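(* Let $G$ be a topological group. For every $G$-space $X$ and every function $f\in\mathrm{RUC}(X)$: (a) $X_f$ is norm compact if and only if $f$ is AP; (b) $X_f$ is weakly compact if and only if $f$ is WAP; (c) $X_f$ is norm fragmented if and only if $f$ is Asplund; (d) $X_f$ is orbitwise light if and only if $f$ is LE; (e) $X_f\subset\mathrm{UC}(G)$ if and only if $f$ is SUC.
   Context: A $G$-space is a Tychonoff space with a continuous left action of $G$. $C(X)$ is the Banach algebra of bounded continuous real functions on $X$ (supremum norm), with $(fg)(x)=f(gx)$. $\mathrm{RUC}(X)$ is the set of $f\in C(X)$ for which $G\to C(X)$, $g\mapsto fg$, is norm continuous. $\mathrm{UC}(G)$ is the algebra of bounded continuous $f\colon G\to\mathbb{R}$ such that for every $\varepsilon>0$ there is a neighborhood $V$ of $e$ with $\sup_{g}|f(vg)-f(g)|<\varepsilon$ and $\sup_g|f(gv)-f(g)|<\varepsilon$ for all $v\in V$. For $f\in\mathrm{RUC}(X)$ let $I=[-\|f\|,\|f\|]$ and $\Omega=I^G$ with the product topology, on which $G$ acts by $(g\omega)(h)=\omega(hg)$. Define $f_\sharp\colon X\to\Omega$, $f_\sharp(x)(g)=f(gx)$, and $X_f:=\mathrm{cl}(f_\sharp(X))\subset\Omega$. Then $X_f\subset\mathrm{RUC}(G)$ and $X_f$ (with the pointwise topology) is a compact $G$-space. In the statement $X_f$ is viewed as a subset of the Banach space $\mathrm{RUC}(G)$; norm compact and weakly compact refer to its norm and weak topologies. $X_f$ is norm fragmented if for every nonempty $A\subset X_f$ and every $\varepsilon>0$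 there is a pointwise open set $O$ such that $O\cap A$ is nonempty and has norm diameter less than $\varepsilon$. $X_f$ is orbitwise light if for every $\psi\in X_f$ the pointwise and norm topologies coincide on the orbit $G\psi$. A function $f\in C(X)$ is AP (resp. WAP) if $\{fg: g\in G\}$ is relatively norm compact (resp. relatively weakly compact) in $C(X)$. $f\in C(X)$ is said to come from a compact $G$-space $Y$ if $f=F\circ\nu$ for some continuous $G$-equivariant $\nu\colon X\to Y$ with dense image and some $F\in C(Y)$. Let $\mu_Y$ be the unique compatible uniformity of $Y$. $f$ is Asplund if it comes from a compact $G$-space $Y$ that is HNS: for every nonempty closed $G$-invariant $Z\subset Y$ and every $\varepsilon\in\mu_Y$ there is a nonempty relatively open $O\subset Z$ such that $gO\times gO\subset\varepsilon$ for all $g\in G$. $f$ is LE if it comes from a compact $G$-space $Y$ that is LE: for every $y_0\in Y$ and $\varepsilon\in\mu_Y$ there is a neighborhood $O$ of $y_0$ such that $(gy_0,gy)\in\varepsilon$ for all $y\in O\cap\mathrm{cl}(Gy_0)$, $g\in G$. $f$ is SUC if it comes from a compact $G$-space $Y$ that is SUC: for every $y_0\in Y$ and $\varepsilon\in\mu_Y$ there is a neighborhood $U$ of $e$ such that $(guy_0,gy_0)\in\varepsilon$ for all $g\in G$, $u\in U$. *)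

theory Defs
  imports "HOL-Analysis.Analysis"
begin

text \<open>
  The acting group is a type of class \<open>topological_group_add\<close>. This class does not assume
  commutativity (nor Hausdorffness), it only writes the group additively: the product \<open>gh\<close> is
  \<open>g + h\<close> and the neutral element \<open>e\<close> is \<open>0\<close>.
\<close>

section \<open>G-spaces and function algebras\<close>

definition G_space :: "'a topology \<Rightarrow> ('g::topological_group_add \<Rightarrow> 'a \<Rightarrow> 'a) \<Rightarrow> bool" where
  "G_space X act \<longleftrightarrow>
     completely_regular_space X \<and> Hausdorff_space X \<and>
     continuous_map (prod_topology euclidean X) X (\<lambda>(g, x). act g x) \<and>
     (\<forall>x\<in>topspace X. act 0 x = x) \<and>
     (\<forall>g h. \<forall>x\<in>topspace X. act (g + h) x = act g (act h x))"

text \<open>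
  \<open>C(X)\<close> is the Banach space \<open>'x \<Rightarrow>\<^sub>C real\<close>. For a continuous action the argument of
  \<open>Bcontfun\<close> below is bounded and continuous, see \<open>apply_translate\<close>.
\<close>

definition translate :: "('g \<Rightarrow> 'x::topological_space \<Rightarrow> 'x) \<Rightarrow> ('x \<Rightarrow>\<^sub>C real) \<Rightarrow> 'g \<Rightarrow> ('x \<Rightarrow>\<^sub>C real)" where
  "translate act f g = Bcontfun (\<lambda>x. f (act g x))"

definition RUC :: "('g::topological_space \<Rightarrow> 'x::topological_space \<Rightarrow> 'x) \<Rightarrow> ('x \<Rightarrow>\<^sub>C real) set" where
  "RUC act = {f. continuous_on UNIV (translate act f)}"

text \<open>\<open>RUC(G)\<close>, with \<open>G\<close> acting on itself by left translations.\<close>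

abbreviation RUC_group :: "('g::topological_group_add \<Rightarrow>\<^sub>C real) set" where
  "RUC_group \<equiv> RUC (+)"

definition UC_group :: "('g::topological_group_add \<Rightarrow>\<^sub>C real) set" where
  "UC_group = {f :: 'g \<Rightarrow>\<^sub>C real. \<forall>\<epsilon>>0. \<forall>\<^sub>F v in nhds 0.
      (SUP g. \<bar>f (v + g) - f g\<bar>) < \<epsilon> \<and> (SUP g. \<bar>f (g + v) - f g\<bar>) < \<epsilon>}"

text \<open>
  The weak topology of a linear subspace \<open>S\<close> of a normed space: the coarsest topology on \<open>S\<close>
  for which all bounded linear functionals on \<open>S\<close> are continuous.
\<close>

definition dual_on :: "'a::real_normed_vector set \<Rightarrow> ('a \<Rightarrow> real) set" where
  "dual_on S = {\<phi>. (\<forall>x\<in>S. \<forall>y\<in>S. \<phi> (x + y) = \<phi> x + \<phi> y) \<and>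
                   (\<forall>c. \<forall>x\<in>S. \<phi> (c *\<^sub>R x) = c * \<phi> x) \<and>
                   (\<exists>K. \<forall>x\<in>S. \<bar>\<phi> x\<bar> \<le> K * norm x)}"

definition weak_topology_on :: "'a::real_normed_vector set \<Rightarrow> 'a topology" where
  "weak_topology_on S = topology_generated_by {{x\<in>S. \<phi> x \<in> U} |\<phi> U. \<phi> \<in> dual_on S \<and> open U}"

definition AP :: "('g \<Rightarrow> 'x::topological_space \<Rightarrow> 'x) \<Rightarrow> ('x \<Rightarrow>\<^sub>C real) \<Rightarrow> bool" where
  "AP act f \<longleftrightarrow> compact (closure (range (translate act f)))"

definition WAP :: "('g \<Rightarrow> 'x::topological_space \<Rightarrow> 'x) \<Rightarrow> ('x \<Rightarrow>\<^sub>C real) \<Rightarrow> bool" where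
  "WAP act f \<longleftrightarrow>
     compactin (weak_topology_on UNIV) (weak_topology_on UNIV closure_of range (translate act f))"

section \<open>The space \<open>X\<^sub>f\<close>\<close>

definition Omega :: "('x::topological_space \<Rightarrow>\<^sub>C real) \<Rightarrow> ('g \<Rightarrow> real) topology" where
  "Omega f = product_topology (\<lambda>_. top_of_set {- norm f .. norm f}) UNIV"

definition Omega_act :: "'g::plus \<Rightarrow> ('g \<Rightarrow> real) \<Rightarrow> ('g \<Rightarrow> real)" where
  "Omega_act g \<omega> = (\<lambda>h. \<omega> (h + g))"

definition f_sharp :: "('g \<Rightarrow> 'x \<Rightarrow> 'x) \<Rightarrow> ('x::topological_space \<Rightarrow>\<^sub>C real) \<Rightarrow> 'x \<Rightarrow> ('g \<Rightarrow> real)" where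
  "f_sharp act f x = (\<lambda>g. f (act g x))"

definition Xf_Omega :: "('g \<Rightarrow> 'x \<Rightarrow> 'x) \<Rightarrow> ('x::topological_space \<Rightarrow>\<^sub>C real) \<Rightarrow> ('g \<Rightarrow> real) set" where
  "Xf_Omega act f = Omega f closure_of range (f_sharp act f)"

text \<open>
  \<open>X\<^sub>f\<close> as a set of elements of the Banach space \<open>'g \<Rightarrow>\<^sub>C real\<close>. Nothing is lost by passing to
  \<open>Xf\<close> when \<open>f \<in> RUC(X)\<close>: see \<open>Xf_subset_RUC_group\<close> and \<open>apply_bcontfun_Xf\<close>.
\<close>

definition Xf :: "('g::topological_space \<Rightarrow> 'x \<Rightarrow> 'x) \<Rightarrow> ('x::topological_space \<Rightarrow>\<^sub>C real) \<Rightarrow> ('g \<Rightarrow>\<^sub>C real) set" where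
  "Xf act f = {\<psi>. apply_bcontfun \<psi> \<in> Xf_Omega act f}"

definition pointwise_topology :: "('a::topological_space \<Rightarrow>\<^sub>C real) topology" where
  "pointwise_topology = pullback_topology UNIV apply_bcontfun (product_topology (\<lambda>_. euclidean) UNIV)"

definition orbit :: "('g::topological_group_add \<Rightarrow>\<^sub>C real) \<Rightarrow> ('g \<Rightarrow>\<^sub>C real) set" where
  "orbit \<psi> = {\<phi>. \<exists>g. apply_bcontfun \<phi> = Omega_act g (apply_bcontfun \<psi>)}"

definition norm_fragmented :: "('a::topological_space \<Rightarrow>\<^sub>C real) set \<Rightarrow> bool" where
  "norm_fragmented K \<longleftrightarrow>
     (\<forall>A. A \<noteq> {} \<and> A \<subseteq> K \<longrightarrow> (\<forall>\<epsilon>>0. \<exists>U. openin pointwise_topology U \<and>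
        U \<inter> A \<noteq> {} \<and> diameter (U \<inter> A) < \<epsilon>))"

definition orbitwise_light :: "('g::topological_group_add \<Rightarrow>\<^sub>C real) set \<Rightarrow> bool" where
  "orbitwise_light K \<longleftrightarrow>
     (\<forall>\<psi>\<in>K. subtopology pointwise_topology (orbit \<psi>) = subtopology euclidean (orbit \<psi>))"

section \<open>Compact G-spaces\<close>

definition compact_G_space :: "'y topology \<Rightarrow> ('g::topological_group_add \<Rightarrow> 'y \<Rightarrow> 'y) \<Rightarrow> bool" where
  "compact_G_space Y actY \<longleftrightarrow> compact_space Y \<and> G_space Y actY"

text \<open>
  Uniformities are filters of entourages, as in the class \<open>uniform_space\<close>; here
  relativised to the carrier \<open>topspace Y\<close>.
\<close>

definition compatible_uniformity :: "'y topology \<Rightarrow> ('y \<times> 'y) filter \<Rightarrow> bool" where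
  "compatible_uniformity Y U \<longleftrightarrow>
     U \<le> principal (topspace Y \<times> topspace Y) \<and>
     (\<forall>E. eventually E U \<longrightarrow> (\<forall>y\<in>topspace Y. E (y, y))) \<and>
     (\<forall>E. eventually E U \<longrightarrow> eventually (\<lambda>(x, y). E (y, x)) U) \<and>
     (\<forall>E. eventually E U \<longrightarrow>
        (\<exists>D. eventually D U \<and> (\<forall>x y z. D (x, y) \<longrightarrow> D (y, z) \<longrightarrow> E (x, z)))) \<and>
     (\<forall>W. openin Y W \<longleftrightarrow>
        W \<subseteq> topspace Y \<and> (\<forall>x\<in>W. eventually (\<lambda>(x', y). x' = x \<longrightarrow> y \<in> W) U))"

text \<open>Well defined for compact Hausdorff \<open>Y\<close>: see \<open>ex1_compatible_uniformity\<close>.\<close>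

definition uniformity_of :: "'y topology \<Rightarrow> ('y \<times> 'y) filter" where
  "uniformity_of Y = (THE U. compatible_uniformity Y U)"

definition HNS_space :: "'y topology \<Rightarrow> ('g \<Rightarrow> 'y \<Rightarrow> 'y) \<Rightarrow> bool" where
  "HNS_space Y actY \<longleftrightarrow>
     (\<forall>Z. Z \<noteq> {} \<and> closedin Y Z \<and> (\<forall>g. actY g ` Z \<subseteq> Z) \<longrightarrow>
        (\<forall>E. eventually E (uniformity_of Y) \<longrightarrow>
           (\<exists>V. openin (subtopology Y Z) V \<and> V \<noteq> {} \<and>
              (\<forall>g. \<forall>x\<in>V. \<forall>y\<in>V. E (actY g x, actY g y)))))"

definition LE_space :: "'y topology \<Rightarrow> ('g \<Rightarrow> 'y \<Rightarrow> 'y) \<Rightarrow> bool" where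
  "LE_space Y actY \<longleftrightarrow>
     (\<forall>y0\<in>topspace Y. \<forall>E. eventually E (uniformity_of Y) \<longrightarrow>
        (\<exists>V. openin Y V \<and> y0 \<in> V \<and>
           (\<forall>y \<in> V \<inter> (Y closure_of range (\<lambda>g. actY g y0)). \<forall>g. E (actY g y0, actY g y))))"

definition SUC_space :: "'y topology \<Rightarrow> ('g::topological_group_add \<Rightarrow> 'y \<Rightarrow> 'y) \<Rightarrow> bool" where
  "SUC_space Y actY \<longleftrightarrow>
     (\<forall>y0\<in>topspace Y. \<forall>E. eventually E (uniformity_of Y) \<longrightarrow>
        (\<forall>\<^sub>F u in nhds 0. \<forall>g. E (actY g (actY u y0), actY g y0)))"

definition comes_from ::
  "('g \<Rightarrow> 'x \<Rightarrow> 'x) \<Rightarrow> ('x::topological_space \<Rightarrow>\<^sub>C real) \<Rightarrow> 'y topology \<Rightarrow> ('g \<Rightarrow> 'y \<Rightarrow> 'y) \<Rightarrow> bool" where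
  "comes_from act f Y actY \<longleftrightarrow>
     (\<exists>\<nu> F. continuous_map euclidean Y \<nu> \<and> (\<forall>g x. \<nu> (act g x) = actY g (\<nu> x)) \<and>
        Y closure_of range \<nu> = topspace Y \<and>
        continuous_map Y euclideanreal F \<and> bounded (F ` topspace Y) \<and>
        (\<forall>x. f x = F (\<nu> x)))"

text \<open>
  HOL cannot quantify existentially over the type of the points of \<open>Y\<close>. The type \<open>'x set set\<close> is
  large enough to represent every compact Hausdorff space in which \<open>X\<close> has a dense image, via
  \<open>y \<mapsto> {A. y \<in> cl (\<nu> A)}\<close>; so the definitions below amount to an existential over spaces \<open>Y\<close> on
  arbitrary types: see \<open>Asplund_if_comes_from\<close>, \<open>LE_if_comes_from\<close>, \<open>SUC_if_comes_from\<close>.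
\<close>

definition Asplund ::
  "('g::topological_group_add \<Rightarrow> 'x \<Rightarrow> 'x) \<Rightarrow> ('x::topological_space \<Rightarrow>\<^sub>C real) \<Rightarrow> bool" where
  "Asplund act f \<longleftrightarrow> (\<exists>(Y :: 'x set set topology) actY.
     compact_G_space Y actY \<and> comes_from act f Y actY \<and> HNS_space Y actY)"

definition LE ::
  "('g::topological_group_add \<Rightarrow> 'x \<Rightarrow> 'x) \<Rightarrow> ('x::topological_space \<Rightarrow>\<^sub>C real) \<Rightarrow> bool" where
  "LE act f \<longleftrightarrow> (\<exists>(Y :: 'x set set topology) actY.
     compact_G_space Y actY \<and> comes_from act f Y actY \<and> LE_space Y actY)"

definition SUC ::
  "('g::topological_group_add \<Rightarrow> 'x \<Rightarrow> 'x) \<Rightarrow> ('x::topological_space \<Rightarrow>\<^sub>C real) \<Rightarrow> bool" where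
  "SUC act f \<longleftrightarrow> (\<exists>(Y :: 'x set set topology) actY.
     compact_G_space Y actY \<and> comes_from act f Y actY \<and> SUC_space Y actY)"

section \<open>\<open>X\<^sub>f\<close> as a subset of \<open>RUC(G)\<close>\<close>

lemma apply_translate:
  assumes "G_space euclidean act"
  shows "apply_bcontfun (translate act f g) x = f (act g x)"
proof -
  have "continuous_on UNIV (\<lambda>x. f (act g x))"
  proof -
    have "continuous_map euclidean (prod_topology euclidean euclidean) (\<lambda>x. (g, x))"
      by (intro continuous_map_pairedI) auto
    then have "continuous_map euclidean euclidean ((\<lambda>(g, x). act g x) \<circ> (\<lambda>x. (g, x)))"
      using assms unfolding G_space_def by (blast intro: continuous_map_compose)
    then have "continuous_on UNIV (act g)"
      by (simp add: o_def)
    then show ?thesis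
      using continuous_on_compose2[OF continuous_on_apply_bcontfun] by blast
  qed
  moreover have "bounded (range (\<lambda>x. f (act g x)))"
    by (rule bounded_subset[OF bounded_apply_bcontfun[of f]]) auto
  ultimately have "(\<lambda>x. f (act g x)) \<in> bcontfun"
    by (simp add: bcontfun_def)
  then show ?thesis
    by (simp add: translate_def Bcontfun_inverse)
qed

lemma Xf_Omega_estimate:
  assumes G: "G_space euclidean act" and \<omega>: "\<omega> \<in> Xf_Omega act f"
  shows "\<bar>\<omega> g\<bar> \<le> norm f"
    and "\<bar>\<omega> (g + h) - \<omega> (g0 + h)\<bar> \<le> dist (translate act f g) (translate act f g0)"
proof -
  have top: "Omega f = subtopology euclidean (PiE UNIV (\<lambda>_. {- norm f .. norm f}))"
    by (simp add: Omega_def flip: euclidean_product_topology subtopology_product_topology)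
  have "\<omega> \<in> topspace (Omega f)"
    using \<omega> unfolding Xf_Omega_def by (meson in_closure_of)
  then have "\<omega> g \<in> {- norm f .. norm f}"
    by (auto simp: Omega_def)
  then show "\<bar>\<omega> g\<bar> \<le> norm f"
    by auto
  let ?C = "{\<omega> :: _ \<Rightarrow> real.
    \<bar>\<omega> (g + h) - \<omega> (g0 + h)\<bar> \<le> dist (translate act f g) (translate act f g0)}"
  have "closed ?C"
    by (auto intro!: closed_Collect_le continuous_intros)
  moreover have "f_sharp act f x \<in> ?C" for x
  proof -
    have "act (k + h) x = act k (act h x)" for k
      using G by (simp add: G_space_def)
    then show ?thesis
      using dist_bounded[of "translate act f g" "act h x" "translate act f g0"]
      by (simp add: f_sharp_def apply_translate[OF G] dist_real_def)
  qed
  then have "range (f_sharp act f) \<subseteq> ?C"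
    by blast
  ultimately have "closure (range (f_sharp act f)) \<subseteq> ?C"
    by (rule closure_minimal[rotated])
  moreover have "\<omega> \<in> closure (range (f_sharp act f))"
    using subsetD[OF closure_of_subtopology_subset \<omega>[unfolded Xf_Omega_def top]] by simp
  ultimately show "\<bar>\<omega> (g + h) - \<omega> (g0 + h)\<bar> \<le> dist (translate act f g) (translate act f g0)"
    by auto
qed

lemma apply_translate_group:
  "apply_bcontfun (translate (+) \<psi> g) h = \<psi> (g + h)" for g :: "'g::topological_group_add"
proof -
  have "continuous_on UNIV (\<lambda>h. \<psi> (g + h))"
    by (rule continuous_on_compose2[OF continuous_on_apply_bcontfun]) (auto intro!: continuous_intros)
  moreover have "bounded (range (\<lambda>h. \<psi> (g + h)))"
    by (rule bounded_subset[OF bounded_apply_bcontfun[of \<psi>]]) auto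
  ultimately show ?thesis
    by (simp add: translate_def Bcontfun_inverse bcontfun_def)
qed

lemma Xf_subset_RUC_group:
  assumes G: "G_space euclidean act" and f: "f \<in> RUC act"
  shows "Xf act f \<subseteq> RUC_group"
proof
  fix \<psi> assume "\<psi> \<in> Xf act f"
  then have *: "dist (translate (+) \<psi> g) (translate (+) \<psi> g0)
      \<le> dist (translate act f g) (translate act f g0)" for g g0
    by (intro dist_bound)
       (simp add: apply_translate_group dist_real_def Xf_def Xf_Omega_estimate(2)[OF G])
  have "(translate act f \<longlongrightarrow> translate act f g0) (at g0)" for g0
    using f by (simp add: RUC_def continuous_on_def)
  then have "(translate (+) \<psi> \<longlongrightarrow> translate (+) \<psi> g0) (at g0)" for g0
    by (rule metric_tendsto_imp_tendsto) (simp add: *)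
  then show "\<psi> \<in> RUC_group"
    by (simp add: RUC_def continuous_on_def)
qed

lemma apply_bcontfun_Xf:
  assumes G: "G_space euclidean act" and f: "f \<in> RUC act"
  shows "apply_bcontfun ` Xf act f = Xf_Omega act f"
proof -
  have "\<omega> \<in> bcontfun" if \<omega>: "\<omega> \<in> Xf_Omega act f" for \<omega>
  proof -
    have "(\<omega> \<longlongrightarrow> \<omega> g0) (at g0)" for g0
    proof -
      have "(translate act f \<longlongrightarrow> translate act f g0) (at g0)"
        using f by (simp add: RUC_def continuous_on_def)
      moreover have "dist (\<omega> g) (\<omega> g0) \<le> dist (translate act f g) (translate act f g0)" for g
        using Xf_Omega_estimate(2)[OF G \<omega>, of g 0 g0] by (simp add: dist_real_def)
      ultimately show ?thesis
        by (blast intro: metric_tendsto_imp_tendsto always_eventually)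
    qed
    moreover have "bounded (range \<omega>)"
      using Xf_Omega_estimate(1)[OF G \<omega>] by (auto simp: bounded_iff)
    ultimately show ?thesis
      by (simp add: bcontfun_def continuous_on_def)
  qed
  then show ?thesis
    unfolding Xf_def by (auto simp: image_iff) (metis Bcontfun_inverse)
qed

section \<open>The unique compatible uniformity of a compact Hausdorff space\<close>

definition nbhd_diag :: "'y topology \<Rightarrow> ('y \<times> 'y) set \<Rightarrow> bool" where
  "nbhd_diag Y W \<longleftrightarrow> openin (prod_topology Y Y) W \<and> (\<forall>y\<in>topspace Y. (y, y) \<in> W)"

definition diag_filter :: "'y topology \<Rightarrow> ('y \<times> 'y) filter" where
  "diag_filter Y = (INF W\<in>{W. nbhd_diag Y W}. principal W)"

lemma nbhd_diag_Int: "nbhd_diag Y V \<Longrightarrow> nbhd_diag Y W \<Longrightarrow> nbhd_diag Y (V \<inter> W)"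
  by (auto simp: nbhd_diag_def)

lemma nbhd_diag_top: "nbhd_diag Y (topspace Y \<times> topspace Y)"
  by (auto simp: nbhd_diag_def openin_prod_Times_iff)

lemma eventually_diag_filter: "eventually E (diag_filter Y) \<longleftrightarrow> (\<exists>W. nbhd_diag Y W \<and> (\<forall>p\<in>W. E p))"
proof -
  have "eventually E (diag_filter Y) \<longleftrightarrow> (\<exists>W\<in>{W. nbhd_diag Y W}. eventually E (principal W))"
    unfolding diag_filter_def
  proof (rule eventually_INF_base)
    show "{W. nbhd_diag Y W} \<noteq> {}"
      using nbhd_diag_top by blast
    fix V W assume "V \<in> {W. nbhd_diag Y W}" "W \<in> {W. nbhd_diag Y W}"
    then show "\<exists>X\<in>{W. nbhd_diag Y W}. principal X \<le> inf (principal V) (principal W)"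
      using nbhd_diag_Int by (intro bexI[of _ "V \<inter> W"]) auto
  qed
  then show ?thesis
    by (auto simp: eventually_principal)
qed

lemma nbhd_diag_square:
  assumes Y: "compact_space Y" "Hausdorff_space Y" and W: "nbhd_diag Y W"
  shows "\<exists>D. nbhd_diag Y D \<and> (\<forall>x y z. (x, y) \<in> D \<longrightarrow> (y, z) \<in> D \<longrightarrow> (x, z) \<in> W)"
proof -
  let ?S = "topspace Y"
  let ?K = "?S \<times> ?S - W"
  have Wo: "openin (prod_topology Y Y) W" and Wd: "\<And>y. y \<in> ?S \<Longrightarrow> (y, y) \<in> W"
    using W by (auto simp: nbhd_diag_def)
  have reg: "regular_space Y"
    by (simp add: Y compact_Hausdorff_imp_regular_space)
  have "closedin (prod_topology Y Y) ?K"
    using Wo by (metis closedin_topspace openin_closedin_eq topspace_prod_topology closedin_diff)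
  then have K: "compactin (prod_topology Y Y) ?K"
    using Y by (simp add: closedin_compact_space compact_space_prod_topology)
  define good where "good O' D \<longleftrightarrow> openin (prod_topology Y Y) O' \<and> nbhd_diag Y D \<and>
     (\<forall>x y z. (x, y) \<in> D \<longrightarrow> (y, z) \<in> D \<longrightarrow> (x, z) \<notin> O')" for O' D
  have ex: "\<exists>O' D. p \<in> O' \<and> good O' D" if "p \<in> ?K" for p
  proof -
    obtain x z where p: "p = (x, z)"
      by fastforce
    with that have xz: "x \<in> ?S" "z \<in> ?S" "x \<noteq> z"
      using Wd by auto
    then obtain P Q where PQ: "openin Y P" "openin Y Q" "x \<in> P" "z \<in> Q" "disjnt P Q"
      using Y(2) unfolding Hausdorff_space_def by blast
    have nb: "\<exists>U V. openin Y U \<and> closedin Y V \<and> a \<in> U \<and> U \<subseteq> V \<and> V \<subseteq> N"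
      if "openin Y N" "a \<in> N" for N a
      using that reg neighbourhood_base_of_closedin[of Y] unfolding neighbourhood_base_of by blast
    obtain A0 A where A: "openin Y A0" "closedin Y A" "x \<in> A0" "A0 \<subseteq> A" "A \<subseteq> P"
      using nb PQ by meson
    obtain B0 B where B: "openin Y B0" "closedin Y B" "z \<in> B0" "B0 \<subseteq> B" "B \<subseteq> Q"
      using nb PQ by meson
    define D where "D = (?S \<times> ?S - A \<times> (?S - P)) - (?S - Q) \<times> B"
    have "closedin (prod_topology Y Y) (A \<times> (?S - P))" "closedin (prod_topology Y Y) ((?S - Q) \<times> B)"
      using A B PQ by (auto simp: closedin_prod_Times_iff closedin_diff)
    moreover have "openin (prod_topology Y Y) (?S \<times> ?S)"
      by (simp add: openin_prod_Times_iff)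
    ultimately have D1: "openin (prod_topology Y Y) D"
      unfolding D_def by (intro openin_diff)
    have D2: "(y, y) \<in> D" if "y \<in> ?S" for y
      using that A B by (auto simp: D_def)
    have D3: "(x', z') \<notin> A0 \<times> B0" if "(x', y) \<in> D" "(y, z') \<in> D" for x' y z'
    proof
      assume "(x', z') \<in> A0 \<times> B0"
      then have "y \<in> P" "y \<in> Q"
        using that A B by (auto simp: D_def)
      then show False
        using PQ by (auto simp: disjnt_iff)
    qed
    have "openin (prod_topology Y Y) (A0 \<times> B0)"
      using A B by (simp add: openin_prod_Times_iff)
    then have "good (A0 \<times> B0) D"
      unfolding good_def nbhd_diag_def by (intro conjI ballI allI impI D1 D2 D3)
    moreover have "p \<in> A0 \<times> B0"
      using A(3) B(3) p by simp
    ultimately show ?thesis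
      by (intro exI conjI)
  qed
  let ?U = "{O'. \<exists>D. good O' D}"
  have "\<exists>\<F>. finite \<F> \<and> \<F> \<subseteq> ?U \<and> ?K \<subseteq> \<Union>\<F>"
  proof (rule compactinD[OF K])
    show "openin (prod_topology Y Y) O'" if "O' \<in> ?U" for O'
      using that by (auto simp: good_def)
    show "?K \<subseteq> \<Union> ?U"
      using ex by blast
  qed
  then obtain \<F> where \<F>: "finite \<F>" "\<F> \<subseteq> ?U" "?K \<subseteq> \<Union>\<F>"
    by blast
  then have "\<forall>O'\<in>\<F>. \<exists>D. good O' D"
    by blast
  from bchoice[OF this] obtain d where d: "\<And>O'. O' \<in> \<F> \<Longrightarrow> good O' (d O')"
    by blast
  define D where "D = (?S \<times> ?S) \<inter> (\<Inter>O'\<in>\<F>. d O')"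
  have "nbhd_diag Y D"
  proof (cases "\<F> = {}")
    case False
    then have "openin (prod_topology Y Y) (\<Inter>O'\<in>\<F>. d O')"
      using \<F>(1) d by (intro openin_INT2) (auto simp: good_def nbhd_diag_def)
    then show ?thesis
      using d by (auto simp: D_def nbhd_diag_def good_def openin_prod_Times_iff openin_Int)
  qed (simp add: D_def nbhd_diag_top)
  moreover have "(x, z) \<in> W" if "(x, y) \<in> D" "(y, z) \<in> D" for x y z
  proof (rule ccontr)
    assume "(x, z) \<notin> W"
    then have "(x, z) \<in> ?K"
      using that by (auto simp: D_def)
    then obtain O' where "O' \<in> \<F>" "(x, z) \<in> O'"
      using \<F>(3) by blast
    then show False
      using d[of O'] that unfolding good_def D_def by blast
  qed
  ultimately show ?thesis
    by blast
qed

lemma compatible_diag_filter: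
  assumes Y: "compact_space Y" "Hausdorff_space Y"
  shows "compatible_uniformity Y (diag_filter Y)"
  unfolding compatible_uniformity_def
proof (intro conjI allI impI)
  let ?S = "topspace Y"
  show "diag_filter Y \<le> principal (?S \<times> ?S)"
    unfolding le_principal eventually_diag_filter using nbhd_diag_top by blast
  fix E
  show "\<exists>D. eventually D (diag_filter Y) \<and> (\<forall>x y z. D (x, y) \<longrightarrow> D (y, z) \<longrightarrow> E (x, z))"
    if E: "eventually E (diag_filter Y)"
  proof -
    obtain W where W: "nbhd_diag Y W" "\<forall>p\<in>W. E p"
      using E by (auto simp: eventually_diag_filter)
    then obtain D where "nbhd_diag Y D" "\<forall>x y z. (x, y) \<in> D \<longrightarrow> (y, z) \<in> D \<longrightarrow> (x, z) \<in> W"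
      using nbhd_diag_square Y by blast
    then show ?thesis
      using W by (intro exI[of _ "\<lambda>p. p \<in> D"]) (auto simp: eventually_diag_filter)
  qed
  show "\<forall>y\<in>?S. E (y, y)" if "eventually E (diag_filter Y)"
    using that by (auto simp: eventually_diag_filter nbhd_diag_def)
  show "eventually (\<lambda>(x, y). E (y, x)) (diag_filter Y)" if E: "eventually E (diag_filter Y)"
  proof -
    obtain W where W: "nbhd_diag Y W" "\<forall>p\<in>W. E p"
      using E by (auto simp: eventually_diag_filter)
    let ?W = "{p \<in> topspace (prod_topology Y Y). (\<lambda>(x, y). (y, x)) p \<in> W}"
    have "openin (prod_topology Y Y) ?W"
      by (rule openin_continuous_map_preimage[where Y="prod_topology Y Y"])
         (use W in \<open>auto simp: nbhd_diag_def case_prod_unfold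
            intro!: continuous_map_pairedI continuous_map_fst continuous_map_snd\<close>)
    then have "nbhd_diag Y ?W"
      using W by (auto simp: nbhd_diag_def)
    then show ?thesis
      using W unfolding eventually_diag_filter by (intro exI[of _ ?W]) auto
  qed
next
  let ?S = "topspace Y"
  fix W
  show "openin Y W \<longleftrightarrow> W \<subseteq> ?S \<and>
      (\<forall>x\<in>W. eventually (\<lambda>(x', y). x' = x \<longrightarrow> y \<in> W) (diag_filter Y))"
  proof (intro iffI conjI ballI)
    assume W: "openin Y W"
    then show "W \<subseteq> ?S"
      by (rule openin_subset)
    fix x assume x: "x \<in> W"
    let ?V = "W \<times> W \<union> (?S - {x}) \<times> ?S"
    have "x \<in> ?S"
      using x W openin_subset by blast
    then have "openin Y (?S - {x})"
      using Y(2) by (blast intro: closedin_Hausdorff_singleton)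
    then have "openin (prod_topology Y Y) ?V"
      using W by (intro openin_Un) (auto simp: openin_prod_Times_iff)
    then have "nbhd_diag Y ?V"
      using x by (auto simp: nbhd_diag_def)
    then show "eventually (\<lambda>(x', y). x' = x \<longrightarrow> y \<in> W) (diag_filter Y)"
      unfolding eventually_diag_filter by (intro exI[of _ ?V]) auto
  next
    assume *: "W \<subseteq> ?S \<and>
      (\<forall>x\<in>W. eventually (\<lambda>(x', y). x' = x \<longrightarrow> y \<in> W) (diag_filter Y))"
    have "\<exists>T. openin Y T \<and> x \<in> T \<and> T \<subseteq> W" if x: "x \<in> W" for x
    proof -
      obtain V where V: "nbhd_diag Y V" "\<forall>(x', y)\<in>V. x' = x \<longrightarrow> y \<in> W"
        using * x unfolding eventually_diag_filter by blast
      have xS: "x \<in> ?S"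
        using * x by blast
      have "openin Y {y \<in> ?S. (x, y) \<in> V}"
        by (rule openin_continuous_map_preimage[where Y="prod_topology Y Y"])
           (use V xS in \<open>auto simp: nbhd_diag_def intro!: continuous_map_pairedI\<close>)
      then show ?thesis
        using V xS by (intro exI[of _ "{y \<in> ?S. (x, y) \<in> V}"]) (auto simp: nbhd_diag_def)
    qed
    then show "openin Y W"
      by (subst openin_subopen) blast
  qed
qed

lemma compatible_imp_diag_filter:
  assumes Y: "compact_space Y" and U: "compatible_uniformity Y U"
  shows "U = diag_filter Y"
proof -
  let ?S = "topspace Y"
  note ax = U[unfolded compatible_uniformity_def le_principal]
  note ax2 = conjunct2[OF ax]
  note ax3 = conjunct2[OF ax2]
  note ax4 = conjunct2[OF ax3]
  have sub: "eventually (\<lambda>p. p \<in> ?S \<times> ?S) U"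
    by (rule conjunct1[OF ax])
  have refl: "\<And>E y. eventually E U \<Longrightarrow> y \<in> ?S \<Longrightarrow> E (y, y)"
    by (rule conjunct1[OF ax2, rule_format])
  have sym: "\<And>E. eventually E U \<Longrightarrow> eventually (\<lambda>(x, y). E (y, x)) U"
    by (rule conjunct1[OF ax3, rule_format])
  have tra: "\<And>E. eventually E U \<Longrightarrow>
        \<exists>D. eventually D U \<and> (\<forall>x y z. D (x, y) \<longrightarrow> D (y, z) \<longrightarrow> E (x, z))"
    by (rule conjunct1[OF ax4, THEN spec, THEN mp])
  have top: "\<And>W. openin Y W \<longleftrightarrow>
        W \<subseteq> ?S \<and> (\<forall>x\<in>W. eventually (\<lambda>(x', y). x' = x \<longrightarrow> y \<in> W) U)"
    by (rule conjunct2[OF ax4, THEN spec])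
  have nb: "\<exists>T. openin Y T \<and> x \<in> T \<and> (\<forall>y\<in>T. E (x, y))" if E: "eventually E U" and x: "x \<in> ?S" for E x
  proof -
    define T where "T = {y \<in> ?S. \<exists>D. eventually D U \<and> (\<forall>z. D (y, z) \<longrightarrow> E (x, z))}"
    have "openin Y T"
      unfolding top
    proof (intro conjI ballI)
      fix y assume "y \<in> T"
      then obtain D where D: "eventually D U" "\<forall>z. D (y, z) \<longrightarrow> E (x, z)"
        by (auto simp: T_def)
      obtain D' where D': "eventually D' U" "\<forall>a b c. D' (a, b) \<longrightarrow> D' (b, c) \<longrightarrow> D (a, c)"
        using tra[OF D(1)] by blast
      show "eventually (\<lambda>(x', z). x' = y \<longrightarrow> z \<in> T) U"
        using D'(1) sub
      proof eventually_elim
        case (elim p)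
        then show ?case
          using D D' by (auto simp: T_def)
      qed
    qed (auto simp: T_def)
    moreover have "x \<in> T"
      using E x by (auto simp: T_def)
    moreover have "E (x, y)" if "y \<in> T" for y
      using that refl by (auto simp: T_def)
    ultimately show ?thesis
      by blast
  qed
  have symtra: "\<exists>D. eventually D U \<and> (\<forall>x y. D (x, y) \<longrightarrow> D (y, x)) \<and>
      (\<forall>x y z. D (x, y) \<longrightarrow> D (y, z) \<longrightarrow> E (x, z))" if E: "eventually E U" for E
  proof -
    obtain D where D: "eventually D U" "\<forall>x y z. D (x, y) \<longrightarrow> D (y, z) \<longrightarrow> E (x, z)"
      using tra[OF E] by blast
    show ?thesis
      using D eventually_conj[OF D(1) sym[OF D(1)]]
      by (intro exI[of _ "\<lambda>p. D p \<and> (case p of (x, y) \<Rightarrow> D (y, x))"]) auto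
  qed
  have "eventually E U \<longleftrightarrow> eventually E (diag_filter Y)" for E
  proof
    assume E: "eventually E U"
    obtain D where D: "eventually D U" "\<forall>x y. D (x, y) \<longrightarrow> D (y, x)"
        "\<forall>x y z. D (x, y) \<longrightarrow> D (y, z) \<longrightarrow> E (x, z)"
      using symtra[OF E] by blast
    obtain T where T: "\<And>x. x \<in> ?S \<Longrightarrow> openin Y (T x) \<and> x \<in> T x \<and> (\<forall>y\<in>T x. D (x, y))"
      using nb[OF D(1)] by metis
    have "nbhd_diag Y (\<Union>x\<in>?S. T x \<times> T x)"
      using T by (auto simp: nbhd_diag_def openin_prod_Times_iff intro!: openin_Union)
    moreover have "\<forall>p\<in>(\<Union>x\<in>?S. T x \<times> T x). E p"
      using T D by blast
    ultimately show "eventually E (diag_filter Y)"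
      unfolding eventually_diag_filter by blast
  next
    assume "eventually E (diag_filter Y)"
    then obtain W where W: "openin (prod_topology Y Y) W" "\<And>y. y \<in> ?S \<Longrightarrow> (y, y) \<in> W" "\<And>p. p \<in> W \<Longrightarrow> E p"
      by (auto simp: eventually_diag_filter nbhd_diag_def)
    define good where "good T D \<longleftrightarrow> openin Y T \<and> eventually D U \<and>
        (\<forall>y z. y \<in> T \<longrightarrow> D (y, z) \<longrightarrow> z \<in> ?S \<longrightarrow> (y, z) \<in> W)" for T D
    have ex: "\<exists>T D. y \<in> T \<and> good T D" if y: "y \<in> ?S" for y
    proof -
      obtain A B where AB: "openin Y A" "openin Y B" "y \<in> A" "y \<in> B" "A \<times> B \<subseteq> W"
        using W(1)[unfolded openin_prod_topology_alt, rule_format, OF W(2)[OF y]] by blast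
      have "eventually (\<lambda>(x', z). x' = y \<longrightarrow> z \<in> B) U"
        using AB(2,4) unfolding top[of B] by (elim conjE) (rule bspec)
      from tra[OF this] obtain D where D: "eventually D U"
          "\<And>b z. D (y, b) \<Longrightarrow> D (b, z) \<Longrightarrow> z \<in> B"
        by auto
      obtain T where T: "openin Y T" "y \<in> T" "\<forall>t\<in>T. D (y, t)"
        using nb[OF D(1) y] by blast
      have "(t, z) \<in> W" if "t \<in> T \<inter> A" "D (t, z)" for t z
        using that T(3) D(2) AB(5) by blast
      then have "good (T \<inter> A) D"
        unfolding good_def using openin_Int[OF T(1) AB(1)] D(1) by simp
      moreover have "y \<in> T \<inter> A"
        using T(2) AB(3) by simp
      ultimately show ?thesis
        by (intro exI conjI)
    qed
    have "\<exists>\<F>. finite \<F> \<and> \<F> \<subseteq> {T. \<exists>D. good T D} \<and> ?S \<subseteq> \<Union>\<F>"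
    proof (rule compactinD)
      show "compactin Y ?S"
        using Y by (simp add: compact_space_def)
      show "openin Y T" if "T \<in> {T. \<exists>D. good T D}" for T
        using that by (auto simp: good_def)
      show "?S \<subseteq> \<Union> {T. \<exists>D. good T D}"
        using ex by blast
    qed
    then obtain \<F> where \<F>: "finite \<F>" "\<F> \<subseteq> {T. \<exists>D. good T D}" "?S \<subseteq> \<Union>\<F>"
      by blast
    then have "\<forall>T\<in>\<F>. \<exists>D. good T D"
      by blast
    from bchoice[OF this] obtain d where d: "\<And>T. T \<in> \<F> \<Longrightarrow> good T (d T)"
      by blast
    have "eventually (\<lambda>p. \<forall>T\<in>\<F>. d T p) U"
      using d by (intro eventually_ball_finite[OF \<F>(1)]) (auto simp: good_def)
    with sub show "eventually E U"
    proof eventually_elim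
      case (elim p)
      obtain y z where p: "p = (y, z)"
        by fastforce
      then obtain T where "T \<in> \<F>" "y \<in> T"
        using elim \<F> by blast
      then have "(y, z) \<in> W"
        using d[of T] elim p unfolding good_def by blast
      then show ?case
        using W(3) p by blast
    qed
  qed
  then show ?thesis
    by (simp add: filter_eq_iff)
qed

lemma ex1_compatible_uniformity:
  assumes "compact_space Y" "Hausdorff_space Y"
  shows "\<exists>!U. compatible_uniformity Y U"
  using assms compatible_diag_filter compatible_imp_diag_filter by metis

lemma eventually_uniformity_of:
  assumes "compact_space Y" "Hausdorff_space Y"
  shows "eventually E (uniformity_of Y) \<longleftrightarrow>
    (\<exists>W. openin (prod_topology Y Y) W \<and> (\<forall>y\<in>topspace Y. (y, y) \<in> W) \<and> (\<forall>p\<in>W. E p))"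
proof -
  have "uniformity_of Y = diag_filter Y"
    unfolding uniformity_of_def
    using assms compatible_diag_filter compatible_imp_diag_filter by (intro the_equality) auto
  then show ?thesis
    by (simp add: eventually_diag_filter nbhd_diag_def)
qed

lemma eventually_uniformity_of_pullback:
  assumes Y: "compact_space Y" "Hausdorff_space Y" and Z: "compact_space Z" "Hausdorff_space Z"
    and e: "continuous_map Y Z e" and E: "eventually E (uniformity_of Z)"
  shows "eventually (\<lambda>(x, y). E (e x, e y)) (uniformity_of Y)"
proof -
  obtain W where W: "openin (prod_topology Z Z) W" "\<forall>y\<in>topspace Z. (y, y) \<in> W" "\<forall>p\<in>W. E p"
    using E by (auto simp: eventually_uniformity_of[OF Z])
  let ?V = "{p \<in> topspace (prod_topology Y Y). (\<lambda>(x, y). (e x, e y)) p \<in> W}"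
  have "continuous_map (prod_topology Y Y) (prod_topology Z Z) (\<lambda>(x, y). (e x, e y))"
    using e by (simp add: continuous_map_prod_top)
  then have "openin (prod_topology Y Y) ?V"
    using W(1) by (rule openin_continuous_map_preimage)
  moreover have "(y, y) \<in> ?V" if "y \<in> topspace Y" for y
    using that W e by (auto simp: continuous_map_def Pi_iff)
  ultimately show ?thesis
    unfolding eventually_uniformity_of[OF Y] using W by (intro exI[of _ ?V]) auto
qed

section \<open>Independence of the type of points\<close>

context
  fixes Y :: "'y topology" and Z :: "'z topology" and e i
    and actY :: "'g::topological_group_add \<Rightarrow> 'y \<Rightarrow> 'y"
  assumes hom: "homeomorphic_maps Y Z e i" and cY: "compact_G_space Y actY"
begin

private abbreviation "actZ \<equiv> (\<lambda>g z. e (actY g (i z)))"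

lemma transport_basic:
  shows "continuous_map Y Z e" "continuous_map Z Y i"
    and "\<And>y. y \<in> topspace Y \<Longrightarrow> i (e y) = y" "\<And>z. z \<in> topspace Z \<Longrightarrow> e (i z) = z"
    and "\<And>y. y \<in> topspace Y \<Longrightarrow> e y \<in> topspace Z" "\<And>z. z \<in> topspace Z \<Longrightarrow> i z \<in> topspace Y"
    and "compact_space Y" "Hausdorff_space Y" "compact_space Z" "Hausdorff_space Z"
    and "completely_regular_space Z"
    and "\<And>g y. y \<in> topspace Y \<Longrightarrow> actY g y \<in> topspace Y"
proof -
  have YZ: "Y homeomorphic_space Z"
    using hom homeomorphic_space_def by blast
  show "compact_space Y" "Hausdorff_space Y"
    using cY by (auto simp: compact_G_space_def G_space_def)
  then show "compact_space Z" "Hausdorff_space Z"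
    using YZ by (simp_all add: homeomorphic_compact_space homeomorphic_Hausdorff_space)
  show "completely_regular_space Z"
    using YZ cY homeomorphic_completely_regular_space by (auto simp: compact_G_space_def G_space_def)
  show c: "continuous_map Y Z e" "continuous_map Z Y i"
    and "\<And>y. y \<in> topspace Y \<Longrightarrow> i (e y) = y" "\<And>z. z \<in> topspace Z \<Longrightarrow> e (i z) = z"
    using hom by (auto simp: homeomorphic_maps_def)
  then show "\<And>y. y \<in> topspace Y \<Longrightarrow> e y \<in> topspace Z" "\<And>z. z \<in> topspace Z \<Longrightarrow> i z \<in> topspace Y"
    by (auto simp: continuous_map_def)
  have "continuous_map (prod_topology euclidean Y) Y (\<lambda>(g, x). actY g x)"
    using cY by (simp add: compact_G_space_def G_space_def)
  then show "actY g y \<in> topspace Y" if "y \<in> topspace Y" for g y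
    using that by (auto simp: Pi_iff dest!: continuous_map_funspace)
qed

lemma transport_compact_G_space: "compact_G_space Z actZ"
proof -
  have Y: "continuous_map (prod_topology euclidean Y) Y (\<lambda>(g, x). actY g x)"
    using cY by (simp add: compact_G_space_def G_space_def)
  have "continuous_map (prod_topology euclidean Z) (prod_topology euclidean Y) (\<lambda>(g, z). (g, i z))"
    using transport_basic(2) by (simp add: continuous_map_prod_top)
  then have "continuous_map (prod_topology euclidean Z) Z
      (e \<circ> ((\<lambda>(g, x). actY g x) \<circ> (\<lambda>(g, z). (g, i z))))"
    using Y transport_basic(1) by (blast intro: continuous_map_compose)
  moreover have "e \<circ> ((\<lambda>(g, x). actY g x) \<circ> (\<lambda>(g, z). (g, i z))) = (\<lambda>(g, z). e (actY g (i z)))"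
    by auto
  ultimately show ?thesis
    using cY transport_basic by (simp add: compact_G_space_def G_space_def)
qed

lemma transport_comes_from:
  assumes "comes_from act f Y actY"
  shows "comes_from act f Z actZ"
proof -
  obtain \<nu> F where \<nu>: "continuous_map euclidean Y \<nu>" "\<And>g x. \<nu> (act g x) = actY g (\<nu> x)"
      "Y closure_of range \<nu> = topspace Y"
    and F: "continuous_map Y euclideanreal F" "bounded (F ` topspace Y)" "\<And>x. f x = F (\<nu> x)"
    using assms unfolding comes_from_def by blast
  have \<nu>Y: "\<nu> x \<in> topspace Y" for x
    using \<nu>(1) by (auto simp: continuous_map_def)
  have "homeomorphic_map Y Z e"
    using hom homeomorphic_maps_map by blast
  then have "Z closure_of (e ` range \<nu>) = e ` (Y closure_of range \<nu>)"
    using \<nu>Y by (intro homeomorphic_map_closure_of) auto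
  also have "\<dots> = topspace Z"
    using \<nu>(3) \<open>homeomorphic_map Y Z e\<close> by (simp add: homeomorphic_imp_surjective_map)
  finally have "Z closure_of range (e \<circ> \<nu>) = topspace Z"
    by (simp add: image_comp)
  moreover have "F ` i ` topspace Z \<subseteq> F ` topspace Y"
    using transport_basic(6) by blast
  then have "bounded ((F \<circ> i) ` topspace Z)"
    using F(2) bounded_subset by (metis image_comp)
  moreover have "continuous_map euclidean Z (e \<circ> \<nu>)" "continuous_map Z euclideanreal (F \<circ> i)"
    using \<nu>(1) F(1) transport_basic(1,2) by (blast intro: continuous_map_compose)+
  ultimately show ?thesis
    unfolding comes_from_def using \<nu> F \<nu>Y transport_basic(3)
    by (intro exI[of _ "e \<circ> \<nu>"] exI[of _ "F \<circ> i"]) simp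
qed

lemma transport_HNS:
  assumes "HNS_space Y actY"
  shows "HNS_space Z actZ"
  unfolding HNS_space_def
proof (intro allI impI)
  fix K E
  assume K: "K \<noteq> {} \<and> closedin Z K \<and> (\<forall>g. actZ g ` K \<subseteq> K)" and E: "eventually E (uniformity_of Z)"
  let ?K = "{y \<in> topspace Y. e y \<in> K}"
  have KZ: "K \<subseteq> topspace Z"
    using K closedin_subset by blast
  have "?K \<noteq> {}"
    using K KZ transport_basic(4,6) by force
  moreover have "closedin Y ?K"
    using K transport_basic(1) closedin_continuous_map_preimage by blast
  moreover have "actY g ` ?K \<subseteq> ?K" for g
    using K transport_basic(3,12) by force
  moreover have "eventually (\<lambda>(x, y). E (e x, e y)) (uniformity_of Y)"
    by (rule eventually_uniformity_of_pullback[OF transport_basic(7-10) transport_basic(1) E])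
  ultimately have "\<exists>V. openin (subtopology Y ?K) V \<and> V \<noteq> {} \<and>
      (\<forall>g. \<forall>x\<in>V. \<forall>y\<in>V. (\<lambda>(x, y). E (e x, e y)) (actY g x, actY g y))"
    using assms unfolding HNS_space_def by (elim allE[of _ ?K]) blast
  then obtain V where V: "openin (subtopology Y ?K) V" "V \<noteq> {}"
      "\<forall>g. \<forall>x\<in>V. \<forall>y\<in>V. E (e (actY g x), e (actY g y))"
    by auto
  obtain T where T: "openin Y T" "V = T \<inter> ?K"
    using V(1) by (auto simp: openin_subtopology)
  let ?T = "{z \<in> topspace Z. i z \<in> T}"
  have "openin Z ?T"
    using T transport_basic(2) openin_continuous_map_preimage by blast
  then have "openin (subtopology Z K) (?T \<inter> K)"
    by (auto simp: openin_subtopology)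
  moreover have "i z \<in> V" if "z \<in> ?T \<inter> K" for z
    using that T transport_basic(4,6) by auto
  moreover have "e y \<in> ?T \<inter> K" if "y \<in> V" for y
    using that T transport_basic(3,5) by auto
  ultimately show "\<exists>V. openin (subtopology Z K) V \<and> V \<noteq> {} \<and>
        (\<forall>g. \<forall>x\<in>V. \<forall>y\<in>V. E (actZ g x, actZ g y))"
    using V(2,3) by (intro exI[of _ "?T \<inter> K"]) blast
qed

lemma transport_LE:
  assumes "LE_space Y actY"
  shows "LE_space Z actZ"
  unfolding LE_space_def
proof (intro allI impI ballI)
  fix z0 E
  assume z0: "z0 \<in> topspace Z" and E: "eventually E (uniformity_of Z)"
  have "eventually (\<lambda>(x, y). E (e x, e y)) (uniformity_of Y)"
    by (rule eventually_uniformity_of_pullback[OF transport_basic(7-10) transport_basic(1) E])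
  then have "\<exists>V. openin Y V \<and> i z0 \<in> V \<and> (\<forall>y \<in> V \<inter> (Y closure_of range (\<lambda>g. actY g (i z0))).
      \<forall>g. (\<lambda>(x, y). E (e x, e y)) (actY g (i z0), actY g y))"
    using assms transport_basic(6)[OF z0] unfolding LE_space_def by blast
  then obtain V where V: "openin Y V" "i z0 \<in> V"
      "\<forall>y \<in> V \<inter> (Y closure_of range (\<lambda>g. actY g (i z0))). \<forall>g. E (e (actY g (i z0)), e (actY g y))"
    by auto
  let ?V = "{z \<in> topspace Z. i z \<in> V}"
  have "homeomorphic_map Z Y i"
    using hom homeomorphic_maps_map homeomorphic_maps_sym by blast
  moreover have R: "range (\<lambda>g. actZ g z0) \<subseteq> topspace Z"
    using z0 transport_basic by auto
  ultimately have "Y closure_of (i ` range (\<lambda>g. actZ g z0)) = i ` (Z closure_of range (\<lambda>g. actZ g z0))"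
    by (intro homeomorphic_map_closure_of)
  moreover have "i ` range (\<lambda>g. actZ g z0) = range (\<lambda>g. actY g (i z0))"
    using transport_basic(3,6,12) z0 by (auto simp: image_image)
  ultimately have "i ` (Z closure_of range (\<lambda>g. actZ g z0)) = Y closure_of range (\<lambda>g. actY g (i z0))"
    by simp
  moreover have "openin Z ?V"
    using V transport_basic(2) openin_continuous_map_preimage by blast
  ultimately show "\<exists>V. openin Z V \<and> z0 \<in> V \<and>
      (\<forall>y \<in> V \<inter> (Z closure_of range (\<lambda>g. actZ g z0)). \<forall>g. E (actZ g z0, actZ g y))"
    using V z0 by (intro exI[of _ ?V]) auto
qed

lemma transport_SUC:
  assumes "SUC_space Y actY"
  shows "SUC_space Z actZ"
  unfolding SUC_space_def
proof (intro allI impI ballI)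
  fix z0 E
  assume z0: "z0 \<in> topspace Z" and E: "eventually E (uniformity_of Z)"
  have "eventually (\<lambda>(x, y). E (e x, e y)) (uniformity_of Y)"
    by (rule eventually_uniformity_of_pullback[OF transport_basic(7-10) transport_basic(1) E])
  then have "\<forall>\<^sub>F u in nhds 0. \<forall>g.
      (\<lambda>(x, y). E (e x, e y)) (actY g (actY u (i z0)), actY g (i z0))"
    using assms transport_basic(6)[OF z0] unfolding SUC_space_def by blast
  then show "\<forall>\<^sub>F u in nhds 0. \<forall>g. E (actZ g (actZ u z0), actZ g z0)"
    using transport_basic(3,6,12) z0 by simp
qed

end

lemma dense_image_small:
  fixes Y :: "'y topology" and \<nu> :: "'x::topological_space \<Rightarrow> 'y"
  assumes H: "Hausdorff_space Y" and \<nu>: "Y closure_of range \<nu> = topspace Y"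
  shows "\<exists>(Z :: 'x set set topology) e i. homeomorphic_maps Y Z e i"
proof -
  define e where "e y = {A. y \<in> Y closure_of (\<nu> ` A)}" for y
  have inj: "inj_on e (topspace Y)"
  proof (rule inj_onI, rule ccontr)
    fix y y' assume yy: "y \<in> topspace Y" "y' \<in> topspace Y" "e y = e y'" "y \<noteq> y'"
    obtain P Q where PQ: "openin Y P" "openin Y Q" "y \<in> P" "y' \<in> Q" "disjnt P Q"
      using H[unfolded Hausdorff_space_def] yy(1,2,4) by blast
    have "\<exists>v \<in> \<nu> ` (\<nu> -` P). v \<in> T" if "y \<in> T" "openin Y T" for T
    proof -
      have "openin Y (T \<inter> P)" "y \<in> T \<inter> P"
        using that PQ by auto
      moreover have "y \<in> Y closure_of range \<nu>"
        using \<nu> yy(1) by simp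
      ultimately obtain v where "v \<in> range \<nu>" "v \<in> T \<inter> P"
        by (meson in_closure_of)
      then show ?thesis
        by blast
    qed
    then have "y \<in> Y closure_of (\<nu> ` (\<nu> -` P))"
      using yy(1) unfolding in_closure_of by blast
    then have "\<nu> -` P \<in> e y"
      by (simp add: e_def)
    moreover have "\<nu> -` P \<notin> e y'"
    proof
      assume "\<nu> -` P \<in> e y'"
      then have "y' \<in> Y closure_of (\<nu> ` (\<nu> -` P))"
        by (simp add: e_def)
      then obtain v where "v \<in> \<nu> ` (\<nu> -` P)" "v \<in> Q"
        using PQ(2,4) by (meson in_closure_of)
      then show False
        using PQ(5) by (auto simp: disjnt_iff)
    qed
    ultimately show False
      using yy(3) by blast
  qed
  define i where "i = inv_into (topspace Y) e"
  define Z where "Z = pullback_topology (e ` topspace Y) i Y"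
  have ie: "i (e y) = y" if "y \<in> topspace Y" for y
    using that inj by (simp add: i_def)
  have "topspace Z = e ` topspace Y"
    using ie by (auto simp: Z_def topspace_pullback_topology)
  moreover have "continuous_map Z Y (id \<circ> i)"
    unfolding Z_def by (rule continuous_map_pullback) simp
  moreover have "continuous_map Y Z e"
    unfolding Z_def
  proof (rule continuous_map_pullback')
    show "continuous_map Y Y (i \<circ> e)"
      using ie by (auto intro: continuous_map_eq[of Y Y id])
  qed auto
  ultimately have "homeomorphic_maps Y Z e i"
    using ie by (auto simp: homeomorphic_maps_def)
  then show ?thesis
    by blast
qed

lemma comes_from_small:
  fixes Y :: "'y topology" and act :: "'g::topological_group_add \<Rightarrow> 'x::topological_space \<Rightarrow> 'x"
  assumes Y: "compact_G_space Y actY" and f: "comes_from act f Y actY"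
  obtains e i and Z :: "'x set set topology" where "homeomorphic_maps Y Z e i"
proof -
  obtain \<nu> :: "'x \<Rightarrow> 'y" where "Y closure_of range \<nu> = topspace Y"
    using f unfolding comes_from_def by blast
  moreover have "Hausdorff_space Y"
    using Y by (simp add: compact_G_space_def G_space_def)
  ultimately show ?thesis
    using dense_image_small that by blast
qed

theorem Asplund_if_comes_from:
  fixes Y :: "'y topology" and act :: "'g::topological_group_add \<Rightarrow> 'x::topological_space \<Rightarrow> 'x"
  assumes Y: "compact_G_space Y actY" "comes_from act f Y actY" and P: "HNS_space Y actY"
  shows "Asplund act f"
proof (rule comes_from_small[OF Y])
  fix e i and Z :: "'x set set topology"
  assume h: "homeomorphic_maps Y Z e i"
  show ?thesis
    unfolding Asplund_def
    using transport_compact_G_space[OF h Y(1)] transport_comes_from[OF h Y] transport_HNS[OF h Y(1) P]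
    by (intro exI conjI)
qed

theorem LE_if_comes_from:
  fixes Y :: "'y topology" and act :: "'g::topological_group_add \<Rightarrow> 'x::topological_space \<Rightarrow> 'x"
  assumes Y: "compact_G_space Y actY" "comes_from act f Y actY" and P: "LE_space Y actY"
  shows "LE act f"
proof (rule comes_from_small[OF Y])
  fix e i and Z :: "'x set set topology"
  assume h: "homeomorphic_maps Y Z e i"
  show ?thesis
    unfolding LE_def
    using transport_compact_G_space[OF h Y(1)] transport_comes_from[OF h Y] transport_LE[OF h Y(1) P]
    by (intro exI conjI)
qed

theorem SUC_if_comes_from:
  fixes Y :: "'y topology" and act :: "'g::topological_group_add \<Rightarrow> 'x::topological_space \<Rightarrow> 'x"
  assumes Y: "compact_G_space Y actY" "comes_from act f Y actY" and P: "SUC_space Y actY"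
  shows "SUC act f"
proof (rule comes_from_small[OF Y])
  fix e i and Z :: "'x set set topology"
  assume h: "homeomorphic_maps Y Z e i"
  show ?thesis
    unfolding SUC_def
    using transport_compact_G_space[OF h Y(1)] transport_comes_from[OF h Y] transport_SUC[OF h Y(1) P]
    by (intro exI conjI)
qed

end

theory Submission
  imports Defs
begin

text \<open>
  \<open>X\<^sub>f\<close> itself, with the pointwise topology, is a compact G-space from which \<open>f\<close> comes, and it is a
  factor of every compact G-space \<open>Y\<close> from which \<open>f\<close> comes. Each of (c), (d), (e) therefore amounts to
  translating a property of the uniformity of \<open>X\<^sub>f\<close> into norms and to pushing the property from \<open>Y\<close>
  down to \<open>X\<^sub>f\<close>; for (c) and (d) the push-down uses minimal closed sets over a given set of points.

  For (a) and (b), the kernel \<open>(\<omega>, g) \<mapsto> \<omega> g\<close> relates \<open>X\<^sub>f\<close> and the translates of \<open>f\<close> symmetrically.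
  Total boundedness of bounded kernels is symmetric. Weak compactness is symmetric by Grothendieck's
  theorem in the following form: for a bounded separately continuous kernel \<open>h\<close> on a product of compact
  spaces \<open>P\<close> and \<open>T\<close>, the map \<open>p \<mapsto> h p\<close> is continuous into the weak topology. No measure theory is
  needed: bounded convergence follows from Dini's theorem and the modularity of the variation of a
  functional.
\<close>

section \<open>Continuity of functionals on pointwise compact families\<close>

text \<open>The functionals in (b) are given on C(X) or RUC(G), not on C(T) for a compact T. The
  bounded convergence argument therefore runs on an arbitrary vector lattice of continuous functions
  on T, to which such a functional is pulled back directly. The parameter space must be compact, so
  X and G are replaced by the closure of their point evaluations; its members are still bounded
  linear functionals, which makes their pairing with weakly compact sets separately continuous.

  The obstacle in (c) is that an open subset of Y may meet the preimage of a set under the factor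
  map \<phi> without containing a whole fibre, and then its image need not contain any relatively
  open set. If M is minimal among the closed sets meeting all fibres over the given points and N is
  an open set meeting M, then M - N is closed and smaller, so it misses one of these fibres. The
  complement of its image is then a nonempty open set over which M lies inside N.\<close>

lemma continuous_map_real_iff:
  "continuous_map X euclideanreal u \<longleftrightarrow>
    (\<forall>x\<in>topspace X. \<forall>e>0. \<exists>U. openin X U \<and> x \<in> U \<and> (\<forall>y\<in>U. \<bar>u y - u x\<bar> < e))"
  using Met_TC.continuous_map_to_metric[where X=X and f=u]
  by (simp add: dist_real_def abs_minus_commute)

text \<open>\<open>L\<close> may be smaller than C(T), so a functional known only on a subspace of
  bounded functions can be used without extending it. Through the case \<open>b = 0\<close>,
  \<open>\<phi>_bound\<close> makes \<open>\<phi>\<close> depend only on values on the carrier of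
  \<open>T\<close>.\<close>

locale lattice_functional =
  fixes T :: "'t topology" and L :: "('t \<Rightarrow> real) set" and \<phi> :: "('t \<Rightarrow> real) \<Rightarrow> real" and K :: real
  assumes compact_T: "compact_space T"
    and L_continuous: "u \<in> L \<Longrightarrow> continuous_map T euclideanreal u"
    and L_add: "u \<in> L \<Longrightarrow> v \<in> L \<Longrightarrow> (\<lambda>t. u t + v t) \<in> L"
    and L_scale: "u \<in> L \<Longrightarrow> (\<lambda>t. c * u t) \<in> L"
    and L_abs: "u \<in> L \<Longrightarrow> (\<lambda>t. \<bar>u t\<bar>) \<in> L"
    and \<phi>_add: "u \<in> L \<Longrightarrow> v \<in> L \<Longrightarrow> \<phi> (\<lambda>t. u t + v t) = \<phi> u + \<phi> v"
    and \<phi>_scale: "u \<in> L \<Longrightarrow> \<phi> (\<lambda>t. c * u t) = c * \<phi> u"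
    and \<phi>_bound: "u \<in> L \<Longrightarrow> (\<And>t. t \<in> topspace T \<Longrightarrow> \<bar>u t\<bar> \<le> b) \<Longrightarrow> \<bar>\<phi> u\<bar> \<le> K * b"
    and K_nonneg: "0 \<le> K"
begin

lemma L_diff:
  assumes "u \<in> L" "v \<in> L"
  shows "(\<lambda>t. u t - v t) \<in> L"
  using L_add[OF assms(1) L_scale[OF assms(2), of "-1"]] by simp

lemma \<phi>_diff:
  assumes "u \<in> L" "v \<in> L"
  shows "\<phi> (\<lambda>t. u t - v t) = \<phi> u - \<phi> v"
  using \<phi>_add[OF assms(1) L_scale[OF assms(2), of "-1"]] \<phi>_scale[OF assms(2), of "-1"] by simp

lemma L_max:
  assumes "u \<in> L" "v \<in> L"
  shows "(\<lambda>t. max (u t) (v t)) \<in> L"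
proof -
  have "(\<lambda>t. max (u t) (v t)) = (\<lambda>t. (1/2) * ((u t + v t) + \<bar>u t - v t\<bar>))"
    by (auto simp: max_def abs_if)
  then show ?thesis
    using assms by (simp only:) (intro L_scale L_add L_abs L_diff)
qed

lemma L_min:
  assumes "u \<in> L" "v \<in> L"
  shows "(\<lambda>t. min (u t) (v t)) \<in> L"
proof -
  have "(\<lambda>t. min (u t) (v t)) = (\<lambda>t. (1/2) * ((u t + v t) - \<bar>u t - v t\<bar>))"
    by (auto simp: min_def abs_if)
  then show ?thesis
    using assms by (simp only:) (intro L_scale L_add L_abs L_diff)
qed

section \<open>The modulus of a functional on a vector lattice\<close>

definition dominated :: "('t \<Rightarrow> real) \<Rightarrow> ('t \<Rightarrow> real) set" where
  "dominated h = {k \<in> L. \<forall>t\<in>topspace T. \<bar>k t\<bar> \<le> h t}"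

text \<open>The Riesz-Kantorovich formula: for nonnegative \<open>h\<close> in \<open>L\<close> this
  is the value at \<open>h\<close> of the modulus of \<open>\<phi>\<close> in the order
  dual.\<close>

definition variation :: "('t \<Rightarrow> real) \<Rightarrow> real" where
  "variation h = (SUP k\<in>dominated h. \<phi> k)"

definition nonneg_in_L :: "('t \<Rightarrow> real) \<Rightarrow> bool" where
  "nonneg_in_L h \<longleftrightarrow> h \<in> L \<and> (\<forall>t\<in>topspace T. 0 \<le> h t)"

lemma L_bounded:
  assumes "h \<in> L"
  obtains b where "\<And>t. t \<in> topspace T \<Longrightarrow> h t \<le> b"
proof -
  have "compactin euclideanreal (h ` topspace T)"
    using L_continuous[OF assms] compact_T unfolding compact_space_def by (rule image_compactin[rotated])
  then have "bounded (h ` topspace T)"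
    by (simp add: compact_imp_bounded)
  then obtain b where "\<forall>x\<in>h ` topspace T. norm x \<le> b"
    by (auto simp: bounded_iff)
  then show ?thesis
    by (intro that[of b]) fastforce
qed

lemma dominated_bdd:
  assumes "h \<in> L"
  shows "bdd_above (\<phi> ` dominated h)"
proof -
  obtain b where b: "\<And>t. t \<in> topspace T \<Longrightarrow> h t \<le> b"
    using L_bounded[OF assms] by blast
  have "\<phi> k \<le> K * b" if "k \<in> dominated h" for k
    using \<phi>_bound[of k b] that b by (force simp: dominated_def)
  then show ?thesis
    by (auto simp: bdd_above_def)
qed

lemma variation_upper:
  assumes "h \<in> L" "k \<in> dominated h"
  shows "\<phi> k \<le> variation h"
  unfolding variation_def using dominated_bdd[OF assms(1)] assms(2) by (rule cSUP_upper[rotated])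

lemma dominated_nonempty: "nonneg_in_L h \<Longrightarrow> h \<in> dominated h"
  by (simp add: dominated_def nonneg_in_L_def)

lemma variation_least:
  assumes "nonneg_in_L h" "\<And>k. k \<in> dominated h \<Longrightarrow> \<phi> k \<le> b"
  shows "variation h \<le> b"
  unfolding variation_def using assms dominated_nonempty by (intro cSUP_least) auto

lemma abs_\<phi>_le_variation:
  assumes "u \<in> L"
  shows "\<bar>\<phi> u\<bar> \<le> variation (\<lambda>t. \<bar>u t\<bar>)"
proof -
  have "u \<in> dominated (\<lambda>t. \<bar>u t\<bar>)" "(\<lambda>t. -1 * u t) \<in> dominated (\<lambda>t. \<bar>u t\<bar>)"
    using assms L_scale[OF assms, of "-1"] by (auto simp: dominated_def)
  from this[THEN variation_upper[OF L_abs[OF assms]]] show ?thesis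
    using \<phi>_scale[OF assms, of "-1"] by simp
qed

lemma variation_mono:
  assumes "nonneg_in_L h" "h' \<in> L" "\<And>t. t \<in> topspace T \<Longrightarrow> h t \<le> h' t"
  shows "variation h \<le> variation h'"
  using assms by (intro variation_least variation_upper) (force simp: dominated_def)+

lemma variation_le:
  assumes "nonneg_in_L h" "\<And>t. t \<in> topspace T \<Longrightarrow> h t \<le> b"
  shows "variation h \<le> K * b"
proof (rule variation_least[OF assms(1)])
  fix k assume "k \<in> dominated h"
  then show "\<phi> k \<le> K * b"
    using \<phi>_bound[of k b] assms(2) by (force simp: dominated_def)
qed

lemma variation_superadditive:
  assumes "nonneg_in_L h" "nonneg_in_L h'"
  shows "variation h + variation h' \<le> variation (\<lambda>t. h t + h' t)"
proof -
  have hL: "h \<in> L" "h' \<in> L"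
    using assms by (auto simp: nonneg_in_L_def)
  have "\<phi> k + \<phi> k' \<le> variation (\<lambda>t. h t + h' t)" if "k \<in> dominated h" "k' \<in> dominated h'" for k k'
  proof -
    have "(\<lambda>t. k t + k' t) \<in> dominated (\<lambda>t. h t + h' t)"
      using that by (fastforce simp: dominated_def intro: L_add)
    then have "\<phi> (\<lambda>t. k t + k' t) \<le> variation (\<lambda>t. h t + h' t)"
      using hL by (intro variation_upper L_add)
    then show ?thesis
      using that \<phi>_add by (simp add: dominated_def)
  qed
  then have "\<phi> k \<le> variation (\<lambda>t. h t + h' t) - \<phi> k'" if "k \<in> dominated h" "k' \<in> dominated h'" for k k'
    using that by (simp add: le_diff_eq)
  then have "variation h \<le> variation (\<lambda>t. h t + h' t) - \<phi> k'" if "k' \<in> dominated h'" for k'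
    using that assms(1) by (intro variation_least)
  then have "\<phi> k' \<le> variation (\<lambda>t. h t + h' t) - variation h" if "k' \<in> dominated h'" for k'
    using that by (simp add: algebra_simps)
  then have "variation h' \<le> variation (\<lambda>t. h t + h' t) - variation h"
    using assms(2) by (intro variation_least)
  then show ?thesis
    by simp
qed

text \<open>Riesz decomposition: truncating \<open>k\<close> to the interval between
  \<open>-h\<close> and \<open>h\<close> leaves a remainder bounded by \<open>h'\<close>, and the
  lattice operations keep both pieces in \<open>L\<close>.\<close>

lemma variation_subadditive:
  assumes "nonneg_in_L h" "nonneg_in_L h'"
  shows "variation (\<lambda>t. h t + h' t) \<le> variation h + variation h'"
proof (rule variation_least)
  have hL: "h \<in> L" "h' \<in> L" and h0: "\<And>t. t \<in> topspace T \<Longrightarrow> 0 \<le> h t" "\<And>t. t \<in> topspace T \<Longrightarrow> 0 \<le> h' t"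
    using assms by (auto simp: nonneg_in_L_def)
  then show "nonneg_in_L (\<lambda>t. h t + h' t)"
    by (simp add: nonneg_in_L_def L_add)
  fix k assume k: "k \<in> dominated (\<lambda>t. h t + h' t)"
  let ?k = "\<lambda>t. max (-1 * h t) (min (k t) (h t))"
  let ?k' = "\<lambda>t. k t - ?k t"
  have kL: "k \<in> L"
    using k by (simp add: dominated_def)
  have L: "?k \<in> L"
    by (intro L_max L_min L_scale kL hL)
  with kL have L': "?k' \<in> L"
    by (rule L_diff)
  have "\<phi> k = \<phi> (\<lambda>t. ?k t + ?k' t)"
    by simp
  also have "\<dots> = \<phi> ?k + \<phi> ?k'"
    using L L' by (rule \<phi>_add)
  also have "?k \<in> dominated h"
    using L h0 by (auto simp: dominated_def max_def min_def)
  then have "\<phi> ?k \<le> variation h"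
    using hL by (intro variation_upper)
  also have "\<bar>?k' t\<bar> \<le> h' t" if "t \<in> topspace T" for t
  proof -
    have "\<bar>k t\<bar> \<le> h t + h' t"
      using k that by (simp add: dominated_def)
    then show ?thesis
      using h0[OF that] by (simp add: max_def min_def abs_if split: if_splits)
  qed
  then have "?k' \<in> dominated h'"
    using L' by (simp add: dominated_def)
  then have "\<phi> ?k' \<le> variation h'"
    using hL by (intro variation_upper)
  finally show "\<phi> k \<le> variation h + variation h'"
    by simp
qed

text \<open>Minimum and maximum add up to \<open>h + h'\<close>, so additivity turns into
  modularity. The inequality bounds from below what survives of the variation when a function is
  replaced by a minimum.\<close>

lemma variation_min_max:
  assumes "nonneg_in_L h" "nonneg_in_L h'"
  shows "variation h + variation h' \<le> variation (\<lambda>t. min (h t) (h' t)) + variation (\<lambda>t. max (h t) (h' t))"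
proof -
  have "nonneg_in_L (\<lambda>t. min (h t) (h' t))" "nonneg_in_L (\<lambda>t. max (h t) (h' t))"
    using assms by (auto simp: nonneg_in_L_def L_min L_max)
  then have "variation (\<lambda>t. min (h t) (h' t) + max (h t) (h' t))
      \<le> variation (\<lambda>t. min (h t) (h' t)) + variation (\<lambda>t. max (h t) (h' t))"
    by (rule variation_subadditive)
  moreover have "(\<lambda>t. min (h t) (h' t) + max (h t) (h' t)) = (\<lambda>t. h t + h' t)"
    by (auto simp: min_def max_def)
  ultimately show ?thesis
    using variation_superadditive[OF assms] by simp
qed

section \<open>Bounded convergence and finite nets\<close>

lemma Dini:
  assumes g: "\<And>n. continuous_map T euclideanreal (g n)"
    and dec: "\<And>n t. t \<in> topspace T \<Longrightarrow> g (Suc n) t \<le> g n t"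
    and lim: "\<And>t. t \<in> topspace T \<Longrightarrow> (\<lambda>n. g n t) \<longlonglongrightarrow> (0::real)" and e: "0 < e"
  shows "\<forall>\<^sub>F n in sequentially. \<forall>t\<in>topspace T. g n t < e"
proof -
  define U where "U n = {t \<in> topspace T. g n t \<in> {..<e}}" for n
  have op: "openin T (U n)" for n
    unfolding U_def by (rule openin_continuous_map_preimage[OF g]) simp
  have cover: "\<exists>n. t \<in> U n" if t: "t \<in> topspace T" for t
  proof -
    have "\<forall>\<^sub>F n in sequentially. g n t < e"
      using lim[OF t] e by (rule order_tendstoD)
    then show ?thesis
      using t by (auto simp: eventually_sequentially U_def)
  qed
  have "\<exists>\<F>. finite \<F> \<and> \<F> \<subseteq> range U \<and> topspace T \<subseteq> \<Union>\<F>"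
  proof (rule compactinD)
    show "compactin T (topspace T)"
      using compact_T by (simp add: compact_space_def)
  qed (use op cover in auto)
  then obtain N where N: "finite N" "topspace T \<subseteq> (\<Union>n\<in>N. U n)"
    by (metis finite_subset_image)
  have "g n t < e" if n: "n \<ge> Max (insert 0 N)" and t: "t \<in> topspace T" for n t
  proof -
    obtain m where m: "m \<in> N" "g m t < e"
      using N t by (auto simp: U_def)
    have "m \<le> Max (insert 0 N)"
      using m N by simp
    then have "m \<le> n"
      using n by simp
    then have "g n t \<le> g m t"
      using lift_Suc_antimono_le[of "\<lambda>n. g n t" m n] dec[OF t] by blast
    then show ?thesis
      using m by simp
  qed
  then show ?thesis
    unfolding eventually_sequentially by blast
qed

text \<open>
  Bounded convergence without measures (Luxemburg): almost optimal continuous minorants \<open>c n\<close> of the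
  upper envelopes \<open>u n\<close> are replaced by their running minima, to which Dini's theorem applies;
  modularity of the variation keeps the loss summable.
\<close>

lemma variation_tendsto_0:
  assumes h: "\<And>n. nonneg_in_L (h n)"
    and b: "\<And>n t. t \<in> topspace T \<Longrightarrow> h n t \<le> b"
    and lim: "\<And>t. t \<in> topspace T \<Longrightarrow> (\<lambda>n. h n t) \<longlonglongrightarrow> 0"
  shows "(\<lambda>n. variation (h n)) \<longlonglongrightarrow> 0"
proof -
  \<comment> \<open>A supremum of continuous functions is only lower semicontinuous, so
    \<open>u n\<close> may fall outside \<open>L\<close>; \<open>I n\<close> stands in for its
    variation, computed from minorants in \<open>L\<close>.\<close>
  define u where "u n t = (SUP k\<in>{n..}. h k t)" for n t
  define A where "A n = {c. nonneg_in_L c \<and> (\<forall>t\<in>topspace T. c t \<le> u n t)}" for n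
  define I where "I n = (SUP c\<in>A n. variation c)" for n
  have bdd: "bdd_above ((\<lambda>k. h k t) ` N)" if "t \<in> topspace T" for t N
    using b[OF that] by (auto simp: bdd_above_def)
  have u_upper: "h k t \<le> u n t" if "t \<in> topspace T" "n \<le> k" for n k t
    unfolding u_def using that bdd by (intro cSUP_upper) auto
  have u_le: "u n t \<le> b" if "t \<in> topspace T" for n t
    unfolding u_def using that b by (intro cSUP_least) auto
  have u_dec: "u m t \<le> u n t" if "t \<in> topspace T" "n \<le> m" for m n t
    unfolding u_def using that bdd by (intro cSUP_subset_mono) auto
  have hA: "h n \<in> A n" for n
    using h u_upper by (simp add: A_def)
  have A_bdd: "bdd_above (variation ` A n)" for n
  proof -
    have "variation c \<le> K * b" if "c \<in> A n" for c
      using that u_le by (intro variation_le) (auto simp: A_def intro: order_trans)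
    then show ?thesis
      by (auto simp: bdd_above_def)
  qed
  have I_upper: "variation c \<le> I n" if "c \<in> A n" for c n
    unfolding I_def using that A_bdd by (intro cSUP_upper)
  have u_lim: "(\<lambda>n. u n t) \<longlonglongrightarrow> 0" if t: "t \<in> topspace T" for t
  proof (rule LIMSEQ_I)
    fix r :: real assume r: "0 < r"
    then have "\<forall>\<^sub>F n in sequentially. h n t < r / 2"
      using lim[OF t] by (intro order_tendstoD) auto
    then obtain N where N: "\<And>n. n \<ge> N \<Longrightarrow> h n t < r / 2"
      by (auto simp: eventually_sequentially)
    have "norm (u n t - 0) < r" if "n \<ge> N" for n
    proof -
      have "u n t \<le> r / 2"
        unfolding u_def using that N by (intro cSUP_least) (auto intro: less_imp_le order_trans)
      moreover have "0 \<le> u n t"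
        using u_upper[OF t order_refl, of n] h[of n] t by (auto simp: nonneg_in_L_def intro: order_trans)
      ultimately show ?thesis
        using r by simp
    qed
    then show "\<exists>N. \<forall>n\<ge>N. norm (u n t - 0) < r"
      by blast
  qed
  have main: "\<forall>\<^sub>F n in sequentially. variation (h n) \<le> K * e + e" if e: "0 < e" for e
  proof -
    \<comment> \<open>The loss allowed at each stage is half the previous one, so that all losses
      together stay below \<open>e\<close>.\<close>
    have "\<exists>c. c \<in> A n \<and> I n \<le> variation c + e * (1/2) ^ Suc n" for n
    proof -
      have "I n - e * (1/2) ^ Suc n < I n"
        using e by simp
      then obtain c where "c \<in> A n" "I n - e * (1/2) ^ Suc n < variation c"
        using less_cSUP_iff[OF _ A_bdd[of n]] hA[of n] unfolding I_def by blast
      then show ?thesis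
        by (intro exI[of _ c]) simp
    qed
    then obtain c where c: "\<And>n. c n \<in> A n" "\<And>n. I n \<le> variation (c n) + e * (1/2) ^ Suc n"
      by metis
    define g where "g = rec_nat (c 0) (\<lambda>n g t. min (g t) (c (Suc n) t))"
    have g0: "g 0 = c 0" and gS: "g (Suc n) = (\<lambda>t. min (g n t) (c (Suc n) t))" for n
      by (simp_all add: g_def)
    have gb: "nonneg_in_L (g n)" for n
    proof (induction n)
      case 0
      then show ?case
        using c(1)[of 0] by (simp add: g0 A_def)
    next
      case (Suc n)
      then show ?case
        using c(1)[of "Suc n"] by (auto simp: gS A_def nonneg_in_L_def L_min)
    qed
    have gc: "g n t \<le> c n t" for n t
      by (cases n) (auto simp: g0 gS)
    have gu: "g n t \<le> u n t" if "t \<in> topspace T" for n t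
      using gc[of n t] c(1)[of n] that by (auto simp: A_def intro: order_trans)
    \<comment> \<open>The maximum of \<open>g n\<close> and \<open>c (Suc n)\<close> still lies
      below \<open>u n\<close>, so its variation is at most \<open>I n\<close>. Modularity then
      shows that passing to the minimum leaves a total loss no larger than the accumulated losses
      plus the new one.\<close>
    have gI: "I n \<le> variation (g n) + (\<Sum>i\<le>n. e * (1/2) ^ Suc i)" for n
    proof (induction n)
      case 0
      then show ?case
        using c(2)[of 0] by (simp add: g0)
    next
      case (Suc n)
      have cb: "nonneg_in_L (c (Suc n))"
        using c(1) by (simp add: A_def)
      have "c (Suc n) t \<le> u n t" if "t \<in> topspace T" for t
        using c(1)[of "Suc n"] u_dec[OF that, of n "Suc n"] that by (auto simp: A_def intro: order_trans)
      then have "(\<lambda>t. max (g n t) (c (Suc n) t)) \<in> A n"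
        using gb[of n] cb gu by (auto simp: A_def nonneg_in_L_def L_max)
      from I_upper[OF this] have "variation (g n) + variation (c (Suc n)) \<le> variation (g (Suc n)) + I n"
        using variation_min_max[OF gb[of n] cb] by (simp add: gS)
      then show ?case
        using Suc.IH c(2)[of "Suc n"] by (simp only: sum.atMost_Suc)
    qed
    have "(\<Sum>i\<le>n. e * (1/2) ^ Suc i) \<le> e" for n
    proof -
      have "(\<Sum>i\<le>n. e * (1/2) ^ Suc i) = e * (1 - (1/2) ^ Suc n)"
        by (induction n) (auto simp: algebra_simps)
      also have "\<dots> \<le> e"
        using e by (simp add: algebra_simps)
      finally show ?thesis .
    qed
    then have hI: "variation (h n) \<le> variation (g n) + e" for n
      using I_upper[OF hA[of n]] gI[of n] by (smt (verit))
    have "\<forall>\<^sub>F n in sequentially. \<forall>t\<in>topspace T. g n t < e"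
    proof (rule Dini)
      show "continuous_map T euclideanreal (g n)" for n
        using gb by (simp add: L_continuous nonneg_in_L_def)
      show "g (Suc n) t \<le> g n t" for n t
        by (simp add: gS)
      show "(\<lambda>n. g n t) \<longlonglongrightarrow> 0" if "t \<in> topspace T" for t
        by (rule tendsto_sandwich[OF _ _ tendsto_const u_lim[OF that]])
           (use that gb gu in \<open>auto simp: nonneg_in_L_def intro!: always_eventually\<close>)
    qed (use e in auto)
    then show ?thesis
    proof eventually_elim
      case (elim n)
      then have "variation (g n) \<le> K * e"
        using gb by (intro variation_le) (auto intro: less_imp_le)
      then show ?case
        using hI[of n] by simp
    qed
  qed
  show ?thesis
  proof (rule LIMSEQ_I)
    fix r :: real assume r: "0 < r"
    \<comment> \<open>In \<open>main\<close>, \<open>K * e\<close> comes from Dini's theorem and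
      \<open>e\<close> from the summed losses. Dividing by \<open>2 * (K + 1)\<close> makes the two
      add up to \<open>r / 2\<close> and stays meaningful for \<open>K = 0\<close>.\<close>
    have Kr: "K * (r / (2 * (K + 1))) + r / (2 * (K + 1)) = r / 2" "0 < r / (2 * (K + 1))"
    proof -
      have "K * (r / (2 * (K + 1))) + r / (2 * (K + 1)) = (K + 1) * (r / (2 * (K + 1)))"
        by (simp only: distrib_right mult_1)
      also have "\<dots> = r / 2"
        using K_nonneg by (simp add: nonzero_divide_eq_eq)
      finally show "K * (r / (2 * (K + 1))) + r / (2 * (K + 1)) = r / 2" .
      show "0 < r / (2 * (K + 1))"
        using K_nonneg r by simp
    qed
    have "\<forall>\<^sub>F n in sequentially. variation (h n) \<le> r / 2"
      using main[OF Kr(2)] unfolding Kr(1) .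
    then obtain N where N: "\<And>n. n \<ge> N \<Longrightarrow> variation (h n) \<le> r / 2"
      by (auto simp: eventually_sequentially)
    have "0 \<le> variation (h n)" for n
      using abs_\<phi>_le_variation[of "h n"] variation_mono[of "\<lambda>t. \<bar>h n t\<bar>" "h n"] h[of n]
      by (force simp: nonneg_in_L_def L_abs)
    moreover have "variation (h n) < r" if "n \<ge> N" for n
      using N[OF that] r by simp
    ultimately show "\<exists>N. \<forall>n\<ge>N. norm (variation (h n) - 0) < r"
      by (intro exI[of _ N]) simp
  qed
qed

text \<open>As far as the functions in \<open>Q\<close> can tell, every point of \<open>T\<close> is
  imitated by one of finitely many points. This lets the inductive construction below deal with
  finitely many conditions at each stage.\<close>

lemma finite_net:
  assumes "finite Q" "Q \<subseteq> L" "0 < e"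
  shows "\<exists>F. finite F \<and> F \<subseteq> topspace T \<and> (\<forall>t\<in>topspace T. \<exists>s\<in>F. \<forall>q\<in>Q. \<bar>q t - q s\<bar> < e)"
proof -
  define U where "U s = topspace T \<inter> (\<Inter>q\<in>Q. {t \<in> topspace T. q t \<in> ball (q s) e})" for s
  have "openin T {t \<in> topspace T. q t \<in> ball (q s) e}" if "q \<in> Q" for q s
    by (rule openin_continuous_map_preimage[OF L_continuous]) (use that assms in auto)
  then have op: "openin T (U s)" for s
    unfolding U_def using assms(1) by (cases "Q = {}") (simp_all add: openin_Int openin_INT2)
  have mem: "s \<in> U s" if "s \<in> topspace T" for s
    using that assms(3) by (simp add: U_def)
  have "\<exists>\<F>. finite \<F> \<and> \<F> \<subseteq> U ` topspace T \<and> topspace T \<subseteq> \<Union>\<F>"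
  proof (rule compactinD)
    show "compactin T (topspace T)"
      using compact_T by (simp add: compact_space_def)
  qed (use op mem in auto)
  then obtain F where F: "finite F" "F \<subseteq> topspace T" "topspace T \<subseteq> (\<Union>s\<in>F. U s)"
    by (metis finite_subset_image)
  have "\<exists>s\<in>F. \<forall>q\<in>Q. \<bar>q t - q s\<bar> < e" if t: "t \<in> topspace T" for t
  proof -
    obtain s where "s \<in> F" "t \<in> U s"
      using F t by blast
    then show ?thesis
      by (intro bexI[of _ s]) (auto simp: U_def dist_real_def abs_minus_commute)
  qed
  then show ?thesis
    using F by blast
qed

end

text \<open>A compact space need not be sequentially compact, so cluster points replace limits of
  subsequences. The index set \<open>J\<close> allows a cluster point to be taken along the indices
  where a convergence fails.\<close>

lemma compact_cluster_point:
  assumes P: "compact_space P" and s: "\<And>n. s n \<in> topspace P" and J: "infinite (J :: nat set)"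
  shows "\<exists>p\<in>topspace P. \<forall>U. openin P U \<longrightarrow> p \<in> U \<longrightarrow> infinite {n \<in> J. s n \<in> U}"
proof (rule ccontr)
  assume "\<not> ?thesis"
  then have no: "\<forall>p\<in>topspace P. \<exists>U. openin P U \<and> p \<in> U \<and> finite {n \<in> J. s n \<in> U}"
    by simp
  let ?\<U> = "{U. openin P U \<and> finite {n \<in> J. s n \<in> U}}"
  have "\<exists>\<F>. finite \<F> \<and> \<F> \<subseteq> ?\<U> \<and> topspace P \<subseteq> \<Union>\<F>"
  proof (rule compactinD)
    show "compactin P (topspace P)"
      using P by (simp add: compact_space_def)
    show "topspace P \<subseteq> \<Union> ?\<U>"
    proof
      fix p assume "p \<in> topspace P"
      then show "p \<in> \<Union> ?\<U>"
        using no by (blast dest: bspec)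
    qed
  qed simp
  then obtain \<F> where \<F>: "finite \<F>" "\<F> \<subseteq> ?\<U>" "topspace P \<subseteq> \<Union>\<F>"
    by blast
  have "J \<subseteq> (\<Union>U\<in>\<F>. {n \<in> J. s n \<in> U})"
    using s \<F>(3) by blast
  then show False
    using finite_subset[OF _ finite_UN_I[OF \<F>(1)], of J "\<lambda>U. {n \<in> J. s n \<in> U}"] \<F>(2) J by auto
qed

text \<open>Reads off the limit of \<open>u (s n)\<close> along \<open>J\<close> at a cluster point:
  a gap between \<open>u p\<close> and \<open>c\<close> would be halved by \<open>d\<close>, and
  some late index in \<open>J\<close> would be within \<open>d\<close> of both.\<close>

lemma cluster_value:
  assumes u: "continuous_map P euclideanreal u" and p: "p \<in> topspace P"
    and cl: "\<forall>U. openin P U \<longrightarrow> p \<in> U \<longrightarrow> infinite {n \<in> J. s n \<in> U}"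
    and e: "\<forall>\<^sub>F n in sequentially. n \<in> J \<longrightarrow> \<bar>u (s n) - c\<bar> \<le> e n" "e \<longlonglongrightarrow> (0::real)"
  shows "u p = c"
proof (rule ccontr)
  assume "u p \<noteq> c"
  define d where "d = \<bar>u p - c\<bar> / 2"
  have d: "0 < d"
    using \<open>u p \<noteq> c\<close> by (simp add: d_def)
  have "openin P {x \<in> topspace P. u x \<in> ball (u p) d}"
    by (rule openin_continuous_map_preimage[OF u]) simp
  then have inf: "infinite {n \<in> J. s n \<in> {x \<in> topspace P. u x \<in> ball (u p) d}}"
    using p d by (intro cl[rule_format]) auto
  have "\<forall>\<^sub>F n in sequentially. e n < d"
    using e(2) d by (rule order_tendstoD)
  with e(1) have "\<forall>\<^sub>F n in sequentially. (n \<in> J \<longrightarrow> \<bar>u (s n) - c\<bar> \<le> e n) \<and> e n < d"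
    by (rule eventually_conj)
  then obtain N where N: "\<And>n. n \<ge> N \<Longrightarrow> n \<in> J \<Longrightarrow> \<bar>u (s n) - c\<bar> < d"
    unfolding eventually_sequentially by fastforce
  obtain n where n: "n \<ge> N" "n \<in> J" "u (s n) \<in> ball (u p) d"
    using inf unfolding infinite_nat_iff_unbounded_le by blast
  then have "\<bar>u p - c\<bar> < 2 * d"
    using N[OF n(1,2)] by (auto simp: dist_real_def)
  then show False
    by (simp add: d_def)
qed

text \<open>
  If continuity fails at \<open>p0\<close>, choose points \<open>p n\<close> witnessing this together with finite
  nets of \<open>T\<close> adapted to the finitely many functions chosen so far, such that \<open>h (p n)\<close> is close to
  \<open>h p0\<close> on the nets. Separate continuity forces \<open>h (p n)\<close> to converge to \<open>h p0\<close> pointwise on all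
  of \<open>T\<close>, which contradicts bounded convergence.
\<close>

lemma (in lattice_functional) continuous_map_functional_of_kernel:
  fixes P :: "'p topology" and h :: "'p \<Rightarrow> 't \<Rightarrow> real"
  assumes P: "compact_space P"
    and hP: "\<And>t. t \<in> topspace T \<Longrightarrow> continuous_map P euclideanreal (\<lambda>p. h p t)"
    and hL: "\<And>p. p \<in> topspace P \<Longrightarrow> h p \<in> L"
    and b: "\<And>p t. p \<in> topspace P \<Longrightarrow> t \<in> topspace T \<Longrightarrow> \<bar>h p t\<bar> \<le> b"
  shows "continuous_map P euclideanreal (\<lambda>p. \<phi> (h p))"
proof (rule ccontr)
  assume "\<not> ?thesis"
  then obtain p0 e where p0: "p0 \<in> topspace P" and e: "e > 0"
    and bad: "\<And>U. openin P U \<Longrightarrow> p0 \<in> U \<Longrightarrow> \<exists>p\<in>U. e \<le> \<bar>\<phi> (h p) - \<phi> (h p0)\<bar>"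
    unfolding continuous_map_real_iff by (meson not_le_imp_less)
  \<comment> \<open>The conditions on \<open>Q\<close> sit under the existential quantifier so that
    choice yields a total function \<open>net\<close>; \<open>pick\<close> is obtained in the same
    way.\<close>
  have "\<exists>F. finite Q \<and> Q \<subseteq> topspace P \<longrightarrow> finite F \<and> F \<subseteq> topspace T \<and>
      (\<forall>t\<in>topspace T. \<exists>s\<in>F. \<forall>q\<in>Q. \<bar>h q t - h q s\<bar> < inverse (real (Suc n)))" for Q n
  proof (cases "finite Q \<and> Q \<subseteq> topspace P")
    case True
    have "\<exists>F. finite F \<and> F \<subseteq> topspace T \<and>
      (\<forall>t\<in>topspace T. \<exists>s\<in>F. \<forall>q\<in>h ` Q. \<bar>q t - q s\<bar> < inverse (real (Suc n)))"
      using True hL by (intro finite_net) auto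
    then show ?thesis
      by simp
  qed auto
  then obtain net where net: "\<And>Q n. finite Q \<Longrightarrow> Q \<subseteq> topspace P \<Longrightarrow> finite (net Q n)"
      "\<And>Q n. finite Q \<Longrightarrow> Q \<subseteq> topspace P \<Longrightarrow> net Q n \<subseteq> topspace T"
      "\<And>Q n t. finite Q \<Longrightarrow> Q \<subseteq> topspace P \<Longrightarrow> t \<in> topspace T \<Longrightarrow>
        \<exists>s\<in>net Q n. \<forall>q\<in>Q. \<bar>h q t - h q s\<bar> < inverse (real (Suc n))"
    by metis
  have "\<exists>p. finite F \<and> F \<subseteq> topspace T \<longrightarrow> p \<in> topspace P \<and>
      (\<forall>s\<in>F. \<bar>h p s - h p0 s\<bar> < inverse (real (Suc n))) \<and> e \<le> \<bar>\<phi> (h p) - \<phi> (h p0)\<bar>" for F n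
  proof (cases "finite F \<and> F \<subseteq> topspace T")
    case True
    define r where "r = inverse (real (Suc n))"
    have r: "0 < r"
      by (simp add: r_def)
    define U where "U = topspace P \<inter> (\<Inter>s\<in>F. {p \<in> topspace P. h p s \<in> ball (h p0 s) r})"
    have "openin P {p \<in> topspace P. h p s \<in> ball (h p0 s) r}" if "s \<in> F" for s
      by (rule openin_continuous_map_preimage[OF hP]) (use that True in auto)
    then have "openin P U"
      unfolding U_def using True by (cases "F = {}") (simp_all add: openin_Int openin_INT2)
    moreover have "p0 \<in> U"
      using p0 r by (auto simp: U_def)
    ultimately obtain p where "p \<in> U" "e \<le> \<bar>\<phi> (h p) - \<phi> (h p0)\<bar>"
      using bad by blast
    then show ?thesis
      unfolding U_def r_def[symmetric] by (auto simp: dist_real_def abs_minus_commute)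
  qed auto
  then obtain pick where pick: "\<And>F n. finite F \<Longrightarrow> F \<subseteq> topspace T \<Longrightarrow> pick F n \<in> topspace P"
      "\<And>F n s. finite F \<Longrightarrow> F \<subseteq> topspace T \<Longrightarrow> s \<in> F \<Longrightarrow>
        \<bar>h (pick F n) s - h p0 s\<bar> < inverse (real (Suc n))"
      "\<And>F n. finite F \<Longrightarrow> F \<subseteq> topspace T \<Longrightarrow> e \<le> \<bar>\<phi> (h (pick F n)) - \<phi> (h p0)\<bar>"
    by metis
  \<comment> \<open>The first component holds the points of \<open>P\<close> chosen so far, the
    second the points of \<open>T\<close> at which later choices must be close to
    \<open>h p0\<close>. Stage \<open>n\<close> picks a point against the current second component
    and only then adds a net adapted to the enlarged first one.\<close>
  define st where "st = rec_nat ({p0}, net {p0} 0)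
    (\<lambda>n QF. (insert (pick (snd QF) n) (fst QF),
             snd QF \<union> net (insert (pick (snd QF) n) (fst QF)) (Suc n)))"
  define Q where "Q n = fst (st n)" for n
  define F where "F n = snd (st n)" for n
  define p where "p n = pick (F n) n" for n
  have Q0: "Q 0 = {p0}" and F0: "F 0 = net {p0} 0"
    and QS: "Q (Suc n) = insert (p n) (Q n)" and FS: "F (Suc n) = F n \<union> net (Q (Suc n)) (Suc n)" for n
    by (simp_all add: Q_def F_def p_def st_def)
  have inv: "finite (Q n) \<and> Q n \<subseteq> topspace P \<and> finite (F n) \<and> F n \<subseteq> topspace T \<and> net (Q n) n \<subseteq> F n" for n
  proof (induction n)
    case 0
    then show ?case
      using p0 net[of "{p0}"] by (simp add: Q0 F0)
  next
    case (Suc n)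
    then have "finite (Q (Suc n))" "Q (Suc n) \<subseteq> topspace P"
      using pick(1) by (auto simp: QS p_def)
    then show ?case
      using Suc net unfolding FS by auto
  qed
  have Fmono: "F m \<subseteq> F n" if "m \<le> n" for m n
    by (rule lift_Suc_mono_le[OF _ that]) (auto simp: FS)
  have Qmono: "Q m \<subseteq> Q n" if "m \<le> n" for m n
    by (rule lift_Suc_mono_le[OF _ that]) (auto simp: QS)
  have pP: "p n \<in> topspace P" and pe: "e \<le> \<bar>\<phi> (h (p n)) - \<phi> (h p0)\<bar>" for n
    using pick inv by (auto simp: p_def)
  have pF: "\<bar>h (p n) s - h p0 s\<bar> \<le> inverse (real (Suc n))" if "s \<in> F m" "m \<le> n" for n m s
    using pick(2)[of "F n" s n] inv[of n] Fmono[OF that(2)] that(1) unfolding p_def by fastforce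
  \<comment> \<open>A double limit argument. The point \<open>s'\<close> is a cluster point of net
    points imitating \<open>t\<close>, so \<open>h (p n) s' = h (p n) t\<close> for all
    \<open>n\<close>, and continuity in the first variable carries this to \<open>q\<close>. As
    \<open>h q\<close> and \<open>h p0\<close> agree on all nets, continuity in the second variable
    makes them agree at \<open>s'\<close>. Hence
    \<open>h q t = h q s' = h p0 s' = h p0 t\<close>.\<close>
  have cluster: "h q t = h p0 t" if t: "t \<in> topspace T" and q: "q \<in> topspace P"
      and cl: "\<forall>U. openin P U \<longrightarrow> q \<in> U \<longrightarrow> infinite {n \<in> J. p n \<in> U}" for J q t
  proof -
    have "\<exists>s\<in>F n. \<forall>q\<in>Q n. \<bar>h q t - h q s\<bar> < inverse (real (Suc n))" for n
      using net(3)[of "Q n" t n] inv[of n] t by blast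
    then obtain s where s: "\<And>n. s n \<in> F n" "\<And>n q. q \<in> Q n \<Longrightarrow> \<bar>h q t - h q (s n)\<bar> < inverse (real (Suc n))"
      by metis
    have "s n \<in> topspace T" for n
      using s inv by blast
    then obtain s' where s': "s' \<in> topspace T"
      "\<forall>U. openin T U \<longrightarrow> s' \<in> U \<longrightarrow> infinite {n \<in> UNIV. s n \<in> U}"
      using compact_cluster_point[OF compact_T, of s UNIV] by auto
    have Qs: "h q s' = h q t" if q: "q \<in> Q m" for q m
    proof (rule cluster_value[OF _ s'])
      show "continuous_map T euclideanreal (h q)"
        using q inv hL L_continuous by blast
      have "\<bar>h q (s n) - h q t\<bar> \<le> inverse (real (Suc n))" if "m \<le> n" for n
        using s(2)[of q n] Qmono[OF that] q by fastforce
      then show "\<forall>\<^sub>F n in sequentially. n \<in> UNIV \<longrightarrow> \<bar>h q (s n) - h q t\<bar> \<le> inverse (real (Suc n))"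
        unfolding eventually_sequentially by blast
    qed (rule LIMSEQ_inverse_real_of_nat)
    have qF: "h q s = h p0 s" if s: "s \<in> F m" for s m
    proof (rule cluster_value[OF hP q cl])
      show "s \<in> topspace T"
        using s inv by blast
      show "\<forall>\<^sub>F n in sequentially. n \<in> J \<longrightarrow> \<bar>h (p n) s - h p0 s\<bar> \<le> inverse (real (Suc n))"
        unfolding eventually_sequentially using pF[OF s] by blast
    qed (rule LIMSEQ_inverse_real_of_nat)
    have "h q s' - h p0 s' = 0"
    proof (rule cluster_value[OF _ s'])
      show "continuous_map T euclideanreal (\<lambda>t. h q t - h p0 t)"
        using q p0 by (intro L_continuous L_diff hL)
      show "\<forall>\<^sub>F n in sequentially. n \<in> UNIV \<longrightarrow> \<bar>h q (s n) - h p0 (s n) - 0\<bar> \<le> 0"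
        using qF[OF s(1)] by simp
    qed simp
    moreover have "h q t - h q s' = 0"
    proof (rule cluster_value[OF _ q cl])
      show "continuous_map P euclideanreal (\<lambda>p. h p t - h p s')"
        using t s' by (intro continuous_map_diff hP)
      have "h (p n) s' = h (p n) t" for n
        by (rule Qs[of _ "Suc n"]) (simp add: QS)
      then show "\<forall>\<^sub>F n in sequentially. n \<in> J \<longrightarrow> \<bar>h (p n) t - h (p n) s' - 0\<bar> \<le> 0"
        by simp
    qed simp_all
    moreover have "h p0 s' = h p0 t"
      by (rule Qs[of _ 0]) (simp add: Q0)
    ultimately show ?thesis
      by simp
  qed
  \<comment> \<open>The indices at which the difference is at least \<open>r\<close> would have a
    cluster point \<open>q\<close>; but the kernel takes the value \<open>h p0 t\<close> there, so
    infinitely many of these differences would be below \<open>r\<close>.\<close>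
  have lim: "(\<lambda>n. \<bar>h (p n) t - h p0 t\<bar>) \<longlonglongrightarrow> 0" if t: "t \<in> topspace T" for t
  proof (rule ccontr)
    assume "\<not> (\<lambda>n. \<bar>h (p n) t - h p0 t\<bar>) \<longlonglongrightarrow> 0"
    then obtain r where r: "r > 0" "\<And>N. \<exists>n\<ge>N. r \<le> \<bar>h (p n) t - h p0 t\<bar>"
      unfolding LIMSEQ_def by (auto simp: dist_real_def not_less)
    define J where "J = {n. r \<le> \<bar>h (p n) t - h p0 t\<bar>}"
    have "infinite J"
      unfolding infinite_nat_iff_unbounded_le J_def using r(2) by auto
    then obtain q where q: "q \<in> topspace P" "\<forall>U. openin P U \<longrightarrow> q \<in> U \<longrightarrow> infinite {n \<in> J. p n \<in> U}"
      using compact_cluster_point[OF P, of p J] pP by blast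
    have "openin P {x \<in> topspace P. h x t \<in> ball (h p0 t) r}"
      by (rule openin_continuous_map_preimage[OF hP[OF t]]) simp
    then have "infinite {n \<in> J. p n \<in> {x \<in> topspace P. h x t \<in> ball (h p0 t) r}}"
      using q(1) cluster[OF t q] r by (intro q(2)[rule_format]) auto
    moreover have "{n \<in> J. p n \<in> {x \<in> topspace P. h x t \<in> ball (h p0 t) r}} = {}"
      by (auto simp: J_def dist_real_def)
    ultimately show False
      by (metis finite.emptyI)
  qed
  have dL: "(\<lambda>t. h (p n) t - h p0 t) \<in> L" for n
    using pP p0 by (intro L_diff hL)
  have "(\<lambda>n. variation (\<lambda>t. \<bar>h (p n) t - h p0 t\<bar>)) \<longlonglongrightarrow> 0"
  proof (rule variation_tendsto_0)
    show "nonneg_in_L (\<lambda>t. \<bar>h (p n) t - h p0 t\<bar>)" for n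
      using L_abs[OF dL] by (simp add: nonneg_in_L_def)
    show "\<bar>h (p n) t - h p0 t\<bar> \<le> 2 * b" if "t \<in> topspace T" for n t
      using b[OF pP that, of n] b[OF p0 that] by linarith
  qed (rule lim)
  then have "\<forall>\<^sub>F n in sequentially. variation (\<lambda>t. \<bar>h (p n) t - h p0 t\<bar>) < e"
    using e by (rule order_tendstoD)
  then obtain n where "variation (\<lambda>t. \<bar>h (p n) t - h p0 t\<bar>) < e"
    by (auto simp: eventually_sequentially)
  moreover have "\<bar>\<phi> (h (p n)) - \<phi> (h p0)\<bar> \<le> variation (\<lambda>t. \<bar>h (p n) t - h p0 t\<bar>)"
    using abs_\<phi>_le_variation[OF dL] \<phi>_diff[OF hL hL, OF pP p0] by simp
  ultimately show False
    using pe[of n] by simp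
qed

section \<open>Compact spaces and their uniformities\<close>

lemma Hausdorff_space_fun: "Hausdorff_space (euclidean :: ('i \<Rightarrow> real) topology)"
  by (simp add: Hausdorff_space_product_topology flip: euclidean_product_topology)

lemma compact_imp_closed_fun: "compact K \<Longrightarrow> closed K" for K :: "('i \<Rightarrow> real) set"
  using compactin_imp_closedin[OF Hausdorff_space_fun, of K] by simp

lemma compact_box: "compact {\<omega> :: 'i \<Rightarrow> real. \<forall>i. \<bar>\<omega> i\<bar> \<le> B i}"
proof -
  have "compactin (product_topology (\<lambda>_. euclidean) UNIV) (PiE UNIV (\<lambda>i. {- B i .. B i}))"
    by (simp add: compactin_PiE)
  moreover have "PiE UNIV (\<lambda>i. {- B i .. B i}) = {\<omega>. \<forall>i. \<bar>\<omega> i\<bar> \<le> B i}"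
    by (auto simp: PiE_iff abs_le_iff minus_le_iff)
  ultimately show ?thesis
    by (simp add: euclidean_product_topology)
qed

lemma dist_bcontfun_le_iff:
  fixes u v :: "'a::topological_space \<Rightarrow>\<^sub>C 'b::metric_space"
  shows "dist u v \<le> b \<longleftrightarrow> (\<forall>x. dist (u x) (v x) \<le> b)"
  using dist_bounded[of u _ v] dist_bound[of u v b] by (meson order_trans)

lemma openin_pointwise_topology:
  "openin pointwise_topology U \<longleftrightarrow> (\<exists>T. open T \<and> U = apply_bcontfun -` T)"
  by (simp add: pointwise_topology_def openin_pullback_topology euclidean_product_topology)

lemma continuous_on_apply_bcontfun_fun:
  "continuous_on UNIV (apply_bcontfun :: ('a::topological_space \<Rightarrow>\<^sub>C 'b::metric_space) \<Rightarrow> 'a \<Rightarrow> 'b)"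
proof (rule continuous_on_coordinatewise_then_product)
  fix x :: 'a
  show "continuous_on UNIV (\<lambda>u :: 'a \<Rightarrow>\<^sub>C 'b. apply_bcontfun u x)"
    unfolding continuous_on_iff using dist_bounded by (metis le_less_trans)
qed

text \<open>The sets of pairs differing by more than a given positive number in a given coordinate
  cover the compact complement of an open entourage. A finite subcover supplies both
  \<open>I\<close> and \<open>e\<close>.\<close>

lemma fun_entourage:
  fixes K :: "('i \<Rightarrow> real) set"
  assumes K: "compact K" and E: "eventually E (uniformity_of (top_of_set K))"
  obtains I e where "finite I" "0 < e"
    "\<And>\<omega> \<omega>'. \<omega> \<in> K \<Longrightarrow> \<omega>' \<in> K \<Longrightarrow> (\<And>i. i \<in> I \<Longrightarrow> \<bar>\<omega> i - \<omega>' i\<bar> < e) \<Longrightarrow> E (\<omega>, \<omega>')"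
proof -
  have "compact_space (top_of_set K)" "Hausdorff_space (top_of_set K)"
    using K by (simp_all add: compact_space_subtopology Hausdorff_space_subtopology Hausdorff_space_fun)
  then obtain W where W: "openin (top_of_set (K \<times> K)) W" "\<And>\<omega>. \<omega> \<in> K \<Longrightarrow> (\<omega>, \<omega>) \<in> W"
      "\<And>p. p \<in> W \<Longrightarrow> E p"
    using E by (auto simp: eventually_uniformity_of prod_topology_subtopology_eu)
  have "closedin (top_of_set (K \<times> K)) (K \<times> K - W)"
    using W(1) by (simp add: openin_closedin_eq)
  then have cpt: "compact (K \<times> K - W)"
    using K by (metis closedin_compact compact_Times)
  define U where "U = (\<lambda>(i, e::real). {p :: ('i \<Rightarrow> real) \<times> ('i \<Rightarrow> real). e < \<bar>fst p i - snd p i\<bar>})"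
  have "open (U q)" for q
    unfolding U_def case_prod_unfold
    by (intro open_Collect_less continuous_intros continuous_on_product_then_coordinatewise)
  moreover have "K \<times> K - W \<subseteq> (\<Union>q\<in>UNIV \<times> {0<..}. U q)"
  proof
    fix p assume "p \<in> K \<times> K - W"
    then have "fst p \<noteq> snd p"
      using W(2) by (cases p) auto
    then obtain i where "fst p i \<noteq> snd p i"
      by blast
    then have "p \<in> U (i, \<bar>fst p i - snd p i\<bar> / 2)" "\<bar>fst p i - snd p i\<bar> / 2 > 0"
      by (auto simp: U_def)
    then show "p \<in> (\<Union>q\<in>UNIV \<times> {0<..}. U q)"
      by blast
  qed
  ultimately obtain Q where Q: "Q \<subseteq> UNIV \<times> {0<..}" "finite Q" "K \<times> K - W \<subseteq> (\<Union>q\<in>Q. U q)"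
    using compactE_image[OF cpt, of "UNIV \<times> {0<..}" U] by blast
  \<comment> \<open>The \<open>1\<close> keeps the minimum well defined and positive when the
    subcover is empty.\<close>
  define e where "e = Min (insert 1 (snd ` Q))"
  have e: "0 < e" "\<And>q. q \<in> Q \<Longrightarrow> e \<le> snd q"
    using Q by (auto simp: e_def)
  show ?thesis
  proof (rule that[of "fst ` Q" e])
    fix \<omega> \<omega>' assume \<omega>: "\<omega> \<in> K" "\<omega>' \<in> K" "\<And>i. i \<in> fst ` Q \<Longrightarrow> \<bar>\<omega> i - \<omega>' i\<bar> < e"
    have "(\<omega>, \<omega>') \<notin> U q" if "q \<in> Q" for q
      using \<omega>(3)[of "fst q"] e(2)[OF that] that by (auto simp: U_def case_prod_unfold)
    then have "(\<omega>, \<omega>') \<in> W"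
      using Q(3) \<omega>(1,2) by blast
    then show "E (\<omega>, \<omega>')"
      by (rule W(3))
  qed (use Q e in auto)
qed

lemma eventually_uniformity_of_real:
  assumes Y: "compact_space Y" "Hausdorff_space Y"
    and F: "continuous_map Y euclideanreal F" and e: "0 < e"
  shows "eventually (\<lambda>(x, y). \<bar>F x - F y\<bar> < e) (uniformity_of Y)"
proof -
  let ?W = "{p \<in> topspace (prod_topology Y Y). F (fst p) - F (snd p) \<in> ball 0 e}"
  have "continuous_map (prod_topology Y Y) euclideanreal (\<lambda>p. F (fst p) - F (snd p))"
    using continuous_map_compose[OF continuous_map_fst F] continuous_map_compose[OF continuous_map_snd F]
    by (intro continuous_map_diff) (auto simp: o_def)
  then have "openin (prod_topology Y Y) ?W"
    by (rule openin_continuous_map_preimage) simp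
  then show ?thesis
    unfolding eventually_uniformity_of[OF Y] using e by (intro exI[of _ ?W]) (auto simp: dist_real_def)
qed

section \<open>Minimal closed sets meeting a family of closed sets\<close>

lemma finite_chain_Inter:
  assumes "finite \<N>" "\<N> \<noteq> {}" "\<forall>A\<in>\<N>. \<forall>B\<in>\<N>. A \<subseteq> B \<or> B \<subseteq> A"
  shows "\<Inter>\<N> \<in> \<N>"
  using assms
proof (induction rule: finite_ne_induct)
  case (insert A \<N>)
  then have N: "\<Inter>\<N> \<in> \<N>"
    by simp
  then have "A \<subseteq> \<Inter>\<N> \<or> \<Inter>\<N> \<subseteq> A"
    using insert.prems by simp
  then have "A \<inter> \<Inter>\<N> = A \<or> A \<inter> \<Inter>\<N> = \<Inter>\<N>"
    by (metis Int_absorb1 Int_absorb2)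
  then show ?case
    using N by auto
qed simp

lemma compact_chain_Inter:
  assumes Y: "compact_space Y" and C: "closedin Y C" and M: "\<M> \<noteq> {}"
    and cl: "\<And>M. M \<in> \<M> \<Longrightarrow> closedin Y M \<and> M \<inter> C \<noteq> {}"
    and chain: "\<forall>A\<in>\<M>. \<forall>B\<in>\<M>. A \<subseteq> B \<or> B \<subseteq> A"
  shows "\<Inter>\<M> \<inter> C \<noteq> {}"
proof -
  have "\<Inter> ((\<lambda>M. M \<inter> C) ` \<M>) \<noteq> {}"
  proof (rule compact_space_fip[THEN iffD1, OF Y, rule_format], intro conjI ballI allI impI)
    show "closedin Y D" if D: "D \<in> (\<lambda>M. M \<inter> C) ` \<M>" for D
    proof -
      obtain M where "M \<in> \<M>" "D = M \<inter> C"
        using D by (rule imageE)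
      then show ?thesis
        using cl C by (simp add: closedin_Int)
    qed
    fix \<D> assume "finite \<D> \<and> \<D> \<subseteq> (\<lambda>M. M \<inter> C) ` \<M>"
    then obtain \<N> where \<N>: "\<N> \<subseteq> \<M>" "finite \<N>" "\<D> = (\<lambda>M. M \<inter> C) ` \<N>"
      by (metis finite_subset_image)
    show "\<Inter>\<D> \<noteq> {}"
    proof (cases "\<N> = {}")
      case False
      then have "\<Inter>\<N> \<in> \<M>"
        using finite_chain_Inter[OF \<N>(2)] chain \<N>(1) by (meson subsetD)
      then have "\<Inter>\<N> \<inter> C \<noteq> {}"
        using cl by blast
      then show ?thesis
        unfolding \<N>(3) by auto
    qed (simp add: \<N>)
  qed
  then show ?thesis
    using M by auto
qed

text \<open>Zorn's lemma, with compactness ensuring that the intersection of a chain still meets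
  every member of \<open>\<C>\<close>. In the applications \<open>\<C>\<close> consists of fibres of
  the factor map, and \<open>R\<close> is trivial for fragmentability and invariance under the
  action for local equicontinuity.\<close>

lemma minimal_closed_set:
  assumes Y: "compact_space Y"
    and \<C>: "\<And>C. C \<in> \<C> \<Longrightarrow> closedin Y C" "\<And>C. C \<in> \<C> \<Longrightarrow> C \<noteq> {}"
    and R: "R (topspace Y)" "\<And>\<M>. \<M> \<noteq> {} \<Longrightarrow> (\<And>M. M \<in> \<M> \<Longrightarrow> R M) \<Longrightarrow> R (\<Inter>\<M>)"
  shows "\<exists>M. closedin Y M \<and> R M \<and> (\<forall>C\<in>\<C>. M \<inter> C \<noteq> {}) \<and>
    (\<forall>M'. closedin Y M' \<longrightarrow> R M' \<longrightarrow> (\<forall>C\<in>\<C>. M' \<inter> C \<noteq> {}) \<longrightarrow> M' \<subseteq> M \<longrightarrow> M' = M)"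
proof -
  define \<F> where "\<F> = {M. closedin Y M \<and> R M \<and> (\<forall>C\<in>\<C>. M \<inter> C \<noteq> {})}"
  have "topspace Y \<inter> C \<noteq> {}" if "C \<in> \<C>" for C
    using \<C>[OF that] closedin_subset by blast
  then have top: "topspace Y \<in> \<F>"
    using R(1) by (simp add: \<F>_def)
  have Inter: "\<Inter>\<M> \<in> \<F>" if M: "\<M> \<noteq> {}" "\<M> \<subseteq> \<F>"
      and chain: "\<forall>A\<in>\<M>. \<forall>B\<in>\<M>. A \<subseteq> B \<or> B \<subseteq> A" for \<M>
  proof -
    have mem: "closedin Y M" "R M" "\<And>C. C \<in> \<C> \<Longrightarrow> M \<inter> C \<noteq> {}" if "M \<in> \<M>" for M
      using subsetD[OF M(2) that] by (auto simp: \<F>_def)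
    have "closedin Y (\<Inter>\<M>)"
      using M(1) mem(1) by (rule closedin_Inter)
    moreover have "R (\<Inter>\<M>)"
      using M(1) mem(2) by (rule R(2))
    moreover have "\<Inter>\<M> \<inter> C \<noteq> {}" if "C \<in> \<C>" for C
      using mem that by (intro compact_chain_Inter[OF Y \<C>(1)[OF that] M(1) _ chain]) simp
    ultimately show ?thesis
      by (simp add: \<F>_def)
  qed
  \<comment> \<open>Complements turn the minimal sets sought into the maximal ones that Zorn's lemma
    provides.\<close>
  have "\<exists>N\<in>uminus ` \<F>. \<forall>X\<in>uminus ` \<F>. N \<subseteq> X \<longrightarrow> X = N"
  proof (rule subset_Zorn_nonempty)
    show "uminus ` \<F> \<noteq> {}"
      using top by blast
    fix \<D> assume \<D>: "\<D> \<noteq> {}" "subset.chain (uminus ` \<F>) \<D>"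
    then have sub: "\<D> \<subseteq> uminus ` \<F>" and ch: "\<forall>A\<in>\<D>. \<forall>B\<in>\<D>. A \<subseteq> B \<or> B \<subseteq> A"
      by (auto simp: subset_chain_def)
    have "\<Inter> (uminus ` \<D>) \<in> \<F>"
    proof (rule Inter)
      show "uminus ` \<D> \<subseteq> \<F>"
        using image_mono[OF sub, of uminus] by (simp add: image_image)
      show "\<forall>A\<in>uminus ` \<D>. \<forall>B\<in>uminus ` \<D>. A \<subseteq> B \<or> B \<subseteq> A"
      proof (intro ballI)
        fix A B assume "A \<in> uminus ` \<D>" "B \<in> uminus ` \<D>"
        then have "- A \<in> \<D>" "- B \<in> \<D>"
          by auto
        then have "- A \<subseteq> - B \<or> - B \<subseteq> - A"
          using ch by blast
        then show "A \<subseteq> B \<or> B \<subseteq> A"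
          by auto
      qed
    qed (use \<D> in simp)
    then have "- \<Inter> (uminus ` \<D>) \<in> uminus ` \<F>"
      by (rule imageI)
    moreover have "- \<Inter> (uminus ` \<D>) = \<Union>\<D>"
      by auto
    ultimately show "\<Union>\<D> \<in> uminus ` \<F>"
      by (rule back_subst[of "\<lambda>X. X \<in> uminus ` \<F>"])
  qed
  then obtain N where N: "N \<in> uminus ` \<F>" "\<forall>X\<in>uminus ` \<F>. N \<subseteq> X \<longrightarrow> X = N"
    by (rule bexE)
  obtain M where M: "M \<in> \<F>" "N = - M"
    using N(1) by (rule imageE)
  have "M' = M" if "M' \<in> \<F>" "M' \<subseteq> M" for M'
  proof -
    have "- M' \<in> uminus ` \<F>"
      using that(1) by (rule imageI)
    then have "- M' = - M"
      using N(2) M(2) that(2) by (metis Compl_subset_Compl_iff)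
    then show ?thesis
      by simp
  qed
  then show ?thesis
    using M(1) by (intro exI[of _ M]) (simp add: \<F>_def)
qed

lemma continuous_map_G_action:
  assumes "G_space X act"
  shows "continuous_map X X (act g)"
proof -
  have "continuous_map X (prod_topology euclidean X) (\<lambda>x. (g, x))"
    by (intro continuous_map_pairedI) auto
  moreover have "continuous_map (prod_topology euclidean X) X (\<lambda>(g, x). act g x)"
    using assms by (simp add: G_space_def)
  ultimately have "continuous_map X X ((\<lambda>(g, x). act g x) \<circ> (\<lambda>x. (g, x)))"
    by (rule continuous_map_compose)
  then show ?thesis
    by (simp add: o_def)
qed

section \<open>Weak topologies on spaces of bounded continuous functions\<close>

lemma zero_in_dual_on: "(\<lambda>_. 0) \<in> dual_on S"
  by (auto simp: dual_on_def intro!: exI[of _ 0])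

lemma topspace_weak_topology_on [simp]: "topspace (weak_topology_on S) = S"
  using zero_in_dual_on[of S] by (auto simp: weak_topology_on_def)

lemma continuous_map_weak_topology_on_iff:
  "continuous_map X (weak_topology_on S) \<Phi> \<longleftrightarrow>
    \<Phi> ` topspace X \<subseteq> S \<and> (\<forall>\<phi>\<in>dual_on S. continuous_map X euclideanreal (\<lambda>x. \<phi> (\<Phi> x)))"
  (is "?l \<longleftrightarrow> ?r")
proof
  assume l: ?l
  have "continuous_map X euclideanreal (\<lambda>x. \<phi> (\<Phi> x))" if "\<phi> \<in> dual_on S" for \<phi>
    unfolding continuous_map_def
  proof (intro conjI allI impI)
    fix U :: "real set" assume U: "openin euclidean U"
    have "openin (weak_topology_on S) {x\<in>S. \<phi> x \<in> U}"
      unfolding weak_topology_on_def using that U by (intro topology_generated_by_Basis) auto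
    then have "openin X {x \<in> topspace X. \<Phi> x \<in> {x\<in>S. \<phi> x \<in> U}}"
      by (rule openin_continuous_map_preimage[OF l])
    moreover have "{x \<in> topspace X. \<Phi> x \<in> {x\<in>S. \<phi> x \<in> U}} = {x \<in> topspace X. \<phi> (\<Phi> x) \<in> U}"
      using continuous_map_funspace[OF l] by auto
    ultimately show "openin X {x \<in> topspace X. \<phi> (\<Phi> x) \<in> U}"
      by simp
  qed simp
  moreover have "\<Phi> ` topspace X \<subseteq> S"
    using continuous_map_image_subset_topspace[OF l] by simp
  ultimately show ?r
    by blast
next
  assume r: ?r
  show ?l
    unfolding weak_topology_on_def
  proof (rule continuous_on_generated_topo)
    fix W assume "W \<in> {{x \<in> S. \<phi> x \<in> U} |\<phi> U. \<phi> \<in> dual_on S \<and> open U}"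
    then obtain \<phi> U where W: "W = {x \<in> S. \<phi> x \<in> U}" "\<phi> \<in> dual_on S" "open U"
      by blast
    have "openin X {x \<in> topspace X. \<phi> (\<Phi> x) \<in> U}"
      using r W by (intro openin_continuous_map_preimage[of X euclidean]) auto
    moreover have "\<Phi> -` W \<inter> topspace X = {x \<in> topspace X. \<phi> (\<Phi> x) \<in> U}"
      using r W(1) by auto
    ultimately show "openin X (\<Phi> -` W \<inter> topspace X)"
      by simp
  next
    have "topspace (weak_topology_on S) = S"
      by simp
    then show "\<Phi> ` topspace X \<subseteq> \<Union> {{x \<in> S. \<phi> x \<in> U} |\<phi> U. \<phi> \<in> dual_on S \<and> open U}"
      using r unfolding weak_topology_on_def topology_generated_by_topspace by simp
  qed
qed

lemma continuous_map_dual_on: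
  "\<phi> \<in> dual_on S \<Longrightarrow> continuous_map (weak_topology_on S) euclideanreal \<phi>"
  using continuous_map_weak_topology_on_iff[of "weak_topology_on S" S "\<lambda>x. x"] continuous_map_id
  by (simp add: id_def)

lemma evaluation_in_dual_on: "(\<lambda>h. apply_bcontfun h x) \<in> dual_on S" for S :: "('a::topological_space \<Rightarrow>\<^sub>C real) set"
proof -
  have "\<exists>K. \<forall>h\<in>S. \<bar>apply_bcontfun h x\<bar> \<le> K * norm h"
    by (intro exI[of _ 1]) (simp add: norm_bounded flip: real_norm_def)
  then show ?thesis
    by (simp add: dual_on_def)
qed

lemma continuous_map_apply_bcontfun_weak:
  "continuous_map (weak_topology_on S) euclidean (apply_bcontfun :: ('a::topological_space \<Rightarrow>\<^sub>C real) \<Rightarrow> 'a \<Rightarrow> real)"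
  unfolding euclidean_product_topology[symmetric] continuous_map_componentwise_UNIV
  using continuous_map_dual_on[OF evaluation_in_dual_on] by blast

lemma Hausdorff_space_weak_topology_on: "Hausdorff_space (weak_topology_on S)"
  for S :: "('a::topological_space \<Rightarrow>\<^sub>C real) set"
  by (rule Hausdorff_space_injective_preimage[OF Hausdorff_space_fun continuous_map_apply_bcontfun_weak])
     (auto simp: inj_on_def apply_bcontfun_inject)

text \<open>The points of the Stone-Cech compactification, as functionals.\<close>

definition evaluations :: "(('a::topological_space \<Rightarrow>\<^sub>C real) \<Rightarrow> real) set" where
  "evaluations = closure (range (\<lambda>x h. apply_bcontfun h x))"

lemma evaluation_in_evaluations: "(\<lambda>h. apply_bcontfun h x) \<in> evaluations"
  unfolding evaluations_def by (rule subsetD[OF closure_subset]) simp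

lemma evaluations_property:
  assumes "p \<in> evaluations" "closed {p. Q p}" "\<And>x. Q (\<lambda>h. apply_bcontfun h x)"
  shows "Q p"
proof -
  have "evaluations \<subseteq> {p. Q p}"
    unfolding evaluations_def using assms(2,3) by (intro closure_minimal) auto
  then show ?thesis
    using assms(1) by blast
qed

lemma abs_evaluations_le: "p \<in> evaluations \<Longrightarrow> \<bar>p h\<bar> \<le> norm h"
  using norm_bounded[of h]
  by (rule_tac evaluations_property)
     (auto intro!: closed_Collect_le continuous_intros continuous_on_product_coordinates)

lemma compact_evaluations: "compact evaluations"
proof -
  have "evaluations \<subseteq> {p. \<forall>h. \<bar>p h\<bar> \<le> norm h}"
    using abs_evaluations_le by blast
  then have "{p. \<forall>h. \<bar>p h\<bar> \<le> norm h} \<inter> evaluations = evaluations"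
    by (rule Int_absorb1)
  moreover have "compact ({p. \<forall>h. \<bar>p h\<bar> \<le> norm h} \<inter> evaluations)"
    by (rule compact_Int_closed[OF compact_box]) (simp add: evaluations_def)
  ultimately show ?thesis
    by (rule subst)
qed

text \<open>Linearity and the norm bound are closed conditions on coordinates, so they pass from
  point evaluations to their limits. The limits are therefore weakly continuous, which gives
  continuity of the kernels of (b) in the variable opposite to the functional.\<close>

lemma evaluations_in_dual_on:
  assumes "p \<in> evaluations"
  shows "p \<in> dual_on S"
proof -
  have "p (u + v) = p u + p v" for u v
    by (rule evaluations_property[OF assms])
       (auto intro!: closed_Collect_eq continuous_intros continuous_on_product_coordinates)
  moreover have "p (c *\<^sub>R u) = c * p u" for c u
    by (rule evaluations_property[OF assms])
       (auto intro!: closed_Collect_eq continuous_intros continuous_on_product_coordinates)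
  moreover have "\<bar>p u\<bar> \<le> 1 * norm u" for u
    using abs_evaluations_le[OF assms] by simp
  ultimately show ?thesis
    unfolding dual_on_def by blast
qed

text \<open>Weak continuity is tested on one functional at a time. Since \<open>j\<close> places the
  points on which members of \<open>S\<close> are evaluated inside the compact space
  \<open>T\<close>, a functional on \<open>S\<close> can be read as one on a lattice of continuous
  functions on \<open>T\<close>.\<close>

lemma continuous_map_weak_topology_on_kernel:
  fixes \<Phi> :: "'p \<Rightarrow> ('a::topological_space \<Rightarrow>\<^sub>C real)" and h :: "'p \<Rightarrow> 't \<Rightarrow> real"
    and S :: "('a \<Rightarrow>\<^sub>C real) set"
  assumes P: "compact_space P" and T: "compact_space T"
    and S_add: "\<And>u v. u \<in> S \<Longrightarrow> v \<in> S \<Longrightarrow> u + v \<in> S"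
    and S_scale: "\<And>c u. u \<in> S \<Longrightarrow> c *\<^sub>R u \<in> S"
    and S_abs: "\<And>u. u \<in> S \<Longrightarrow> \<exists>v\<in>S. \<forall>a. v a = \<bar>u a\<bar>"
    and j: "\<And>a. j a \<in> topspace T"
    and \<Phi>: "\<And>p. p \<in> topspace P \<Longrightarrow> \<Phi> p \<in> S" "\<And>p a. p \<in> topspace P \<Longrightarrow> \<Phi> p a = h p (j a)"
    and hP: "\<And>t. t \<in> topspace T \<Longrightarrow> continuous_map P euclideanreal (\<lambda>p. h p t)"
    and hT: "\<And>p. p \<in> topspace P \<Longrightarrow> continuous_map T euclideanreal (h p)"
    and b: "\<And>p t. p \<in> topspace P \<Longrightarrow> t \<in> topspace T \<Longrightarrow> \<bar>h p t\<bar> \<le> b"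
  shows "continuous_map P (weak_topology_on S) \<Phi>"
  unfolding continuous_map_weak_topology_on_iff
proof (intro conjI ballI)
  show "\<Phi> ` topspace P \<subseteq> S"
    using \<Phi>(1) by blast
  fix \<phi> assume "\<phi> \<in> dual_on S"
  then obtain K where add: "\<And>x y. x \<in> S \<Longrightarrow> y \<in> S \<Longrightarrow> \<phi> (x + y) = \<phi> x + \<phi> y"
    and scale: "\<And>c x. x \<in> S \<Longrightarrow> \<phi> (c *\<^sub>R x) = c * \<phi> x"
    and K: "\<And>x. x \<in> S \<Longrightarrow> \<bar>\<phi> x\<bar> \<le> K * norm x"
    unfolding dual_on_def by blast
  \<comment> \<open>Composition with \<open>j\<close> sends \<open>L\<close> into \<open>S\<close>;
    pulling \<open>\<phi>\<close> back along this map takes the place of extending it to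
    C(T).\<close>
  define L where "L = {u. continuous_map T euclideanreal u \<and> (\<exists>v\<in>S. \<forall>a. apply_bcontfun v a = u (j a))}"
  define R :: "('t \<Rightarrow> real) \<Rightarrow> ('a \<Rightarrow>\<^sub>C real)" where "R u = Bcontfun (\<lambda>a. u (j a))" for u
  have R_eq: "R u = v" if "\<And>a. apply_bcontfun v a = u (j a)" for u v
    using apply_bcontfun_inverse[of v] that by (simp add: R_def flip: that)
  have R: "R u \<in> S" "apply_bcontfun (R u) a = u (j a)" if "u \<in> L" for u a
    using that R_eq[of _ u] by (auto simp: L_def)
  have R_add: "R (\<lambda>t. u t + v t) = R u + R v" if "u \<in> L" "v \<in> L" for u v
    using that by (intro R_eq) (simp add: R(2))
  have R_scale: "R (\<lambda>t. c * u t) = c *\<^sub>R R u" if "u \<in> L" for c u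
    using that by (intro R_eq) (simp add: R(2))
  \<comment> \<open>The bound in \<open>dual_on\<close> may carry a constant of either sign, so its
    absolute value is passed on.\<close>
  interpret lattice_functional T L "\<lambda>u. \<phi> (R u)" "\<bar>K\<bar>"
  proof
    show "compact_space T"
      by (rule T)
    show "continuous_map T euclideanreal u" if "u \<in> L" for u
      using that by (simp add: L_def)
    show "(\<lambda>t. u t + v t) \<in> L" if "u \<in> L" "v \<in> L" for u v
    proof -
      have "continuous_map T euclideanreal (\<lambda>t. u t + v t)"
        using that by (intro continuous_map_add) (auto simp: L_def)
      then show ?thesis
        unfolding L_def using S_add[OF R(1)[OF that(1)] R(1)[OF that(2)]] that
        by (intro CollectI conjI bexI[of _ "R u + R v"]) (simp_all add: R(2))
    qed
    show "(\<lambda>t. c * u t) \<in> L" if "u \<in> L" for c u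
    proof -
      have "continuous_map T euclideanreal (\<lambda>t. c * u t)"
        using that by (intro continuous_map_real_mult_left) (auto simp: L_def)
      then show ?thesis
        unfolding L_def using S_scale[OF R(1)[OF that]] that
        by (intro CollectI conjI bexI[of _ "c *\<^sub>R R u"]) (simp_all add: R(2))
    qed
    show "(\<lambda>t. \<bar>u t\<bar>) \<in> L" if "u \<in> L" for u
    proof -
      have "continuous_map T euclideanreal (\<lambda>t. \<bar>u t\<bar>)"
        using that by (intro continuous_map_real_abs) (auto simp: L_def)
      then show ?thesis
        using S_abs[OF R(1)[OF that]] R(2)[OF that] by (simp add: L_def)
    qed
    show "\<phi> (R (\<lambda>t. u t + v t)) = \<phi> (R u) + \<phi> (R v)" if "u \<in> L" "v \<in> L" for u v
      using that by (simp add: R_add add R(1))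
    show "\<phi> (R (\<lambda>t. c * u t)) = c * \<phi> (R u)" if "u \<in> L" for c u
      using that by (simp add: R_scale scale R(1))
    show "\<bar>\<phi> (R u)\<bar> \<le> \<bar>K\<bar> * b" if u: "u \<in> L" and b: "\<And>t. t \<in> topspace T \<Longrightarrow> \<bar>u t\<bar> \<le> b" for u b
    proof -
      have "norm (R u) \<le> b"
        using b[OF j] R(2)[OF u] by (intro norm_bound) simp
      then have "\<bar>K\<bar> * norm (R u) \<le> \<bar>K\<bar> * b"
        by (rule mult_left_mono) simp
      moreover have "K * norm (R u) \<le> \<bar>K\<bar> * norm (R u)"
        by (rule mult_right_mono) auto
      ultimately show ?thesis
        using K[OF R(1)[OF u]] by linarith
    qed
  qed simp
  have hL: "h p \<in> L" if "p \<in> topspace P" for p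
    using that \<Phi> hT by (auto simp: L_def)
  have "continuous_map P euclideanreal (\<lambda>p. \<phi> (R (h p)))"
    using P hP hL b by (rule continuous_map_functional_of_kernel)
  moreover have "R (h p) = \<Phi> p" if "p \<in> topspace P" for p
    using \<Phi>(2)[OF that] by (rule R_eq)
  ultimately show "continuous_map P euclideanreal (\<lambda>p. \<phi> (\<Phi> p))"
    by (auto intro: continuous_map_eq)
qed

section \<open>RUC(G) as a vector lattice\<close>

lemma dist_translate_group_le_iff:
  "dist (translate (+) u g) (translate (+) u g0) \<le> b \<longleftrightarrow> (\<forall>h. \<bar>u (g + h) - u (g0 + h)\<bar> \<le> b)"
  for g g0 :: "'g::topological_group_add"
  by (simp add: dist_bcontfun_le_iff apply_translate_group dist_real_def)

lemma RUC_group_add: "u \<in> RUC_group \<Longrightarrow> v \<in> RUC_group \<Longrightarrow> u + v \<in> RUC_group"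
  for u v :: "'g::topological_group_add \<Rightarrow>\<^sub>C real"
proof -
  have "translate (+) (u + v) = (\<lambda>g. translate (+) u g + translate (+) v g)"
    by (intro ext bcontfun_eqI) (simp add: apply_translate_group)
  then show "u \<in> RUC_group \<Longrightarrow> v \<in> RUC_group \<Longrightarrow> u + v \<in> RUC_group"
    by (simp add: RUC_def continuous_on_add)
qed

lemma RUC_group_scaleR: "u \<in> RUC_group \<Longrightarrow> c *\<^sub>R u \<in> RUC_group"
  for u :: "'g::topological_group_add \<Rightarrow>\<^sub>C real"
proof -
  have "translate (+) (c *\<^sub>R u) = (\<lambda>g. c *\<^sub>R translate (+) u g)"
    by (intro ext bcontfun_eqI) (simp add: apply_translate_group)
  then show "u \<in> RUC_group \<Longrightarrow> c *\<^sub>R u \<in> RUC_group"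
    by (simp add: RUC_def continuous_on_scaleR)
qed

lemma abs_bcontfun:
  fixes u :: "'a::topological_space \<Rightarrow>\<^sub>C real"
  obtains v :: "'a \<Rightarrow>\<^sub>C real" where "\<And>a. v a = \<bar>u a\<bar>"
proof -
  have "(\<lambda>a. \<bar>u a\<bar>) \<in> bcontfun"
    using norm_bounded[of u] by (intro bcontfun_normI continuous_intros) auto
  then show ?thesis
    by (intro that[of "Bcontfun (\<lambda>a. \<bar>u a\<bar>)"]) (simp add: Bcontfun_inverse)
qed

text \<open>The absolute value on the reals is a contraction, so it does not increase the distance
  between translates. This is the lattice condition on \<open>S\<close> in the kernel lemma.\<close>

lemma RUC_group_abs:
  fixes u :: "'g::topological_group_add \<Rightarrow>\<^sub>C real"
  assumes u: "u \<in> RUC_group"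
  shows "\<exists>v\<in>RUC_group. \<forall>a. v a = \<bar>u a\<bar>"
proof -
  obtain v :: "'g \<Rightarrow>\<^sub>C real" where v: "\<And>a. v a = \<bar>u a\<bar>"
    using abs_bcontfun by blast
  have le: "dist (translate (+) v g) (translate (+) v g0) \<le> dist (translate (+) u g) (translate (+) u g0)" for g g0
  proof -
    have "\<bar>u (g + h) - u (g0 + h)\<bar> \<le> dist (translate (+) u g) (translate (+) u g0)" for h
      using dist_translate_group_le_iff[of u g g0] by blast
    moreover have "\<bar>\<bar>u (g + h)\<bar> - \<bar>u (g0 + h)\<bar>\<bar> \<le> \<bar>u (g + h) - u (g0 + h)\<bar>" for h
      by (rule abs_triangle_ineq3)
    ultimately show ?thesis
      unfolding dist_translate_group_le_iff v by (meson order_trans)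
  qed
  have "(translate (+) u \<longlongrightarrow> translate (+) u g0) (at g0)" for g0
    using u by (simp add: RUC_def continuous_on_def)
  then have "(translate (+) v \<longlongrightarrow> translate (+) v g0) (at g0)" for g0
    by (rule metric_tendsto_imp_tendsto) (simp add: le)
  then have "v \<in> RUC_group"
    by (simp add: RUC_def continuous_on_def)
  then show ?thesis
    using v by blast
qed

section \<open>The compact G-space \<open>X\<^sub>f\<close>\<close>

locale ruc_function =
  fixes act :: "'g::topological_group_add \<Rightarrow> 'x::topological_space \<Rightarrow> 'x" and f :: "'x \<Rightarrow>\<^sub>C real"
  assumes G: "G_space euclidean act" and f: "f \<in> RUC act"
begin

abbreviation "Xfun \<equiv> Xf_Omega act f"

lemma act_add: "act (g + h) x = act g (act h x)"
  using G by (simp add: G_space_def)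

lemma f_sharp_act: "f_sharp act f (act g x) = Omega_act g (f_sharp act f x)"
  by (simp add: f_sharp_def Omega_act_def act_add)

lemma Omega_act_add: "Omega_act (g + h) \<omega> = Omega_act g (Omega_act h \<omega>)" for g h :: 'g
  by (simp add: Omega_act_def add.assoc)

lemma continuous_on_f_sharp: "continuous_on UNIV (f_sharp act f)"
proof (rule continuous_on_coordinatewise_then_product)
  fix g
  have "(\<lambda>x. f_sharp act f x g) = apply_bcontfun (translate act f g)"
    by (rule ext) (simp add: f_sharp_def apply_translate[OF G])
  then show "continuous_on UNIV (\<lambda>x. f_sharp act f x g)"
    by (simp only: continuous_on_apply_bcontfun)
qed

text \<open>The box of functions bounded by \<open>norm f\<close> is closed among all functions on
  the group, so closing the image of X inside \<open>Omega f\<close> or in the full product gives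
  the same set.\<close>

lemma closed_Xfun: "closed Xfun"
  and Xfun_eq_closure: "Xfun = closure (range (f_sharp act f))"
proof -
  let ?B = "PiE (UNIV :: 'g set) (\<lambda>_. {- norm f .. norm f})"
  have top: "Omega f = subtopology euclidean ?B"
    by (simp add: Omega_def flip: euclidean_product_topology subtopology_product_topology)
  have sub: "range (f_sharp act f) \<subseteq> ?B"
    using norm_bounded[of f] by (auto simp: f_sharp_def abs_le_iff minus_le_iff)
  have "?B = {\<omega>. \<forall>i. \<bar>\<omega> i\<bar> \<le> norm f}"
    by (auto simp: PiE_iff abs_le_iff minus_le_iff)
  then have "closed ?B"
    by (simp add: compact_imp_closed_fun[OF compact_box])
  then have "closure (range (f_sharp act f)) \<subseteq> ?B"
    using sub by (rule closure_minimal[rotated])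
  then show "Xfun = closure (range (f_sharp act f))"
    unfolding Xf_Omega_def top using sub by (simp add: closure_of_subtopology Int_absorb1)
  then show "closed Xfun"
    by simp
qed

lemma compact_Xfun: "compact Xfun"
proof -
  have "Xfun \<subseteq> {\<omega>. \<forall>i. \<bar>\<omega> i\<bar> \<le> norm f}"
    using Xf_Omega_estimate(1)[OF G] by blast
  then show ?thesis
    using closed_Xfun compact_box[of "\<lambda>_. norm f"] by (metis compact_Int_closed inf.absorb_iff2)
qed

lemma f_sharp_in_Xfun: "f_sharp act f x \<in> Xfun"
  unfolding Xfun_eq_closure by (rule subsetD[OF closure_subset]) simp

lemma Omega_act_in_Xfun:
  assumes "\<omega> \<in> Xfun"
  shows "Omega_act g \<omega> \<in> Xfun"
proof -
  have "continuous_on UNIV (Omega_act g :: ('g \<Rightarrow> real) \<Rightarrow> _)"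
    unfolding Omega_act_def
    by (intro continuous_on_coordinatewise_then_product continuous_on_product_coordinates)
  then have "Omega_act g ` closure (range (f_sharp act f)) \<subseteq> Xfun"
  proof (intro image_closure_subset closed_Xfun)
    show "Omega_act g ` range (f_sharp act f) \<subseteq> Xfun"
      using f_sharp_in_Xfun by (auto simp flip: f_sharp_act)
  qed (auto intro: continuous_on_subset)
  then show ?thesis
    using assms by (auto simp: Xfun_eq_closure)
qed

lemma Xfun_lift: "\<omega> \<in> Xfun \<Longrightarrow> apply_bcontfun (Bcontfun \<omega>) = \<omega>"
  using apply_bcontfun_Xf[OF G f] by (metis apply_bcontfun_inverse imageE)

lemma Xfun_cases:
  assumes "\<omega> \<in> Xfun"
  obtains \<psi> where "\<psi> \<in> Xf act f" "apply_bcontfun \<psi> = \<omega>"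
  using Xfun_lift[OF assms] assms by (metis Xf_def mem_Collect_eq)

lemma bounded_Xf: "bounded (Xf act f)"
  unfolding bounded_iff
  using Xf_Omega_estimate(1)[OF G] by (intro exI[of _ "norm f"] ballI norm_bound) (auto simp: Xf_def)

lemma translate_tendsto: "(translate act f \<longlongrightarrow> translate act f g) (nhds g)"
proof -
  have "(translate act f \<longlongrightarrow> translate act f g) (at g)"
    using f by (simp add: RUC_def continuous_on_def)
  then show ?thesis
    by (simp add: tendsto_at_iff_tendsto_nhds)
qed

text \<open>All members of \<open>Xfun\<close> inherit the modulus of continuity of
  \<open>translate act f\<close>. This equicontinuity allows the point of evaluation and the
  function to move at the same time, and so makes the action on \<open>Xfun\<close> jointly
  continuous.\<close>

lemma tendsto_eval_Xfun:
  assumes a: "(a \<longlongrightarrow> g0) F" and w: "(w \<longlongrightarrow> \<omega>0) F" and X: "\<forall>\<^sub>F p in F. w p \<in> Xfun"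
  shows "((\<lambda>p. w p (h + a p)) \<longlongrightarrow> \<omega>0 (h + g0)) F"
proof -
  let ?d = "\<lambda>p. dist (translate act f (h + a p)) (translate act f (h + g0)) + dist (w p (h + g0)) (\<omega>0 (h + g0))"
  have "((\<lambda>p. translate act f (h + a p)) \<longlongrightarrow> translate act f (h + g0)) F"
    by (rule filterlim_compose[OF translate_tendsto tendsto_add[OF tendsto_const a]])
  moreover have "((\<lambda>p. w p (h + g0)) \<longlongrightarrow> \<omega>0 (h + g0)) F"
  proof (rule filterlim_compose[OF _ w])
    show "((\<lambda>\<omega>. \<omega> (h + g0)) \<longlongrightarrow> \<omega>0 (h + g0)) (nhds \<omega>0)"
    proof -
      have "continuous_on UNIV (\<lambda>\<omega> :: 'g \<Rightarrow> real. \<omega> (h + g0))"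
        by (rule continuous_on_product_coordinates)
      then show ?thesis
        using tendsto_at_iff_tendsto_nhds[of "\<lambda>\<omega>. \<omega> (h + g0)" \<omega>0] by (simp add: continuous_on_def)
    qed
  qed
  ultimately have d: "(?d \<longlongrightarrow> 0) F"
    by (intro tendsto_add_zero iffD1[OF tendsto_dist_iff])
  have "\<forall>\<^sub>F p in F. norm (dist (w p (h + a p)) (\<omega>0 (h + g0))) \<le> ?d p"
    using X
  proof eventually_elim
    case (elim p)
    have "dist (w p (h + a p)) (w p (h + g0)) \<le> dist (translate act f (h + a p)) (translate act f (h + g0))"
      using Xf_Omega_estimate(2)[OF G elim, of "h + a p" 0 "h + g0"] by (simp only: dist_real_def add_0_right)
    then show ?case
      using dist_triangle[of "w p (h + a p)" "\<omega>0 (h + g0)" "w p (h + g0)"] by simp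
  qed
  then have "((\<lambda>p. dist (w p (h + a p)) (\<omega>0 (h + g0))) \<longlongrightarrow> 0) F"
    using d by (rule Lim_null_comparison)
  then show ?thesis
    by (rule iffD2[OF tendsto_dist_iff])
qed

lemma continuous_on_Omega_act: "continuous_on (UNIV \<times> Xfun) (\<lambda>(g, \<omega>). Omega_act g \<omega>)"
proof (rule continuous_on_coordinatewise_then_product)
  fix h
  have "((\<lambda>p. snd p (h + fst p)) \<longlongrightarrow> snd q (h + fst q)) (at q within UNIV \<times> Xfun)" for q
    by (intro tendsto_eval_Xfun tendsto_fst tendsto_snd tendsto_ident_at)
       (auto simp: eventually_at_filter intro!: always_eventually)
  then show "continuous_on (UNIV \<times> Xfun) (\<lambda>p. (case p of (g, \<omega>) \<Rightarrow> Omega_act g \<omega>) h)"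
    unfolding continuous_on_def Omega_act_def case_prod_unfold by blast
qed

lemma compact_G_space_Xfun: "compact_G_space (top_of_set Xfun) Omega_act"
proof -
  have "prod_topology euclidean (top_of_set Xfun) = top_of_set ((UNIV :: 'g set) \<times> Xfun)"
    using prod_topology_subtopology_eu[of "UNIV :: 'g set" Xfun] by simp
  then have "continuous_map (prod_topology euclidean (top_of_set Xfun)) (top_of_set Xfun)
      (\<lambda>(g, \<omega>). Omega_act g \<omega>)"
    using continuous_on_Omega_act Omega_act_in_Xfun by (auto simp: continuous_map_in_subtopology)
  moreover have "compact_space (top_of_set Xfun)" "Hausdorff_space (top_of_set Xfun)"
    using compact_Xfun by (simp_all add: compact_space_subtopology Hausdorff_space_subtopology Hausdorff_space_fun)
  ultimately show ?thesis
    unfolding compact_G_space_def G_space_def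
    by (simp add: compact_Hausdorff_or_regular_imp_normal_space normal_imp_completely_regular_space_A
        Hausdorff_imp_t1_space Omega_act_add) (simp add: Omega_act_def)
qed

lemma comes_from_Xfun: "comes_from act f (top_of_set Xfun) Omega_act"
  unfolding comes_from_def
proof (intro exI conjI allI)
  show "continuous_map euclidean (top_of_set Xfun) (f_sharp act f)"
    using continuous_on_f_sharp f_sharp_in_Xfun by (auto simp: continuous_map_in_subtopology)
  show "f_sharp act f (act g x) = Omega_act g (f_sharp act f x)" for g x
    by (rule f_sharp_act)
  have "range (f_sharp act f) \<subseteq> Xfun"
    using f_sharp_in_Xfun by blast
  then show "top_of_set Xfun closure_of range (f_sharp act f) = topspace (top_of_set Xfun)"
    by (simp add: closure_of_subtopology Int_absorb1 flip: Xfun_eq_closure)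
  show "continuous_map (top_of_set Xfun) euclideanreal (\<lambda>\<omega>. \<omega> 0)"
    using continuous_on_subset[OF continuous_on_product_coordinates subset_UNIV] by simp
  show "bounded ((\<lambda>\<omega>. \<omega> 0) ` topspace (top_of_set Xfun))"
    using Xf_Omega_estimate(1)[OF G] by (auto simp: bounded_iff)
  show "apply_bcontfun f x = f_sharp act f x 0" for x
    using G by (simp add: f_sharp_def G_space_def)
qed

text \<open>Density of the image of X puts the image of \<open>\<phi>\<close> inside
  \<open>Xfun\<close>; compactness makes that image closed, which gives equality. The function
  \<open>F\<close> is exposed because the later arguments use entourages of \<open>Y\<close> only
  through differences of \<open>F\<close> along orbits.\<close>

lemma factor_map:
  assumes Y: "compact_G_space Y actY" and c: "comes_from act f Y actY"
  shows "\<exists>F \<phi>. continuous_map Y euclideanreal F \<and> continuous_map Y euclidean \<phi> \<and>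
    \<phi> ` topspace Y = Xfun \<and> (\<forall>g y. \<phi> y g = F (actY g y)) \<and>
    (\<forall>g. \<forall>y\<in>topspace Y. \<phi> (actY g y) = Omega_act g (\<phi> y))"
proof -
  obtain \<nu> F where \<nu>: "continuous_map euclidean Y \<nu>" "\<And>g x. \<nu> (act g x) = actY g (\<nu> x)"
      "Y closure_of range \<nu> = topspace Y"
    and F: "continuous_map Y euclideanreal F" "\<And>x. f x = F (\<nu> x)"
    using c unfolding comes_from_def by blast
  have add: "\<And>g h y. y \<in> topspace Y \<Longrightarrow> actY (g + h) y = actY g (actY h y)"
    and cact: "\<And>g. continuous_map Y Y (actY g)"
    using Y continuous_map_G_action[of Y actY] by (simp_all add: compact_G_space_def G_space_def)
  define \<phi> where "\<phi> y = (\<lambda>g. F (actY g y))" for y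
  have c\<phi>: "continuous_map Y euclidean \<phi>"
    unfolding euclidean_product_topology[symmetric] continuous_map_componentwise_UNIV \<phi>_def
    using continuous_map_compose[OF cact F(1)] by (simp add: o_def)
  have \<phi>\<nu>: "\<phi> (\<nu> x) = f_sharp act f x" for x
    by (simp add: \<phi>_def f_sharp_def F(2) \<nu>(2))
  have "\<phi> ` topspace Y = Xfun"
  proof
    have "\<phi> ` (Y closure_of range \<nu>) \<subseteq> euclidean closure_of \<phi> ` range \<nu>"
      using c\<phi> by (rule continuous_map_image_closure_subset)
    then show "\<phi> ` topspace Y \<subseteq> Xfun"
      by (simp add: \<nu>(3) Xfun_eq_closure image_image \<phi>\<nu>)
    have "compactin euclidean (\<phi> ` topspace Y)"
      using c\<phi> Y by (intro image_compactin[of Y]) (auto simp: compact_G_space_def compact_space_def)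
    then have "closed (\<phi> ` topspace Y)"
      by (simp add: compact_imp_closed_fun)
    moreover have "range (f_sharp act f) \<subseteq> \<phi> ` topspace Y"
      using \<nu>(1) by (force simp: continuous_map_def simp flip: \<phi>\<nu>)
    ultimately show "Xfun \<subseteq> \<phi> ` topspace Y"
      unfolding Xfun_eq_closure by (rule closure_minimal[rotated])
  qed
  moreover have "\<phi> (actY g y) = Omega_act g (\<phi> y)" if "y \<in> topspace Y" for g y
    using add[OF that] by (simp add: \<phi>_def Omega_act_def)
  ultimately show ?thesis
    using F(1) c\<phi> by (intro exI[of _ F] exI[of _ \<phi>]) (simp add: \<phi>_def)
qed

end

section \<open>Norm compactness\<close>

text \<open>Round the entries of each row down to multiples of \<open>d\<close> at the columns of a
  finite net. Boundedness leaves finitely many rounded rows, and two rows with the same rounding are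
  close at every column.\<close>

lemma bounded_kernel_finite_net:
  fixes m :: "'a \<Rightarrow> 'b \<Rightarrow> real"
  assumes bdd: "\<And>a b. a \<in> A \<Longrightarrow> b \<in> B \<Longrightarrow> \<bar>m a b\<bar> \<le> c"
    and cols: "\<And>e. 0 < e \<Longrightarrow> \<exists>k\<subseteq>B. finite k \<and> (\<forall>b\<in>B. \<exists>b'\<in>k. \<forall>a\<in>A. \<bar>m a b - m a b'\<bar> \<le> e)"
    and e: "0 < e"
  shows "\<exists>k\<subseteq>A. finite k \<and> (\<forall>a\<in>A. \<exists>a'\<in>k. \<forall>b\<in>B. \<bar>m a b - m a' b\<bar> \<le> e)"
proof -
  \<comment> \<open>Three errors are added: two for replacing a column by a column of the net, one
    for the rounding.\<close>
  define d where "d = e / 3"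
  have d: "0 < d"
    using e by (simp add: d_def)
  obtain B' where B: "B' \<subseteq> B" "finite B'" "\<And>b. b \<in> B \<Longrightarrow> \<exists>b'\<in>B'. \<forall>a\<in>A. \<bar>m a b - m a b'\<bar> \<le> d"
    using cols[OF d] by blast
  define q where "q a = restrict (\<lambda>b. \<lfloor>m a b / d\<rfloor>) B'" for a
  have "q a \<in> PiE B' (\<lambda>_. {\<lfloor>- c / d\<rfloor> .. \<lfloor>c / d\<rfloor>})" if "a \<in> A" for a
  proof (rule PiE_I)
    fix b assume "b \<in> B'"
    then have "- c \<le> m a b" "m a b \<le> c"
      using bdd[OF that, of b] B(1) by auto
    then have "- c / d \<le> m a b / d" "m a b / d \<le> c / d"
      using d by (metis divide_right_mono less_imp_le)+
    then show "q a b \<in> {\<lfloor>- c / d\<rfloor> .. \<lfloor>c / d\<rfloor>}"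
      using \<open>b \<in> B'\<close> by (simp only: q_def restrict_apply' floor_mono atLeastAtMost_iff simp_thms)
  qed (simp add: q_def)
  then have fin: "finite (q ` A)"
    using B(2) by (intro finite_subset[OF _ finite_PiE[of B' "\<lambda>_. {\<lfloor>- c / d\<rfloor> .. \<lfloor>c / d\<rfloor>}"]]) auto
  obtain A' where A': "A' \<subseteq> A" "finite A'" "q ` A = q ` A'"
    using finite_subset_image[OF fin order_refl] by metis
  have "\<exists>a'\<in>A'. \<forall>b\<in>B. \<bar>m a b - m a' b\<bar> \<le> e" if a: "a \<in> A" for a
  proof -
    have "q a \<in> q ` A'"
      using a A'(3) by blast
    then obtain a' where a': "a' \<in> A'" "q a = q a'"
      by blast
    have "\<bar>m a b - m a' b\<bar> \<le> e" if b: "b \<in> B" for b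
    proof -
      obtain b' where b': "b' \<in> B'" "\<forall>a\<in>A. \<bar>m a b - m a b'\<bar> \<le> d"
        using B(3)[OF b] by blast
      have "\<lfloor>m a b' / d\<rfloor> = \<lfloor>m a' b' / d\<rfloor>"
        using fun_cong[OF a'(2), of b'] b'(1) by (simp add: q_def)
      then have "\<bar>m a b' / d - m a' b' / d\<bar> < 1"
        by linarith
      then have "\<bar>m a b' - m a' b'\<bar> / d < 1"
        using d by (simp add: abs_divide flip: diff_divide_distrib)
      then have "\<bar>m a b' - m a' b'\<bar> < d"
        using d by simp
      moreover have "\<bar>m a b - m a b'\<bar> \<le> d" "\<bar>m a' b - m a' b'\<bar> \<le> d"
        using b'(2) a a' A'(1) by auto
      ultimately show ?thesis
        unfolding d_def by linarith
    qed
    then show ?thesis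
      using a'(1) by blast
  qed
  then show ?thesis
    using A' by blast
qed

lemma complete_bcontfun: "complete (UNIV :: ('a::topological_space \<Rightarrow>\<^sub>C 'b::complete_space) set)"
  unfolding complete_def
proof (intro allI impI)
  fix u :: "nat \<Rightarrow> 'a \<Rightarrow>\<^sub>C 'b"
  assume u: "(\<forall>n. u n \<in> UNIV) \<and> Cauchy u"
  \<comment> \<open>The conjunct \<open>True\<close> instantiates the predicate in
    \<open>uniformly_convergent_eq_cauchy\<close>.\<close>
  have "\<forall>e>0. \<exists>N. \<forall>m n x. N \<le> m \<and> N \<le> n \<and> True \<longrightarrow> dist (u m x) (u n x) < e"
  proof (intro allI impI)
    fix e :: real assume "0 < e"
    then obtain N where "\<forall>m\<ge>N. \<forall>n\<ge>N. dist (u m) (u n) < e"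
      using u unfolding Cauchy_def by blast
    then show "\<exists>N. \<forall>m n x. N \<le> m \<and> N \<le> n \<and> True \<longrightarrow> dist (u m x) (u n x) < e"
      by (intro exI[of _ N]) (simp add: dist_fun_lt_imp_dist_val_lt)
  qed
  from iffD2[OF uniformly_convergent_eq_cauchy this]
  obtain v where "\<forall>e>0. \<exists>N. \<forall>n x. N \<le> n \<and> True \<longrightarrow> dist (u n x) (v x) < e"
    by (rule exE)
  then have "uniform_limit UNIV (\<lambda>n. apply_bcontfun (u n)) v sequentially"
    by (simp add: uniform_limit_sequentially_iff)
  then obtain l where "v = apply_bcontfun l" "u \<longlonglongrightarrow> l"
    using uniform_limit_bcontfunE[OF _ sequentially_bot] by metis
  then show "\<exists>l\<in>UNIV. u \<longlonglongrightarrow> l"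
    by (intro bexI[of _ l]) simp_all
qed

lemma compact_closure_if_finite_nets:
  fixes S :: "('a::topological_space \<Rightarrow>\<^sub>C 'b::complete_space) set"
  assumes "\<And>e. 0 < e \<Longrightarrow> \<exists>k. finite k \<and> S \<subseteq> (\<Union>x\<in>k. cball x e)"
  shows "compact (closure S)"
  unfolding compact_eq_totally_bounded
proof (intro conjI allI impI)
  show "complete (closure S)"
    by (rule complete_closed_subset[OF closed_closure subset_UNIV complete_bcontfun])
  fix e :: real assume e: "0 < e"
  \<comment> \<open>A finite union of closed balls of half the radius is closed, so it contains the
    closure and still fits into the open balls of radius \<open>e\<close>.\<close>
  then obtain k where k: "finite k" "S \<subseteq> (\<Union>x\<in>k. cball x (e / 2))"
    using assms[OF half_gt_zero] by meson
  have "closed (\<Union>x\<in>k. cball x (e / 2))"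
    using k(1) by (intro closed_UN) auto
  then have "closure S \<subseteq> (\<Union>x\<in>k. cball x (e / 2))"
    using k(2) by (rule closure_minimal[rotated])
  also have "\<dots> \<subseteq> (\<Union>x\<in>k. ball x e)"
    using e by (intro UN_mono order_refl subsetI) simp
  finally show "\<exists>k. finite k \<and> closure S \<subseteq> (\<Union>x\<in>k. ball x e)"
    using k(1) by blast
qed

lemma compact_finite_net:
  assumes "compact S" "0 < e"
  obtains k where "finite k" "k \<subseteq> S" "S \<subseteq> (\<Union>x\<in>k. ball x e)"
  using seq_compact_imp_totally_bounded[of S] assms compact_imp_seq_compact by blast

context ruc_function
begin

lemma apply_Xf: "\<psi> \<in> Xf act f \<Longrightarrow> apply_bcontfun \<psi> \<in> Xfun"
  by (simp add: Xf_def)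

lemma closed_Xf: "closed (Xf act f)"
proof -
  have "open (apply_bcontfun -` (- Xfun) :: ('g \<Rightarrow>\<^sub>C real) set)"
    using closed_Xfun by (intro open_vimage continuous_on_apply_bcontfun_fun) auto
  then show ?thesis
    by (simp add: Xf_def vimage_def closed_def Compl_eq)
qed

theorem compact_Xf_iff_AP: "compact (Xf act f) \<longleftrightarrow> AP act f"
proof
  assume cpt: "compact (Xf act f)"
  show "AP act f"
    unfolding AP_def
  proof (rule compact_closure_if_finite_nets)
    fix e :: real assume e: "0 < e"
    \<comment> \<open>Rows are group elements and columns are members of X_f. Two rows that are
      uniformly close give translates of \<open>f\<close> that are close in norm, because every
      \<open>f_sharp act f x\<close> is one of the columns.\<close>
    have "\<exists>k\<subseteq>UNIV. finite k \<and> (\<forall>g\<in>UNIV. \<exists>g'\<in>k. \<forall>\<psi>\<in>Xf act f. \<bar>\<psi> g - \<psi> g'\<bar> \<le> e)"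
    proof (rule bounded_kernel_finite_net[OF _ _ e, where m = "\<lambda>g \<psi>. apply_bcontfun \<psi> g"])
      show "\<bar>\<psi> g\<bar> \<le> norm f" if "\<psi> \<in> Xf act f" for g and \<psi> :: "'g \<Rightarrow>\<^sub>C real"
        using Xf_Omega_estimate(1)[OF G apply_Xf[OF that]] .
      fix d :: real assume d: "0 < d"
      obtain k where k: "finite k" "k \<subseteq> Xf act f" "Xf act f \<subseteq> (\<Union>x\<in>k. ball x d)"
        using compact_finite_net[OF cpt d] by blast
      have "\<exists>\<psi>'\<in>k. \<forall>g\<in>UNIV. \<bar>\<psi> g - \<psi>' g\<bar> \<le> d" if \<psi>: "\<psi> \<in> Xf act f" for \<psi>
      proof -
        obtain \<psi>' where "\<psi>' \<in> k" "dist \<psi> \<psi>' \<le> d"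
          using subsetD[OF k(3) \<psi>] by (auto simp: dist_commute)
        then show ?thesis
          unfolding dist_bcontfun_le_iff dist_real_def by blast
      qed
      then show "\<exists>k\<subseteq>Xf act f. finite k \<and> (\<forall>\<psi>\<in>Xf act f. \<exists>\<psi>'\<in>k. \<forall>g\<in>UNIV. \<bar>\<psi> g - \<psi>' g\<bar> \<le> d)"
        using k by blast
    qed
    then obtain k where k: "finite k" "\<And>g. \<exists>g'\<in>k. \<forall>\<psi>\<in>Xf act f. \<bar>\<psi> g - \<psi> g'\<bar> \<le> e"
      by blast
    have "translate act f g \<in> (\<Union>h\<in>translate act f ` k. cball h e)" for g
    proof -
      obtain g' where g': "g' \<in> k" "\<forall>\<psi>\<in>Xf act f. \<bar>\<psi> g - \<psi> g'\<bar> \<le> e"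
        using k(2) by blast
      have "\<bar>f (act g x) - f (act g' x)\<bar> \<le> e" for x
        using Xfun_cases[OF f_sharp_in_Xfun[of x]] g'(2) by (metis f_sharp_def)
      then have "dist (translate act f g') (translate act f g) \<le> e"
        by (simp add: dist_bcontfun_le_iff apply_translate[OF G] dist_real_def abs_minus_commute)
      then show ?thesis
        using g'(1) by auto
    qed
    then show "\<exists>k. finite k \<and> range (translate act f) \<subseteq> (\<Union>h\<in>k. cball h e)"
      using k(1) by (intro exI[of _ "translate act f ` k"]) auto
  qed
next
  assume AP: "AP act f"
  have "compact (closure (Xf act f))"
  proof (rule compact_closure_if_finite_nets)
    fix e :: real assume e: "0 < e"
    have "\<exists>k\<subseteq>Xf act f. finite k \<and> (\<forall>\<psi>\<in>Xf act f. \<exists>\<psi>'\<in>k. \<forall>g\<in>UNIV. \<bar>\<psi> g - \<psi>' g\<bar> \<le> e)"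
    proof (rule bounded_kernel_finite_net[OF _ _ e])
      show "\<bar>\<psi> g\<bar> \<le> norm f" if "\<psi> \<in> Xf act f" for g and \<psi> :: "'g \<Rightarrow>\<^sub>C real"
        using Xf_Omega_estimate(1)[OF G apply_Xf[OF that]] .
      fix d :: real assume d: "0 < d"
      obtain k where k: "finite k" "k \<subseteq> closure (range (translate act f))"
          "closure (range (translate act f)) \<subseteq> (\<Union>x\<in>k. ball x (d / 2))"
        using compact_finite_net[of "closure (range (translate act f))" "d / 2"] AP d
        by (auto simp: AP_def)
      \<comment> \<open>The centres of the net lie only in the closure of the set of translates.
        Replacing them by nearby translates costs the second half of \<open>d\<close>.\<close>
      have "\<exists>g. dist (translate act f g) h < d / 2" if "h \<in> k" for h
        using k(2) that d by (metis closure_approachable half_gt_zero rangeE subsetD)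
      then obtain p where p: "\<And>h. h \<in> k \<Longrightarrow> dist (translate act f (p h)) h < d / 2"
        by metis
      have "\<exists>g'\<in>p ` k. \<forall>\<psi>\<in>Xf act f. \<bar>\<psi> g - \<psi> g'\<bar> \<le> d" for g
      proof -
        have "translate act f g \<in> closure (range (translate act f))"
          by (rule subsetD[OF closure_subset]) simp
        then obtain h where h: "h \<in> k" "dist h (translate act f g) < d / 2"
          using k(3) by auto
        have "dist (translate act f g) (translate act f (p h)) \<le> d"
          using dist_triangle[of "translate act f g" "translate act f (p h)" h] h(2) p[OF h(1)]
          by (simp add: dist_commute)
        moreover have "\<bar>\<psi> g - \<psi> (p h)\<bar> \<le> dist (translate act f g) (translate act f (p h))"
          if "\<psi> \<in> Xf act f" for \<psi>
          using Xf_Omega_estimate(2)[OF G apply_Xf[OF that], of g 0 "p h"] by simp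
        ultimately show ?thesis
          using h(1) by (intro bexI[of _ "p h"]) (auto intro: order_trans)
      qed
      then show "\<exists>k\<subseteq>UNIV. finite k \<and> (\<forall>g\<in>UNIV. \<exists>g'\<in>k. \<forall>\<psi>\<in>Xf act f. \<bar>\<psi> g - \<psi> g'\<bar> \<le> d)"
        using k(1) by (intro exI[of _ "p ` k"]) auto
    qed
    then obtain k :: "('g \<Rightarrow>\<^sub>C real) set" where k: "finite k" "\<And>\<psi>. \<psi> \<in> Xf act f \<Longrightarrow> \<exists>\<psi>'\<in>k. \<forall>g. \<bar>\<psi> g - \<psi>' g\<bar> \<le> e"
      by auto
    have "Xf act f \<subseteq> (\<Union>\<psi>\<in>k. cball \<psi> e)"
      using k(2) by (force simp: dist_bcontfun_le_iff dist_real_def abs_minus_commute)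
    then show "\<exists>k. finite k \<and> Xf act f \<subseteq> (\<Union>\<psi>\<in>k. cball \<psi> e)"
      using k(1) by blast
  qed
  then show "compact (Xf act f)"
    using closed_Xf by (simp add: closure_closed)
qed

section \<open>Weak compactness\<close>

text \<open>Restricting a limit of point evaluations to the translates of \<open>f\<close> produces
  exactly the members of X_f. The kernel is the pairing of these limits with the weak closure of the
  translates, compact by assumption; X_f is then the image of a compact space under a weakly
  continuous map.\<close>

lemma weakly_compact_Xf_if_WAP:
  assumes "WAP act f"
  shows "compactin (weak_topology_on RUC_group) (Xf act f)"
proof -
  let ?w = "weak_topology_on (UNIV :: ('x \<Rightarrow>\<^sub>C real) set)"
  define W where "W = ?w closure_of range (translate act f)"
  define r where "r p = (\<lambda>g. p (translate act f g))" for p :: "('x \<Rightarrow>\<^sub>C real) \<Rightarrow> real"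
  have c_r: "continuous_on A r" for A
    unfolding r_def by (intro continuous_on_coordinatewise_then_product continuous_on_subset[OF continuous_on_product_coordinates subset_UNIV])
  have r_eval: "r (\<lambda>h. apply_bcontfun h x) = f_sharp act f x" for x
    by (simp add: r_def f_sharp_def apply_translate[OF G])
  have r_image: "r ` evaluations = Xfun"
  proof
    show "r ` evaluations \<subseteq> Xfun"
      unfolding evaluations_def
    proof (rule image_closure_subset[OF c_r closed_Xfun])
      show "r ` range (\<lambda>x h. apply_bcontfun h x) \<subseteq> Xfun"
        using f_sharp_in_Xfun by (auto simp: r_eval)
    qed
    have "closed (r ` evaluations)"
      by (rule compact_imp_closed_fun[OF compact_continuous_image[OF c_r compact_evaluations]])
    moreover have "range (f_sharp act f) \<subseteq> r ` evaluations"
      using evaluation_in_evaluations by (auto simp flip: r_eval)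
    ultimately show "Xfun \<subseteq> r ` evaluations"
      unfolding Xfun_eq_closure by (rule closure_minimal[rotated])
  qed
  define \<Phi> where "\<Phi> p = Bcontfun (r p)" for p
  have \<Phi>: "apply_bcontfun (\<Phi> p) = r p" if "p \<in> evaluations" for p
    unfolding \<Phi>_def using r_image that by (intro Xfun_lift) blast
  have \<Phi>_image: "\<Phi> ` evaluations = Xf act f"
  proof
    show "\<Phi> ` evaluations \<subseteq> Xf act f"
      using \<Phi> r_image by (auto simp: Xf_def)
    show "Xf act f \<subseteq> \<Phi> ` evaluations"
    proof
      fix \<psi> assume "\<psi> \<in> Xf act f"
      then obtain p where "p \<in> evaluations" "apply_bcontfun \<psi> = r p"
        using r_image by (auto simp: Xf_def)
      then show "\<psi> \<in> \<Phi> ` evaluations"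
        using \<Phi>[of p] by (intro image_eqI[of _ _ p]) (simp_all flip: apply_bcontfun_inject)
    qed
  qed
  have rW: "range (translate act f) \<subseteq> W"
    unfolding W_def by (rule closure_of_subset) simp
  \<comment> \<open>The norm bound survives weak limits because each point evaluation is weakly
    continuous.\<close>
  have norm_W: "norm w \<le> norm f" if "w \<in> W" for w
  proof (rule norm_bound)
    fix x
    have "closedin ?w {w \<in> topspace ?w. apply_bcontfun w x \<in> {- norm f .. norm f}}"
      by (rule closedin_continuous_map_preimage[OF continuous_map_dual_on[OF evaluation_in_dual_on]]) simp
    moreover have "range (translate act f) \<subseteq> {w \<in> topspace ?w. apply_bcontfun w x \<in> {- norm f .. norm f}}"
      using norm_bounded[of f] by (auto simp: apply_translate[OF G] abs_le_iff minus_le_iff)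
    ultimately have "W \<subseteq> {w \<in> topspace ?w. apply_bcontfun w x \<in> {- norm f .. norm f}}"
      unfolding W_def by (rule closure_of_minimal[rotated])
    then show "norm (w x) \<le> norm f"
      using that by (auto simp: abs_le_iff minus_le_iff)
  qed
  have "continuous_map (top_of_set evaluations) (weak_topology_on RUC_group) \<Phi>"
  proof (rule continuous_map_weak_topology_on_kernel[where T = "subtopology ?w W" and h = "\<lambda>p. p"
        and j = "translate act f" and b = "norm f"])
    show "compact_space (top_of_set (evaluations :: (('x \<Rightarrow>\<^sub>C real) \<Rightarrow> real) set))"
      by (simp add: compact_space_subtopology compact_evaluations)
    show "compact_space (subtopology ?w W)"
      using assms unfolding WAP_def W_def by (rule compact_space_subtopology)
    show "translate act f g \<in> topspace (subtopology ?w W)" for g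
      using rW by auto
    show "\<Phi> p \<in> RUC_group" if "p \<in> topspace (top_of_set evaluations)" for p
      using that \<Phi>_image Xf_subset_RUC_group[OF G f] by auto
    show "apply_bcontfun (\<Phi> p) g = p (translate act f g)" if "p \<in> topspace (top_of_set evaluations)" for p g
      using that \<Phi> by (simp add: r_def)
    show "continuous_map (top_of_set evaluations) euclideanreal (\<lambda>p. p w)" for w :: "'x \<Rightarrow>\<^sub>C real"
      using continuous_on_subset[OF continuous_on_product_coordinates subset_UNIV] by simp
    show "continuous_map (subtopology ?w W) euclideanreal p" if "p \<in> topspace (top_of_set evaluations)" for p
      using that by (intro continuous_map_from_subtopology continuous_map_dual_on evaluations_in_dual_on) simp
    show "\<bar>p w\<bar> \<le> norm f" if "p \<in> topspace (top_of_set evaluations)" "w \<in> topspace (subtopology ?w W)" for p w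
      using that abs_evaluations_le[of p w] norm_W[of w] by simp
  qed (simp_all add: RUC_group_add RUC_group_scaleR RUC_group_abs)
  then have "compactin (weak_topology_on RUC_group) (\<Phi> ` evaluations)"
    by (rule image_compactin[rotated]) (simp add: compactin_subtopology compact_evaluations)
  then show ?thesis
    by (simp only: \<Phi>_image)
qed

text \<open>On the weakly compact X_f the weak and pointwise topologies coincide, since a continuous
  bijection from a compact space onto a Hausdorff one is a homeomorphism. Limits of point
  evaluations on the group thus become continuous functions on \<open>Xfun\<close>, and pulling
  these back to X yields a weakly compact set containing all translates of \<open>f\<close>.\<close>

lemma WAP_if_weakly_compact_Xf:
  assumes cpt: "compactin (weak_topology_on RUC_group) (Xf act f)"
  shows "WAP act f"
proof -
  let ?X = "subtopology (weak_topology_on RUC_group) (Xf act f)"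
  let ?w = "weak_topology_on (UNIV :: ('x \<Rightarrow>\<^sub>C real) set)"
  have XR: "Xf act f \<subseteq> RUC_group"
    by (rule Xf_subset_RUC_group[OF G f])
  have "continuous_map ?X (top_of_set Xfun) apply_bcontfun"
    using continuous_map_from_subtopology[OF continuous_map_apply_bcontfun_weak]
    by (auto simp: continuous_map_in_subtopology Xf_def)
  moreover have "compact_space ?X"
    using cpt by (rule compact_space_subtopology)
  moreover have "Hausdorff_space (top_of_set Xfun)"
    by (rule Hausdorff_space_subtopology[OF Hausdorff_space_fun])
  moreover have "apply_bcontfun ` topspace ?X = topspace (top_of_set Xfun)"
    using apply_bcontfun_Xf[OF G f] XR by (simp add: Int_absorb1)
  moreover have "inj_on apply_bcontfun (topspace ?X)"
    by (auto simp: inj_on_def apply_bcontfun_inject)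
  ultimately have "homeomorphic_map ?X (top_of_set Xfun) apply_bcontfun"
    by (rule continuous_imp_homeomorphic_map)
  then obtain k where k: "homeomorphic_maps ?X (top_of_set Xfun) apply_bcontfun k"
    unfolding homeomorphic_map_maps by blast
  then have ck: "continuous_map (top_of_set Xfun) ?X k"
    and ak: "\<And>\<omega>. \<omega> \<in> Xfun \<Longrightarrow> apply_bcontfun (k \<omega>) = \<omega>"
    by (auto simp: homeomorphic_maps_def)
  have kX: "k \<omega> \<in> Xf act f" if "\<omega> \<in> Xfun" for \<omega>
    using that ak by (simp add: Xf_def)
  have norm_k: "norm (k \<omega>) \<le> norm f" if "\<omega> \<in> Xfun" for \<omega>
    using Xf_Omega_estimate(1)[OF G that] ak[OF that] by (intro norm_bound) simp
  have c_eval: "continuous_map (top_of_set Xfun) euclideanreal (\<lambda>\<omega>. q (k \<omega>))" if q: "q \<in> evaluations" for q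
  proof -
    have "continuous_map ?X euclideanreal q"
      by (intro continuous_map_from_subtopology continuous_map_dual_on evaluations_in_dual_on q)
    then have "continuous_map (top_of_set Xfun) euclideanreal (q \<circ> k)"
      by (rule continuous_map_compose[OF ck])
    then show ?thesis
      by (simp add: o_def)
  qed
  define \<Phi> where "\<Phi> q = Bcontfun (\<lambda>x. q (k (f_sharp act f x)))" for q :: "('g \<Rightarrow>\<^sub>C real) \<Rightarrow> real"
  have \<Phi>: "apply_bcontfun (\<Phi> q) x = q (k (f_sharp act f x))" if q: "q \<in> evaluations" for q x
  proof -
    have "continuous_on Xfun (\<lambda>\<omega>. q (k \<omega>))"
      using c_eval[OF q] by simp
    then have "continuous_on UNIV (\<lambda>x. q (k (f_sharp act f x)))"
      using continuous_on_f_sharp by (rule continuous_on_compose2) (auto simp: f_sharp_in_Xfun)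
    moreover have "norm (q (k (f_sharp act f x))) \<le> norm f" for x
      using abs_evaluations_le[OF q] norm_k[OF f_sharp_in_Xfun] by (metis order_trans real_norm_def)
    ultimately have "(\<lambda>x. q (k (f_sharp act f x))) \<in> bcontfun"
      by (rule bcontfun_normI)
    then show ?thesis
      by (simp add: \<Phi>_def Bcontfun_inverse)
  qed
  have "continuous_map (top_of_set evaluations) ?w \<Phi>"
  proof (rule continuous_map_weak_topology_on_kernel[where T = "top_of_set Xfun" and h = "\<lambda>q \<omega>. q (k \<omega>)"
        and j = "f_sharp act f" and b = "norm f"])
    show "compact_space (top_of_set (evaluations :: (('g \<Rightarrow>\<^sub>C real) \<Rightarrow> real) set))"
      by (simp add: compact_space_subtopology compact_evaluations)
    show "compact_space (top_of_set Xfun)"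
      using compact_Xfun by (simp add: compact_space_subtopology)
    show "\<exists>v\<in>UNIV. \<forall>a. apply_bcontfun v a = \<bar>u a\<bar>" for u :: "'x \<Rightarrow>\<^sub>C real"
      using abs_bcontfun[of u] by (metis UNIV_I)
    show "continuous_map (top_of_set evaluations) euclideanreal (\<lambda>q. q (k \<omega>))" for \<omega>
      using continuous_on_subset[OF continuous_on_product_coordinates subset_UNIV] by simp
    show "\<bar>q (k \<omega>)\<bar> \<le> norm f" if "q \<in> topspace (top_of_set evaluations)" "\<omega> \<in> topspace (top_of_set Xfun)" for q \<omega>
      using that abs_evaluations_le[of q "k \<omega>"] norm_k[of \<omega>] by simp
    show "continuous_map (top_of_set Xfun) euclideanreal (\<lambda>\<omega>. q (k \<omega>))"
      if "q \<in> topspace (top_of_set evaluations)" for q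
      using that by (intro c_eval) simp
  qed (simp_all add: f_sharp_in_Xfun \<Phi>)
  then have cpt\<Phi>: "compactin ?w (\<Phi> ` evaluations)"
    by (rule image_compactin[rotated]) (simp add: compactin_subtopology compact_evaluations)
  have "translate act f g \<in> \<Phi> ` evaluations" for g
  proof (rule image_eqI[OF _ evaluation_in_evaluations[of g]])
    show "translate act f g = \<Phi> (\<lambda>h. apply_bcontfun h g)"
    proof (rule bcontfun_eqI)
      show "translate act f g x = \<Phi> (\<lambda>h. apply_bcontfun h g) x" for x
        unfolding \<Phi>[OF evaluation_in_evaluations] ak[OF f_sharp_in_Xfun] apply_translate[OF G]
        by (simp add: f_sharp_def)
    qed
  qed
  \<comment> \<open>A compact subset of the Hausdorff weak topology is closed, so it contains the
    weak closure as well.\<close>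
  then have "?w closure_of range (translate act f) \<subseteq> \<Phi> ` evaluations"
    using compactin_imp_closedin[OF Hausdorff_space_weak_topology_on cpt\<Phi>]
    by (intro closure_of_minimal) auto
  then show ?thesis
    unfolding WAP_def using cpt\<Phi> by (intro closed_compactin[OF cpt\<Phi>]) auto
qed

section \<open>Fragmentability, local equicontinuity and SUC\<close>

text \<open>The action permutes coordinates, so it preserves uniform distances: a relatively open
  piece of \<open>Z\<close> with small norm diameter has uniformly small translates. Fragmentability
  is applied to \<open>Z\<close> itself.\<close>

lemma Asplund_if_norm_fragmented:
  assumes fr: "norm_fragmented (Xf act f)"
  shows "Asplund act f"
proof (rule Asplund_if_comes_from[OF compact_G_space_Xfun comes_from_Xfun])
  show "HNS_space (top_of_set Xfun) Omega_act"
    unfolding HNS_space_def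
  proof (intro allI impI)
    fix Z E
    assume Z: "Z \<noteq> {} \<and> closedin (top_of_set Xfun) Z \<and> (\<forall>g. Omega_act g ` Z \<subseteq> Z)"
      and E: "eventually E (uniformity_of (top_of_set Xfun))"
    obtain I d where I: "0 < d" "\<And>\<omega> \<omega>'. \<omega> \<in> Xfun \<Longrightarrow> \<omega>' \<in> Xfun \<Longrightarrow>
        (\<And>i. i \<in> I \<Longrightarrow> \<bar>\<omega> i - \<omega>' i\<bar> < d) \<Longrightarrow> E (\<omega>, \<omega>')"
      using fun_entourage[OF compact_Xfun E] by metis
    have ZX: "Z \<subseteq> Xfun"
      using Z closedin_subset by fastforce
    define A where "A = {\<psi>. apply_bcontfun \<psi> \<in> Z}"
    have A: "A \<subseteq> Xf act f"
      using ZX by (auto simp: A_def Xf_def)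
    have lift: "\<exists>\<psi>\<in>A. apply_bcontfun \<psi> = \<omega>" if "\<omega> \<in> Z" for \<omega>
      using that Xfun_cases[of \<omega>] ZX by (metis A_def mem_Collect_eq subsetD)
    then have "A \<noteq> {}"
      using Z by blast
    then obtain U where U: "openin pointwise_topology U" "U \<inter> A \<noteq> {}" "diameter (U \<inter> A) < d"
      using fr A I(1) unfolding norm_fragmented_def by meson
    obtain T where T: "open T" "U = apply_bcontfun -` T"
      using U(1) by (auto simp: openin_pointwise_topology)
    have "openin (subtopology (top_of_set Xfun) Z) (T \<inter> Z)"
      using T(1) ZX by (auto simp: subtopology_subtopology Int_absorb1 openin_open)
    moreover have "T \<inter> Z \<noteq> {}"
      using U(2) T(2) by (auto simp: A_def)
    moreover have "E (Omega_act g \<omega>, Omega_act g \<omega>')" if \<omega>: "\<omega> \<in> T \<inter> Z" "\<omega>' \<in> T \<inter> Z" for g \<omega> \<omega>'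
    proof -
      obtain \<psi> \<psi>' where \<psi>: "\<psi> \<in> A" "apply_bcontfun \<psi> = \<omega>" "\<psi>' \<in> A" "apply_bcontfun \<psi>' = \<omega>'"
        using lift \<omega> by (meson IntD2)
      have "bounded (U \<inter> A)"
        using A by (intro bounded_subset[OF bounded_Xf]) auto
      then have "dist \<psi> \<psi>' \<le> diameter (U \<inter> A)"
        using \<psi> \<omega> T(2) by (intro diameter_bounded_bound) auto
      then have "dist \<psi> \<psi>' < d"
        using U(3) by simp
      then have "\<bar>\<omega> h - \<omega>' h\<bar> < d" for h
        using dist_fun_lt_imp_dist_val_lt[of \<psi> \<psi>' d h] \<psi> by (simp add: dist_real_def)
      then show ?thesis
        using \<omega> ZX by (intro I(2) Omega_act_in_Xfun) (auto simp: Omega_act_def)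
    qed
    ultimately show "\<exists>V. openin (subtopology (top_of_set Xfun) Z) V \<and> V \<noteq> {} \<and>
        (\<forall>g. \<forall>x\<in>V. \<forall>y\<in>V. E (Omega_act g x, Omega_act g y))"
      by blast
  qed
qed

text \<open>Lightness concerns the orbit, local equicontinuity its closure. The non-strict bound
  \<open>d / 2\<close> is a pointwise closed condition, so inside the open set \<open>T\<close> it
  passes from the orbit to its closure and is still below \<open>d\<close> there.\<close>

lemma LE_if_orbitwise_light:
  assumes light: "orbitwise_light (Xf act f)"
  shows "LE act f"
proof (rule LE_if_comes_from[OF compact_G_space_Xfun comes_from_Xfun])
  show "LE_space (top_of_set Xfun) Omega_act"
    unfolding LE_space_def
  proof (intro allI impI ballI)
    fix \<omega> E
    assume "\<omega> \<in> topspace (top_of_set Xfun)"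
      and E: "eventually E (uniformity_of (top_of_set Xfun))"
    then have \<omega>: "\<omega> \<in> Xfun"
      by simp
    obtain I d where I: "0 < d" "\<And>\<omega> \<omega>'. \<omega> \<in> Xfun \<Longrightarrow> \<omega>' \<in> Xfun \<Longrightarrow>
        (\<And>i. i \<in> I \<Longrightarrow> \<bar>\<omega> i - \<omega>' i\<bar> < d) \<Longrightarrow> E (\<omega>, \<omega>')"
      using fun_entourage[OF compact_Xfun E] by metis
    obtain \<psi> where \<psi>: "\<psi> \<in> Xf act f" "apply_bcontfun \<psi> = \<omega>"
      using \<omega> by (rule Xfun_cases)
    have "openin (subtopology euclidean (orbit \<psi>)) (ball \<psi> (d / 2) \<inter> orbit \<psi>)"
      by (auto simp: openin_open)
    moreover have "subtopology pointwise_topology (orbit \<psi>) = subtopology euclidean (orbit \<psi>)"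
      using light \<psi>(1) unfolding orbitwise_light_def by blast
    ultimately have "openin (subtopology pointwise_topology (orbit \<psi>)) (ball \<psi> (d / 2) \<inter> orbit \<psi>)"
      by simp
    then obtain T where T: "open T" "ball \<psi> (d / 2) \<inter> orbit \<psi> = apply_bcontfun -` T \<inter> orbit \<psi>"
      unfolding openin_subtopology openin_pointwise_topology by blast
    have "\<psi> \<in> orbit \<psi>"
      by (auto simp: orbit_def Omega_act_def intro!: exI[of _ 0])
    then have "\<psi> \<in> ball \<psi> (d / 2) \<inter> orbit \<psi>"
      using I(1) by simp
    then have "\<psi> \<in> apply_bcontfun -` T"
      unfolding T(2) by (rule IntD1)
    then have \<omega>T: "\<omega> \<in> T"
      using \<psi>(2) by simp
    define B where "B = {\<omega>'. \<forall>h. \<bar>\<omega> h - \<omega>' h\<bar> \<le> d / 2}"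
    have "closed B"
      unfolding B_def
      by (intro closed_Collect_all closed_Collect_le continuous_intros continuous_on_product_coordinates)
    moreover have "T \<inter> range (\<lambda>g. Omega_act g \<omega>) \<subseteq> B"
    proof
      fix \<omega>' assume "\<omega>' \<in> T \<inter> range (\<lambda>g. Omega_act g \<omega>)"
      then obtain g where g: "\<omega>' = Omega_act g \<omega>" "\<omega>' \<in> T"
        by blast
      obtain \<psi>' where \<psi>': "apply_bcontfun \<psi>' = \<omega>'"
        using Xfun_cases[OF Omega_act_in_Xfun[OF \<omega>, of g]] g(1) by metis
      have "\<psi>' \<in> apply_bcontfun -` T \<inter> orbit \<psi>"
        using g \<psi>' \<psi>(2) by (auto simp: orbit_def)
      then have "\<psi>' \<in> ball \<psi> (d / 2)"
        unfolding T(2)[symmetric] by (rule IntD1)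
      then have "dist \<psi> \<psi>' \<le> d / 2"
        by simp
      then have "\<bar>\<omega> h - \<omega>' h\<bar> \<le> d / 2" for h
        using dist_bounded[of \<psi> h \<psi>'] \<psi>(2) \<psi>' by (simp add: dist_real_def)
      then show "\<omega>' \<in> B"
        by (simp add: B_def)
    qed
    ultimately have "closure (T \<inter> range (\<lambda>g. Omega_act g \<omega>)) \<subseteq> B"
      by (rule closure_minimal[rotated])
    then have TB: "T \<inter> closure (range (\<lambda>g. Omega_act g \<omega>)) \<subseteq> B"
      using open_Int_closure_subset[OF T(1)] by blast
    have "E (Omega_act g \<omega>, Omega_act g \<omega>')"
      if "\<omega>' \<in> T \<inter> Xfun \<inter> (top_of_set Xfun closure_of range (\<lambda>g. Omega_act g \<omega>))" for g \<omega>'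
    proof -
      have "\<omega>' \<in> closure (range (\<lambda>g. Omega_act g \<omega>))"
        using that closure_of_subtopology_subset[of euclidean Xfun] by auto
      then have "\<omega>' \<in> B"
        using TB that by blast
      then have "\<bar>\<omega> h - \<omega>' h\<bar> \<le> d / 2" for h
        by (simp only: B_def mem_Collect_eq)
      then have "\<bar>\<omega> h - \<omega>' h\<bar> < d" for h
        by (rule le_less_trans) (use I(1) in simp)
      then show ?thesis
        using \<omega> that by (intro I(2) Omega_act_in_Xfun) (auto simp: Omega_act_def)
    qed
    then show "\<exists>V. openin (top_of_set Xfun) V \<and> \<omega> \<in> V \<and>
        (\<forall>y\<in>V \<inter> (top_of_set Xfun closure_of range (\<lambda>g. Omega_act g \<omega>)).
          \<forall>g. E (Omega_act g \<omega>, Omega_act g y))"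
      using T(1) \<omega> \<omega>T by (intro exI[of _ "T \<inter> Xfun"]) (auto simp: openin_open)
  qed
qed

text \<open>Acting by \<open>u\<close> and then by \<open>g\<close> evaluates \<omega> at
  \<open>h + g + u\<close>. The supremum over right shifts in \<open>UC_group\<close> therefore
  controls all coordinates \<open>h\<close> and all \<open>g\<close> at once.\<close>

lemma SUC_if_Xf_subset_UC:
  assumes UC: "Xf act f \<subseteq> UC_group"
  shows "SUC act f"
proof (rule SUC_if_comes_from[OF compact_G_space_Xfun comes_from_Xfun])
  show "SUC_space (top_of_set Xfun) Omega_act"
    unfolding SUC_space_def
  proof (intro allI impI ballI)
    fix \<omega> E
    assume "\<omega> \<in> topspace (top_of_set Xfun)"
      and E: "eventually E (uniformity_of (top_of_set Xfun))"
    then have \<omega>: "\<omega> \<in> Xfun"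
      by simp
    obtain I d where I: "0 < d" "\<And>\<omega> \<omega>'. \<omega> \<in> Xfun \<Longrightarrow> \<omega>' \<in> Xfun \<Longrightarrow>
        (\<And>i. i \<in> I \<Longrightarrow> \<bar>\<omega> i - \<omega>' i\<bar> < d) \<Longrightarrow> E (\<omega>, \<omega>')"
      using fun_entourage[OF compact_Xfun E] by metis
    obtain \<psi> where \<psi>: "\<psi> \<in> Xf act f" "apply_bcontfun \<psi> = \<omega>"
      using \<omega> by (rule Xfun_cases)
    have bdd: "bdd_above (range (\<lambda>g. \<bar>\<omega> (g + v) - \<omega> g\<bar>))" for v
    proof (rule bdd_aboveI2)
      show "\<bar>\<omega> (g + v) - \<omega> g\<bar> \<le> 2 * norm f" for g
        using Xf_Omega_estimate(1)[OF G \<omega>, of "g + v"] Xf_Omega_estimate(1)[OF G \<omega>, of g] by linarith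
    qed
    have "\<psi> \<in> UC_group"
      using UC \<psi>(1) by blast
    then have "\<forall>\<^sub>F v in nhds 0. (SUP g. \<bar>\<omega> (v + g) - \<omega> g\<bar>) < d \<and> (SUP g. \<bar>\<omega> (g + v) - \<omega> g\<bar>) < d"
      using I(1) \<psi>(2) by (simp add: UC_group_def)
    then show "\<forall>\<^sub>F u in nhds 0. \<forall>g. E (Omega_act g (Omega_act u \<omega>), Omega_act g \<omega>)"
    proof eventually_elim
      case (elim u)
      show ?case
      proof (intro allI I(2) Omega_act_in_Xfun \<omega>)
        fix g h
        have "\<bar>\<omega> (h + g + u) - \<omega> (h + g)\<bar> \<le> (SUP g. \<bar>\<omega> (g + u) - \<omega> g\<bar>)"
          by (rule cSUP_upper[OF UNIV_I bdd])
        then show "\<bar>Omega_act g (Omega_act u \<omega>) h - Omega_act g \<omega> h\<bar> < d"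
          using elim by (simp add: Omega_act_def)
      qed
    qed
  qed
qed

text \<open>The two halves of uniform continuity have different sources: left shifts are controlled
  by norm continuity of the translates of \<open>f\<close>, right shifts by SUC of \<open>Y\<close>
  tested against \<open>F\<close>, because \<psi> at \<open>g + v\<close> equals
  \<open>F (actY g (actY v y))\<close>.\<close>

lemma Xf_subset_UC_if_SUC:
  assumes "SUC act f"
  shows "Xf act f \<subseteq> UC_group"
proof
  obtain Y :: "'x set set topology" and actY where Y: "compact_G_space Y actY"
    and c: "comes_from act f Y actY" and SUC: "SUC_space Y actY"
    using assms unfolding SUC_def by blast
  obtain F \<phi> where F: "continuous_map Y euclideanreal F"
    and \<phi>: "\<phi> ` topspace Y = Xfun" "\<forall>g y. \<phi> y g = F (actY g y)"
    using factor_map[OF Y c] by blast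
  note \<phi> = \<phi>(1) \<phi>(2)[rule_format]
  have add: "actY (g + h) y = actY g (actY h y)" if "y \<in> topspace Y" for g h y
    using Y that by (simp add: compact_G_space_def G_space_def)
  fix \<psi> assume \<psi>: "\<psi> \<in> Xf act f"
  then obtain y where y: "y \<in> topspace Y" "apply_bcontfun \<psi> = \<phi> y"
    using \<phi>(1) apply_Xf by (metis imageE)
  show "\<psi> \<in> UC_group"
    unfolding UC_group_def
  proof (intro CollectI allI impI)
    fix e :: real assume e: "0 < e"
    have "\<forall>\<^sub>F v in nhds 0. dist (translate act f v) (translate act f 0) < e / 2"
      using translate_tendsto[of 0] e by (intro tendstoD) auto
    moreover have "eventually (\<lambda>(x, y). \<bar>F x - F y\<bar> < e / 2) (uniformity_of Y)"
      using Y F e by (intro eventually_uniformity_of_real) (auto simp: compact_G_space_def G_space_def)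
    then have "\<forall>\<^sub>F u in nhds 0. \<forall>g. (\<lambda>(x, y). \<bar>F x - F y\<bar> < e / 2) (actY g (actY u y), actY g y)"
      using SUC y(1) unfolding SUC_space_def by blast
    ultimately show "\<forall>\<^sub>F v in nhds 0. (SUP g. \<bar>\<psi> (v + g) - \<psi> g\<bar>) < e \<and> (SUP g. \<bar>\<psi> (g + v) - \<psi> g\<bar>) < e"
    proof eventually_elim
      case (elim v)
      have "\<bar>\<psi> (v + g) - \<psi> g\<bar> \<le> e / 2" for g
        using Xf_Omega_estimate(2)[OF G apply_Xf[OF \<psi>], of v g 0] elim(1) by simp
      then have "(SUP g. \<bar>\<psi> (v + g) - \<psi> g\<bar>) \<le> e / 2"
        by (intro cSUP_least) auto
      moreover have "\<bar>\<psi> (g + v) - \<psi> g\<bar> \<le> e / 2" for g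
        using elim(2) y by (simp add: \<phi>(2) add less_imp_le)
      then have "(SUP g. \<bar>\<psi> (g + v) - \<psi> g\<bar>) \<le> e / 2"
        by (intro cSUP_least) auto
      ultimately show ?case
        using e by simp
    qed
  qed
qed

lemma norm_fragmented_if_Asplund:
  assumes "Asplund act f"
  shows "norm_fragmented (Xf act f)"
proof -
  obtain Y :: "'x set set topology" and actY where Y: "compact_G_space Y actY"
    and c: "comes_from act f Y actY" and HNS: "HNS_space Y actY"
    using assms unfolding Asplund_def by blast
  obtain F \<phi> where F: "continuous_map Y euclideanreal F" and c\<phi>: "continuous_map Y euclidean \<phi>"
    and \<phi>: "\<phi> ` topspace Y = Xfun" "\<forall>g y. \<phi> y g = F (actY g y)"
    using factor_map[OF Y c] by blast
  note \<phi> = \<phi>(1) \<phi>(2)[rule_format]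
  have cact: "continuous_map Y Y (actY g)" for g
    using Y continuous_map_G_action[of Y actY g] by (simp add: compact_G_space_def)
  have add: "actY (g + h) y = actY g (actY h y)" if "y \<in> topspace Y" for g h y
    using Y that by (simp add: compact_G_space_def G_space_def)
  have cY: "compact_space Y" "Hausdorff_space Y"
    using Y by (auto simp: compact_G_space_def G_space_def)
  have actY: "actY g y \<in> topspace Y" if "y \<in> topspace Y" for g y
    using cact[of g] that by (auto simp: continuous_map_def)
  \<comment> \<open>Non-sensitivity of the closed invariant set generated by \<open>M\<close>, translated back into \<open>M\<close>.\<close>
  have small: "\<exists>N. openin Y N \<and> N \<inter> M \<noteq> {} \<and> (\<forall>y\<in>N \<inter> M. \<forall>y'\<in>N \<inter> M. \<forall>g. \<bar>\<phi> y g - \<phi> y' g\<bar> < e)"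
    if M: "M \<noteq> {}" "M \<subseteq> topspace Y" and e: "0 < e" for M e
  proof -
    define S where "S = (\<Union>g. actY g ` M)"
    define Z where "Z = Y closure_of S"
    have S: "S \<subseteq> topspace Y"
      using M(2) actY by (auto simp: S_def)
    then have SZ: "S \<subseteq> Z"
      unfolding Z_def by (rule closure_of_subset)
    have "actY g ` S \<subseteq> S" for g
    proof
      fix z assume "z \<in> actY g ` S"
      then obtain h y where "y \<in> M" "z = actY g (actY h y)"
        by (auto simp: S_def)
      then have "z = actY (g + h) y"
        using add M(2) by auto
      then show "z \<in> S"
        using \<open>y \<in> M\<close> by (auto simp: S_def)
    qed
    then have "actY g ` Z \<subseteq> Z" for g
      using continuous_map_image_closure_subset[OF cact[of g], of S] closure_of_mono[of "actY g ` S" S Y]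
      by (auto simp: Z_def)
    moreover have "Z \<noteq> {}"
      using SZ M(1) by (auto simp: S_def)
    moreover have "closedin Y Z"
      by (simp add: Z_def)
    moreover have "eventually (\<lambda>(x, y). \<bar>F x - F y\<bar> < e) (uniformity_of Y)"
      by (rule eventually_uniformity_of_real[OF cY F e])
    ultimately have "\<exists>V. openin (subtopology Y Z) V \<and> V \<noteq> {} \<and>
        (\<forall>g. \<forall>x\<in>V. \<forall>y\<in>V. (\<lambda>(x, y). \<bar>F x - F y\<bar> < e) (actY g x, actY g y))"
      using HNS unfolding HNS_space_def by blast
    then obtain V where V: "openin (subtopology Y Z) V" "V \<noteq> {}"
        "\<forall>g. \<forall>x\<in>V. \<forall>y\<in>V. \<bar>F (actY g x) - F (actY g y)\<bar> < e"
      unfolding prod.case by meson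
    obtain T where T: "openin Y T" "V = T \<inter> Z"
      using V(1) by (auto simp: openin_subtopology)
    obtain z where "z \<in> T" "z \<in> Z"
      using V(2) T(2) by blast
    then obtain s where "s \<in> S" "s \<in> T"
      using T(1) unfolding Z_def by (meson in_closure_of)
    then obtain k y0 where y0: "y0 \<in> M" "actY k y0 \<in> T"
      by (auto simp: S_def)
    \<comment> \<open>The open set \<open>T\<close> meets the invariant hull of \<open>M\<close>
      only at a translate by \<open>k\<close>; its preimage under \<open>k\<close> meets
      \<open>M\<close> itself.\<close>
    define N where "N = {y \<in> topspace Y. actY k y \<in> T}"
    have "openin Y N"
      unfolding N_def using cact T(1) by (rule openin_continuous_map_preimage)
    moreover have "y0 \<in> N \<inter> M"
      using y0 M(2) by (auto simp: N_def)
    moreover have "\<bar>\<phi> y g - \<phi> y' g\<bar> < e" if y: "y \<in> N \<inter> M" "y' \<in> N \<inter> M" for y y' g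
    proof -
      have kV: "actY k x \<in> V" if "x \<in> N \<inter> M" for x
      proof -
        have "actY k x \<in> S"
          using that by (auto simp: S_def)
        then show ?thesis
          using that SZ T(2) by (auto simp: N_def)
      qed
      \<comment> \<open>Smallness of \<open>V\<close> holds under every group element, so
        \<open>g - k\<close> can be used to undo the translation by \<open>k\<close>.\<close>
      have "actY g x = actY (g - k) (actY k x)" if "x \<in> N \<inter> M" for x
        using that add[of x "g - k" k] by (auto simp: N_def)
      then show ?thesis
        using V(3)[rule_format, OF kV[OF y(1)] kV[OF y(2)], of "g - k"] y by (simp add: \<phi>(2))
    qed
    ultimately show ?thesis
      by blast
  qed
  show ?thesis
    unfolding norm_fragmented_def
  proof (intro allI impI)
    fix A :: "('g \<Rightarrow>\<^sub>C real) set" and e :: real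
    assume A: "A \<noteq> {} \<and> A \<subseteq> Xf act f" and e: "0 < e"
    define C where "C = closure (apply_bcontfun ` A)"
    have AC: "apply_bcontfun ` A \<subseteq> C"
      unfolding C_def by (rule closure_subset)
    have CX: "C \<subseteq> Xfun"
      unfolding C_def using A closed_Xfun by (intro closure_minimal) (auto simp: Xf_def)
    define fibre where "fibre \<omega> = {y \<in> topspace Y. \<phi> y \<in> {\<omega>}}" for \<omega>
    have "closed {\<omega>}" for \<omega> :: "'g \<Rightarrow> real"
      by (rule compact_imp_closed_fun) simp
    then have fib_closed: "closedin Y (fibre \<omega>)" for \<omega>
      unfolding fibre_def by (intro closedin_continuous_map_preimage[OF c\<phi>]) simp
    have fib_ne: "fibre \<omega> \<noteq> {}" if \<omega>: "\<omega> \<in> C" for \<omega>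
    proof -
      have "\<omega> \<in> \<phi> ` topspace Y"
        using CX \<omega> \<phi>(1) by blast
      then show ?thesis
        by (auto simp: fibre_def)
    qed
    \<comment> \<open>The conjunct \<open>True\<close> is the trivial instance of \<open>R\<close>
      in \<open>minimal_closed_set\<close>.\<close>
    have "\<exists>M. closedin Y M \<and> True \<and> (\<forall>D\<in>fibre ` C. M \<inter> D \<noteq> {}) \<and>
        (\<forall>M'. closedin Y M' \<longrightarrow> True \<longrightarrow> (\<forall>D\<in>fibre ` C. M' \<inter> D \<noteq> {}) \<longrightarrow> M' \<subseteq> M \<longrightarrow> M' = M)"
      by (rule minimal_closed_set[OF cY(1)]) (use fib_closed fib_ne in auto)
    then obtain M where M': "closedin Y M" "\<forall>\<omega>\<in>C. M \<inter> fibre \<omega> \<noteq> {}"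
        "\<forall>M'. closedin Y M' \<longrightarrow> (\<forall>\<omega>\<in>C. M' \<inter> fibre \<omega> \<noteq> {}) \<longrightarrow> M' \<subseteq> M \<longrightarrow> M' = M"
      by auto
    note M = M'(1) M'(2,3)[rule_format]
    have "C \<noteq> {}"
      using AC A by blast
    then have "M \<noteq> {}"
      using M(2) by blast
    from small[OF this closedin_subset[OF M(1)] half_gt_zero[OF e]]
    obtain N where N: "openin Y N" "N \<inter> M \<noteq> {}"
        "\<forall>y\<in>N \<inter> M. \<forall>y'\<in>N \<inter> M. \<forall>g. \<bar>\<phi> y g - \<phi> y' g\<bar> < e / 2"
      by (elim exE conjE)
    have MN: "closedin Y (M - N)"
      using M(1) N(1) by (rule closedin_diff)
    then have "M - N \<noteq> M"
      using N(2) by blast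
    then obtain \<omega>0 where \<omega>0: "\<omega>0 \<in> C" "(M - N) \<inter> fibre \<omega>0 = {}"
      using M(3)[OF MN] by blast
    \<comment> \<open>By minimality, removing \<open>N\<close> from \<open>M\<close> empties the
      fibre over \<open>\<omega>0\<close>, so \<open>T\<close> is a neighbourhood of
      \<open>\<omega>0\<close>. Points of \<open>M\<close> lying over \<open>T\<close> belong to
      \<open>N\<close>.\<close>
    define T where "T = - \<phi> ` (M - N)"
    have "compactin euclidean (\<phi> ` (M - N))"
      using c\<phi> closedin_compact_space[OF cY(1) MN] by (rule image_compactin[rotated])
    then have T: "open T"
      unfolding T_def by (simp add: compact_imp_closed_fun open_Compl)
    have "\<omega>0 \<in> T"
      using \<omega>0(2) closedin_subset[OF M(1)] by (auto simp: T_def fibre_def)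
    then have "T \<inter> apply_bcontfun ` A \<noteq> {}"
      using \<omega>0(1) T open_Int_closure_eq_empty[of T "apply_bcontfun ` A"] by (auto simp: C_def)
    then have "apply_bcontfun -` T \<inter> A \<noteq> {}"
      by blast
    moreover have "openin pointwise_topology (apply_bcontfun -` T)"
      using T by (auto simp: openin_pointwise_topology)
    moreover have "diameter (apply_bcontfun -` T \<inter> A) \<le> e / 2"
    proof (rule diameter_le)
      fix \<psi> \<psi>' assume \<psi>: "\<psi> \<in> apply_bcontfun -` T \<inter> A" "\<psi>' \<in> apply_bcontfun -` T \<inter> A"
      have lift: "\<exists>y\<in>N \<inter> M. \<phi> y = apply_bcontfun \<psi>" if "\<psi> \<in> apply_bcontfun -` T \<inter> A" for \<psi>
      proof -
        have "apply_bcontfun \<psi> \<in> C"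
          using AC that by blast
        then obtain y where y: "y \<in> M" "\<phi> y = apply_bcontfun \<psi>"
          using M(2) by (fastforce simp: fibre_def)
        moreover have "y \<in> N"
          using that y by (force simp: T_def)
        ultimately show ?thesis
          by blast
      qed
      obtain y y' where "y \<in> N \<inter> M" "\<phi> y = apply_bcontfun \<psi>" "y' \<in> N \<inter> M" "\<phi> y' = apply_bcontfun \<psi>'"
        using lift \<psi> by meson
      then have "dist (\<psi> g) (\<psi>' g) \<le> e / 2" for g
        using N(3)[rule_format, of y y' g] by (simp add: dist_real_def)
      then show "norm (\<psi> - \<psi>') \<le> e / 2"
        unfolding dist_norm[symmetric] by (rule dist_bound)
    qed (use e in simp)
    ultimately show "\<exists>U. openin pointwise_topology U \<and> U \<inter> A \<noteq> {} \<and> diameter (U \<inter> A) < e"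
      using e by (intro exI[of _ "apply_bcontfun -` T"]) auto
  qed
qed

text \<open>
  The factor of a locally equicontinuous space is again locally equicontinuous: inside a minimal closed
  invariant set over \<open>\<psi>\<close>, every point over \<open>\<psi>\<close> has the same orbit closure, so that local
  equicontinuity is available at all points of the fibre simultaneously.
\<close>

lemma orbitwise_light_if_LE:
  assumes "LE act f"
  shows "orbitwise_light (Xf act f)"
proof -
  obtain Y :: "'x set set topology" and actY where Y: "compact_G_space Y actY"
    and c: "comes_from act f Y actY" and LE: "LE_space Y actY"
    using assms unfolding LE_def by blast
  obtain F \<phi> where F: "continuous_map Y euclideanreal F" and c\<phi>: "continuous_map Y euclidean \<phi>"
    and \<phi>: "\<phi> ` topspace Y = Xfun" "\<forall>g y. \<phi> y g = F (actY g y)"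
    and equi: "\<forall>g. \<forall>y\<in>topspace Y. \<phi> (actY g y) = Omega_act g (\<phi> y)"
    using factor_map[OF Y c] by blast
  note \<phi> = \<phi>(1) \<phi>(2)[rule_format]
  have cact: "continuous_map Y Y (actY g)" for g
    using Y continuous_map_G_action[of Y actY g] by (simp add: compact_G_space_def)
  have zero: "actY 0 y = y" and add: "actY (g + h) y = actY g (actY h y)" if "y \<in> topspace Y" for g h y
    using Y that by (simp_all add: compact_G_space_def G_space_def)
  have cY: "compact_space Y" "Hausdorff_space Y"
    using Y by (auto simp: compact_G_space_def G_space_def)
  have actY: "actY g y \<in> topspace Y" if "y \<in> topspace Y" for g y
    using cact[of g] that by (auto simp: continuous_map_def)
  have key: "\<exists>T. open T \<and> \<omega> \<in> T \<and> (\<forall>h. Omega_act h \<omega> \<in> T \<longrightarrow> (\<forall>g. \<bar>\<omega> g - Omega_act h \<omega> g\<bar> < e))"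
    if \<omega>: "\<omega> \<in> Xfun" and e: "0 < e" for \<omega> e
  proof -
    define fibre where "fibre = {y \<in> topspace Y. \<phi> y \<in> {\<omega>}}"
    have "closed {\<omega>}"
      by (rule compact_imp_closed_fun) simp
    then have fib_closed: "closedin Y fibre"
      unfolding fibre_def by (intro closedin_continuous_map_preimage[OF c\<phi>]) simp
    have "\<omega> \<in> \<phi> ` topspace Y"
      using \<omega> \<phi>(1) by simp
    then have fib_ne: "fibre \<noteq> {}"
      by (auto simp: fibre_def)
    define inv where "inv M \<longleftrightarrow> (\<forall>g. actY g ` M \<subseteq> M)" for M
    have "inv (topspace Y)"
      using actY by (auto simp: inv_def)
    moreover have "inv (\<Inter>\<M>)" if "\<M> \<noteq> {}" "\<And>M. M \<in> \<M> \<Longrightarrow> inv M" for \<M>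
      using that(2) unfolding inv_def by blast
    ultimately obtain M where M': "closedin Y M" "inv M" "M \<inter> fibre \<noteq> {}"
        "\<forall>M'. closedin Y M' \<longrightarrow> inv M' \<longrightarrow> M' \<inter> fibre \<noteq> {} \<longrightarrow> M' \<subseteq> M \<longrightarrow> M' = M"
      using minimal_closed_set[OF cY(1), of "{fibre}" inv] fib_closed fib_ne by auto
    note M = M'(1,2,3) M'(4)[rule_format]
    \<comment> \<open>The orbit closure is itself closed, invariant, inside \<open>M\<close>, and
      meets the fibre, so minimality makes it all of \<open>M\<close>.\<close>
    have clo: "Y closure_of range (\<lambda>g. actY g y) = M" if y: "y \<in> M \<inter> fibre" for y
    proof (rule M(4))
      let ?O = "range (\<lambda>g. actY g y)"
      have yY: "y \<in> topspace Y"
        using y by (simp add: fibre_def)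
      have O: "?O \<subseteq> topspace Y"
        using actY[OF yY] by auto
      show "closedin Y (Y closure_of ?O)"
        by simp
      have inv_O: "actY g ` ?O \<subseteq> ?O" for g
      proof
        fix z assume "z \<in> actY g ` ?O"
        then obtain h where "z = actY g (actY h y)"
          by auto
        then have "z = actY (g + h) y"
          using add[OF yY] by simp
        then show "z \<in> ?O"
          by blast
      qed
      show "inv (Y closure_of ?O)"
        unfolding inv_def
      proof
        fix g
        have "actY g ` (Y closure_of ?O) \<subseteq> Y closure_of (actY g ` ?O)"
          by (rule continuous_map_image_closure_subset[OF cact])
        also have "\<dots> \<subseteq> Y closure_of ?O"
          by (rule closure_of_mono[OF inv_O])
        finally show "actY g ` (Y closure_of ?O) \<subseteq> Y closure_of ?O" .
      qed
      have "y \<in> ?O"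
        by (rule range_eqI[of _ _ 0]) (simp add: zero[OF yY])
      then have "y \<in> Y closure_of ?O"
        using closure_of_subset[OF O] by blast
      then show "Y closure_of ?O \<inter> fibre \<noteq> {}"
        using y by blast
      have "?O \<subseteq> M"
        using M(2) y by (auto simp: inv_def)
      then show "Y closure_of ?O \<subseteq> M"
        using M(1) by (rule closure_of_minimal)
    qed
    have "\<exists>V. openin Y V \<and> y \<in> V \<and> (\<forall>z\<in>V \<inter> M. \<forall>g. \<bar>\<omega> g - \<phi> z g\<bar> < e)"
      if y: "y \<in> M \<inter> fibre" for y
    proof -
      have yY: "y \<in> topspace Y" "\<phi> y = \<omega>"
        using y by (auto simp: fibre_def)
      have "eventually (\<lambda>(x, y). \<bar>F x - F y\<bar> < e) (uniformity_of Y)"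
        by (rule eventually_uniformity_of_real[OF cY F e])
      from LE[unfolded LE_space_def, rule_format, OF yY(1) this]
      obtain V where "openin Y V" "y \<in> V" "\<forall>z\<in>V \<inter> M. \<forall>g. \<bar>F (actY g y) - F (actY g z)\<bar> < e"
        unfolding clo[OF y] prod.case by meson
      then show ?thesis
        unfolding yY(2)[symmetric] \<phi>(2) by (intro exI[of _ V] conjI)
    qed
    then obtain V where V: "\<And>y. y \<in> M \<inter> fibre \<Longrightarrow> openin Y (V y) \<and> y \<in> V y"
        "\<And>y z g. y \<in> M \<inter> fibre \<Longrightarrow> z \<in> V y \<inter> M \<Longrightarrow> \<bar>\<omega> g - \<phi> z g\<bar> < e"
      by metis
    \<comment> \<open>\<open>N\<close> covers the whole fibre in \<open>M\<close>, so \<omega>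
      avoids the compact image of \<open>M - N\<close>. If a translate of \<omega> avoids it too,
      the corresponding translate of a fibre point lies in \<open>M\<close>, hence in some
      \<open>V y\<close>.\<close>
    define N where "N = (\<Union>y\<in>M \<inter> fibre. V y)"
    have "openin Y N"
      unfolding N_def using V(1) by (intro openin_Union) auto
    with M(1) have "closedin Y (M - N)"
      by (rule closedin_diff)
    then have "compactin euclidean (\<phi> ` (M - N))"
      using c\<phi> by (intro image_compactin[OF closedin_compact_space[OF cY(1)]])
    then have "open (- \<phi> ` (M - N))"
      by (simp add: compact_imp_closed_fun open_Compl)
    moreover have "\<omega> \<in> - \<phi> ` (M - N)"
    proof
      assume "\<omega> \<in> \<phi> ` (M - N)"
      then obtain y where y: "y \<in> M" "y \<notin> N" "\<phi> y = \<omega>"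
        by blast
      then have "y \<in> M \<inter> fibre"
        using closedin_subset[OF M(1)] by (auto simp: fibre_def)
      then show False
        using V(1) y(2) by (auto simp: N_def)
    qed
    moreover have "\<bar>\<omega> g - Omega_act h \<omega> g\<bar> < e" if h: "Omega_act h \<omega> \<in> - \<phi> ` (M - N)" for h g
    proof -
      obtain y where y: "y \<in> M" "y \<in> topspace Y" "\<phi> y = \<omega>"
        using M(3) by (auto simp: fibre_def)
      have "actY h y \<in> M"
        using M(2) y(1) by (auto simp: inv_def)
      moreover have "\<phi> (actY h y) = Omega_act h \<omega>"
        using equi y(2,3) by simp
      ultimately show ?thesis
        using h V(2)[of _ "actY h y" g] by (force simp: N_def)
    qed
    ultimately show ?thesis
      by blast
  qed
  show ?thesis
    unfolding orbitwise_light_def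
  proof (intro ballI)
    fix \<psi> assume "\<psi> \<in> Xf act f"
    then have \<psi>: "apply_bcontfun \<psi> \<in> Xfun"
      by (simp add: Xf_def)
    have "openin (subtopology pointwise_topology (orbit \<psi>)) S \<longleftrightarrow> openin (subtopology euclidean (orbit \<psi>)) S" for S
    proof
      assume "openin (subtopology pointwise_topology (orbit \<psi>)) S"
      then obtain T where "open T" "S = apply_bcontfun -` T \<inter> orbit \<psi>"
        unfolding openin_subtopology openin_pointwise_topology by blast
      then show "openin (subtopology euclidean (orbit \<psi>)) S"
        using open_vimage[OF _ continuous_on_apply_bcontfun_fun] by (auto simp: openin_open)
    next
      assume S: "openin (subtopology euclidean (orbit \<psi>)) S"
      have "\<exists>T. open T \<and> apply_bcontfun \<theta> \<in> T \<and> apply_bcontfun -` T \<inter> orbit \<psi> \<subseteq> S" if \<theta>: "\<theta> \<in> S" for \<theta>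
      proof -
        obtain e where e: "0 < e" "ball \<theta> e \<inter> orbit \<psi> \<subseteq> S"
          using S \<theta> unfolding openin_contains_ball by blast
        obtain k where k: "apply_bcontfun \<theta> = Omega_act k (apply_bcontfun \<psi>)"
          using S \<theta> openin_imp_subset by (fastforce simp: orbit_def)
        obtain T where T: "open T" "apply_bcontfun \<theta> \<in> T" "\<And>h. Omega_act h (apply_bcontfun \<theta>) \<in> T
            \<Longrightarrow> \<forall>g. \<bar>\<theta> g - Omega_act h (apply_bcontfun \<theta>) g\<bar> < e / 2"
          \<comment> \<open>The neighbourhood is centred at \<theta>, not at \<psi>. Both have the
            same orbit, and an element reached from \<psi> by \<open>h\<close> is reached from
            \<theta> by \<open>h - k\<close>.\<close>
          using key[OF Omega_act_in_Xfun[OF \<psi>, of k], of "e / 2"] e(1) by (auto simp flip: k)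
        have "\<theta>' \<in> S" if \<theta>': "\<theta>' \<in> apply_bcontfun -` T \<inter> orbit \<psi>" for \<theta>'
        proof -
          obtain h where h: "apply_bcontfun \<theta>' = Omega_act h (apply_bcontfun \<psi>)"
            using \<theta>' by (auto simp: orbit_def)
          have "apply_bcontfun \<theta>' = Omega_act (h - k) (apply_bcontfun \<theta>)"
            unfolding h k by (simp flip: Omega_act_add)
          then have "\<forall>g. \<bar>\<theta> g - \<theta>' g\<bar> < e / 2"
            using T(3)[of "h - k"] \<theta>' by simp
          then have "dist (\<theta> g) (\<theta>' g) \<le> e / 2" for g
            using less_imp_le by (auto simp only: dist_real_def)
          then have "dist \<theta> \<theta>' \<le> e / 2"
            by (rule dist_bound)
          then show ?thesis
            using e \<theta>' by auto
        qed
        then show ?thesis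
          using T by blast
      qed
      then obtain T where T: "\<And>\<theta>. \<theta> \<in> S \<Longrightarrow> open (T \<theta>)" "\<And>\<theta>. \<theta> \<in> S \<Longrightarrow> apply_bcontfun \<theta> \<in> T \<theta>"
          "\<And>\<theta>. \<theta> \<in> S \<Longrightarrow> apply_bcontfun -` T \<theta> \<inter> orbit \<psi> \<subseteq> S"
        by metis
      have "S = apply_bcontfun -` (\<Union>\<theta>\<in>S. T \<theta>) \<inter> orbit \<psi>"
        using T(2,3) openin_imp_subset[OF S] by blast
      moreover have "open (\<Union>\<theta>\<in>S. T \<theta>)"
        using T(1) by blast
      ultimately show "openin (subtopology pointwise_topology (orbit \<psi>)) S"
        unfolding openin_subtopology openin_pointwise_topology by blast
    qed
    then show "subtopology pointwise_topology (orbit \<psi>) = subtopology euclidean (orbit \<psi>)"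
      by (simp add: topology_eq)
  qed
qed

end

theorem theorem7p12:
  fixes act :: "'g::topological_group_add \<Rightarrow> 'x::topological_space \<Rightarrow> 'x"
    and f :: "'x \<Rightarrow>\<^sub>C real"
  assumes "G_space euclidean act"
    and "f \<in> RUC act"
  shows "(compact (Xf act f) \<longleftrightarrow> AP act f) \<and>
         (compactin (weak_topology_on RUC_group) (Xf act f) \<longleftrightarrow> WAP act f) \<and>
         (norm_fragmented (Xf act f) \<longleftrightarrow> Asplund act f) \<and>
         (orbitwise_light (Xf act f) \<longleftrightarrow> LE act f) \<and>
         (Xf act f \<subseteq> UC_group \<longleftrightarrow> SUC act f)"
proof -
  interpret ruc_function act f
    by unfold_locales (rule assms)+
  show ?thesis
    using compact_Xf_iff_AP weakly_compact_Xf_if_WAP WAP_if_weakly_compact_Xf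
      Asplund_if_norm_fragmented norm_fragmented_if_Asplund
      LE_if_orbitwise_light orbitwise_light_if_LE SUC_if_Xf_subset_UC Xf_subset_UC_if_SUC
    by blast
qed

end
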